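(* Let $g\ge1$. The topological space $\mathcal T_g^{tr,p}$ (the pure tropical Teichmüller space) is an ideal stacky fan with cells $\mathcal C^0_{(\Gamma,h)}$, where $(\Gamma,h)$ runs over the equivalence classes of stable marked graphs of genus $g$. It parametrizes marked pure tropical curves of genus $g$, i.e. its points are in bijection with equivalence classes of marked pure tropical curves $(\Gamma,l,h)$ of genus $g$, with $(\Gamma,l,h)$ corresponding to $l\in\mathcal C^0_{(\Gamma,h)}$.
   Context: Graphs are finite and connected, loops and multiple edges allowed; the genus of $\Gamma$ is $|E(\Gamma)|-|V(\Gamma)|+1$; a loop counts twice in the valence. A graph is stable if every vertex has valence at least $3$. $R_g$ is the rose with one vertex and $g$ loops. A marking of a graph $\Gamma$ of genus $g$ is a homotopy equivalence $h:R_g\to\Gamma$. Marked graphs $(\Gamma,h),(\Gamma',h')$ are equivalent if there is an isomorphism $\gamma:\Gamma\to\Gamma'$ of graphs (1-complexes) with $\gamma\circ h$ homotopic to $h'$. A pure tropical curve of genus $g$ is a pair $(\Gamma,l)$ with $\Gamma$ stable of genus $g$ and $l:E(\Gamma)\to\mathbb R_{>0}$; marked pure tropical curves $(\Gamma,l,h)$ are equivalent if there is such a $\gamma$ that is an isometry. For a stable marked graph $(\Gamma,h)$ let $\mathcal C^0_{(\Gamma,h)}=\mathbb R_{>0}^{E(\Gamma)}$ and let $\mathcal C_{(\Gamma,h)}=\{l\in\mathbb R_{\ge0}^{E(\Gamma)}:l^{-1}(0)\text{ contains no cycle of }\Gamma\}$, in $\mathbb R^{E(\Gamma)}$ with lattice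 $\mathbb Z^{E(\Gamma)}$. $(\Gamma,h)$ specializes to $(\Gamma',h')$ if there is a surjective map $\pi:\Gamma\to\Gamma'$ contracting an acyclic subgraph (a forest) with $\pi\circ h$ homotopic to $h'$; the resulting inclusion $E(\Gamma')\hookrightarrow E(\Gamma)$ induces a linear map $L_\iota:\mathcal C_{(\Gamma',h')}\hookrightarrow\mathcal C_{(\Gamma,h)}$ onto a face. $\mathcal T_g^{tr,p}=(\coprod\mathcal C_{(\Gamma,h)})/\!\approx$ with the quotient topology, the disjoint union over equivalence classes of stable marked graphs of genus $g$ and $\approx$ generated by all maps $L_\iota$ of specializations. Ideal stacky fan: an ideal cone $\sigma$ is obtained from a rational polyhedral cone (in a finite-dimensional real vector space with lattice) by removing some proper faces; $\sigma^0$ is its relative interior; faces of $\sigma$ are intersections of $\sigma$ with faces of its closure. A linear map $L:V\to V'$ (lattices $N,N'$) is a lattice-preserving inclusion $\sigma\hookrightarrow\sigma'$ if it maps $\sigma$ bijectively onto a face of $\sigma'$ and $L(N\cap\operatorname{span}\sigma)=N'\cap L(\operatorname{span}\sigma)$. Given ideal cones $\sigma_i$ and lattice-preserving inclusions $L_\alpha:\sigma_i\hookrightarrow\sigma_j$, the space $X=(\coprod\sigma_i)/\!\sim$ ($\sim$ generated by $x\sim L_\alpha(x)$) is an ideal stacky fan with cells $\sigma_i^0/\!\sim$ if $X=\coprod(\sigma_i^0/\!\sim)$ as sets. That the cells are $\mathcal C^0_{(\Gamma,h)}$ means that no two distinct points of $\mathcal C^0_{(\Gamma,h)}$ are identified.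 *)

theory Defs
  imports
    "HOL-Analysis.Analysis"
    "HOL-Analysis.Finite_Function_Topology"
    "Graph_Theory.Bidirected_Digraph"
    "Graph_Theory.Digraph_Component"
begin

section \<open>Topological preliminaries\<close>

text \<open>The final topology on \<^term>\<open>S\<close> for the maps \<^term>\<open>f i\<close> from \<^term>\<open>X i\<close> to \<^term>\<open>S\<close>, \<^term>\<open>i \<in> I\<close>.\<close>

definition final_topology ::
  "'b set \<Rightarrow> 'i set \<Rightarrow> ('i \<Rightarrow> 'a topology) \<Rightarrow> ('i \<Rightarrow> 'a \<Rightarrow> 'b) \<Rightarrow> 'b topology" where
  "final_topology S I X f =
     topology (\<lambda>U. U \<subseteq> S \<and> (\<forall>i \<in> I. openin (X i) {x \<in> topspace (X i). f i x \<in> U}))"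

lemma openin_final_topology:
  "openin (final_topology S I X f) U \<longleftrightarrow>
     U \<subseteq> S \<and> (\<forall>i \<in> I. openin (X i) {x \<in> topspace (X i). f i x \<in> U})"
proof -
  have 1: "{x \<in> topspace (X i). f i x \<in> U \<inter> V} =
      {x \<in> topspace (X i). f i x \<in> U} \<inter> {x \<in> topspace (X i). f i x \<in> V}" for i U V
    by auto
  have 2: "{x \<in> topspace (X i). f i x \<in> \<Union>K} = (\<Union>U\<in>K. {x \<in> topspace (X i). f i x \<in> U})" for i K
    by auto
  have "istopology (\<lambda>U. U \<subseteq> S \<and> (\<forall>i \<in> I. openin (X i) {x \<in> topspace (X i). f i x \<in> U}))"
    unfolding istopology_def 1 2 by blast
  then show ?thesis by (simp add: final_topology_def)
qed

lemma topspace_final_topology: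
  assumes "\<And>i. i \<in> I \<Longrightarrow> f i ` topspace (X i) \<subseteq> S"
  shows "topspace (final_topology S I X f) = S"
proof -
  have "{x \<in> topspace (X i). f i x \<in> S} = topspace (X i)" if "i \<in> I" for i
    using assms[OF that] by auto
  then have "openin (final_topology S I X f) S"
    by (simp add: openin_final_topology)
  then show ?thesis
    by (meson openin_final_topology openin_subset openin_topspace subset_antisym)
qed

definition quotient_topology :: "'a topology \<Rightarrow> ('a \<times> 'a) set \<Rightarrow> 'a set topology" where
  "quotient_topology X r = final_topology (topspace X // r) {()} (\<lambda>_. X) (\<lambda>_ x. r `` {x})"

lemma topspace_quotient_topology [simp]: "topspace (quotient_topology X r) = topspace X // r"
  unfolding quotient_topology_def by (rule topspace_final_topology) (auto intro: quotientI)

lemma quotient_map_quotient_topology: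
  "quotient_map X (quotient_topology X r) (\<lambda>x. r `` {x})"
proof -
  have "(\<lambda>x. r `` {x}) ` topspace X = topspace X // r"
    by (auto simp: quotient_def)
  then show ?thesis
    unfolding quotient_map_def topspace_quotient_topology
    by (simp add: quotient_topology_def openin_final_topology)
qed

definition homotopy_equivalence_map :: "'a topology \<Rightarrow> 'b topology \<Rightarrow> ('a \<Rightarrow> 'b) \<Rightarrow> bool" where
  "homotopy_equivalence_map X Y f \<longleftrightarrow>
     (\<exists>g. continuous_map X Y f \<and> continuous_map Y X g \<and>
          homotopic_with (\<lambda>_. True) X X (g \<circ> f) id \<and>
          homotopic_with (\<lambda>_. True) Y Y (f \<circ> g) id)"

section \<open>Graphs\<close>

text \<open>
  An undirected multigraph with loops is given by a digraph together with a fixed-point free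
  involution on its arcs: the two arcs \<^term>\<open>a\<close> and \<open>ug_rev G a\<close> are the two orientations of
  one edge. In particular isomorphisms may reverse loops, and
  the valence (loops counted twice) of a vertex is its out-degree.
\<close>

record ('v, 'a) ugraph =
  ug_dig :: "('v, 'a) pre_digraph"
  ug_rev :: "'a \<Rightarrow> 'a"

abbreviation ug_verts :: "('v, 'a) ugraph \<Rightarrow> 'v set" where
  "ug_verts G \<equiv> verts (ug_dig G)"

abbreviation ug_arcs :: "('v, 'a) ugraph \<Rightarrow> 'a set" where
  "ug_arcs G \<equiv> arcs (ug_dig G)"

abbreviation ug_tail :: "('v, 'a) ugraph \<Rightarrow> 'a \<Rightarrow> 'v" where
  "ug_tail G \<equiv> tail (ug_dig G)"

abbreviation ug_head :: "('v, 'a) ugraph \<Rightarrow> 'a \<Rightarrow> 'v" where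
  "ug_head G \<equiv> head (ug_dig G)"

definition ug_edge :: "('v, 'a) ugraph \<Rightarrow> 'a \<Rightarrow> 'a set" where
  "ug_edge G a = {a, ug_rev G a}"

definition ug_edges :: "('v, 'a) ugraph \<Rightarrow> 'a set set" where
  "ug_edges G = ug_edge G ` ug_arcs G"

definition finite_connected_graph :: "('v, 'a) ugraph \<Rightarrow> bool" where
  "finite_connected_graph G \<longleftrightarrow>
     bidirected_digraph (ug_dig G) (ug_rev G) \<and> fin_digraph (ug_dig G) \<and>
     Digraph_Component.connected (ug_dig G)"

definition genus :: "('v, 'a) ugraph \<Rightarrow> int" where
  "genus G = int (card (ug_edges G)) - int (card (ug_verts G)) + 1"

definition stable_graph :: "('v, 'a) ugraph \<Rightarrow> bool" where
  "stable_graph G \<longleftrightarrow> (\<forall>v \<in> ug_verts G. 3 \<le> out_degree (ug_dig G) v)"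

text \<open>
  \<^term>\<open>pre_digraph.cycle\<close> would also accept an edge traversed back and forth; distinctness of the
  underlying edges excludes exactly this.
\<close>

definition ug_cycle :: "('v, 'a) ugraph \<Rightarrow> 'a list \<Rightarrow> bool" where
  "ug_cycle G p \<longleftrightarrow> pre_digraph.cycle (ug_dig G) p \<and> distinct (map (ug_edge G) p)"

definition acyclic_edges :: "('v, 'a) ugraph \<Rightarrow> 'a set set \<Rightarrow> bool" where
  "acyclic_edges G F \<longleftrightarrow> \<not> (\<exists>p. ug_cycle G p \<and> ug_edge G ` set p \<subseteq> F)"

subsection \<open>The associated one-dimensional complex\<close>

text \<open>
  Points of the complex are vertices and interior points of edges. The interior point at
  parameter \<^term>\<open>t\<close> on the arc \<^term>\<open>a\<close> is also the point at parameter \<open>1 - t\<close> on the reversed arc,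
  and is encoded by the set of these two coordinate pairs.
\<close>

datatype ('v, 'a) gpoint = Vertex 'v | Interior "('a \<times> real) set"

definition arc_point :: "('v, 'a) ugraph \<Rightarrow> 'a \<Rightarrow> real \<Rightarrow> ('v, 'a) gpoint" where
  "arc_point G a t =
     (if t = 0 then Vertex (ug_tail G a)
      else if t = 1 then Vertex (ug_head G a)
      else Interior {(a, t), (ug_rev G a, 1 - t)})"

definition gpoints :: "('v, 'a) ugraph \<Rightarrow> ('v, 'a) gpoint set" where
  "gpoints G = Vertex ` ug_verts G \<union> (\<Union>a \<in> ug_arcs G. arc_point G a ` {0..1})"

definition realization :: "('v, 'a) ugraph \<Rightarrow> ('v, 'a) gpoint topology" where
  "realization G = final_topology (gpoints G) (ug_arcs G) (\<lambda>_. top_of_set {0..1}) (arc_point G)"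

lemma topspace_realization [simp]: "topspace (realization G) = gpoints G"
  unfolding realization_def by (rule topspace_final_topology) (auto simp: gpoints_def)

subsection \<open>Isomorphisms and contractions\<close>

definition graph_iso ::
  "('v, 'a) ugraph \<Rightarrow> ('w, 'b) ugraph \<Rightarrow> ('v \<Rightarrow> 'w) \<Rightarrow> ('a \<Rightarrow> 'b) \<Rightarrow> bool" where
  "graph_iso G G' fv fa \<longleftrightarrow>
     bij_betw fv (ug_verts G) (ug_verts G') \<and> bij_betw fa (ug_arcs G) (ug_arcs G') \<and>
     (\<forall>a \<in> ug_arcs G. ug_tail G' (fa a) = fv (ug_tail G a) \<and> ug_rev G' (fa a) = fa (ug_rev G a))"

text \<open>
  A contraction of the forest \<^term>\<open>F\<close>: two vertices are identified iff they lie in the same component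
  of \<^term>\<open>F\<close>, and the remaining edges are in bijection with those of the target. As edges are sets of
  arcs, \<^term>\<open>\<Union>F\<close> is the set of contracted arcs.
\<close>

definition forest_contraction ::
  "('v, 'a) ugraph \<Rightarrow> ('w, 'b) ugraph \<Rightarrow> 'a set set \<Rightarrow> ('v \<Rightarrow> 'w) \<Rightarrow> ('a \<Rightarrow> 'b) \<Rightarrow> bool" where
  "forest_contraction G G' F fv fa \<longleftrightarrow>
     F \<subseteq> ug_edges G \<and> acyclic_edges G F \<and>
     fv ` ug_verts G = ug_verts G' \<and>
     (\<forall>u \<in> ug_verts G. \<forall>v \<in> ug_verts G. fv u = fv v \<longleftrightarrow> reachable (ug_dig G\<lparr>arcs := \<Union>F\<rparr>) u v) \<and>
     bij_betw fa (ug_arcs G - \<Union>F) (ug_arcs G') \<and>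
     (\<forall>a \<in> ug_arcs G - \<Union>F.
        ug_tail G' (fa a) = fv (ug_tail G a) \<and> ug_rev G' (fa a) = fa (ug_rev G a))"

text \<open>
  The map of complexes induced by \<^term>\<open>fv\<close> and \<^term>\<open>fa\<close> (with \<^term>\<open>F = {}\<close> for isomorphisms):
  it is \<open>fv\<close> on vertices, \<open>t \<mapsto> t\<close> from the arc \<open>a\<close> to the arc \<open>fa a\<close>, and constant on the
  edges in \<^term>\<open>F\<close>.
\<close>

fun realization_map ::
  "('v, 'a) ugraph \<Rightarrow> 'a set set \<Rightarrow> ('v \<Rightarrow> 'w) \<Rightarrow> ('a \<Rightarrow> 'b) \<Rightarrow> ('v, 'a) gpoint \<Rightarrow> ('w, 'b) gpoint"
where
  "realization_map G F fv fa (Vertex v) = Vertex (fv v)"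
| "realization_map G F fv fa (Interior S) =
     (if fst ` S \<subseteq> \<Union>F then Vertex (the_elem ((\<lambda>(a, t). fv (ug_tail G a)) ` S))
      else Interior ((\<lambda>(a, t). (fa a, t)) ` S))"

lemma realization_map_arc_point:
  assumes "bidirected_digraph (ug_dig G) (ug_rev G)" "bidirected_digraph (ug_dig G') (ug_rev G')"
    and c: "forest_contraction G G' F fv fa" and a: "a \<in> ug_arcs G"
  shows "a \<notin> \<Union>F \<Longrightarrow> realization_map G F fv fa (arc_point G a t) = arc_point G' (fa a) t"
    and "a \<in> \<Union>F \<Longrightarrow> realization_map G F fv fa (arc_point G a t) = Vertex (fv (ug_tail G a))"
proof -
  interpret G: bidirected_digraph "ug_dig G" "ug_rev G" by fact
  interpret G': bidirected_digraph "ug_dig G'" "ug_rev G'" by fact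
  have F: "ug_rev G b \<in> \<Union>F" if b: "b \<in> \<Union>F" for b
  proof -
    from b obtain e where e: "e \<in> F" "b \<in> e" by blast
    moreover have "F \<subseteq> ug_edges G" using c by (simp add: forest_contraction_def)
    ultimately obtain a where "e = {a, ug_rev G a}"
      by (auto simp: ug_edges_def ug_edge_def)
    with e show ?thesis by auto
  qed
  {
    assume n: "a \<notin> \<Union>F"
    then have n': "ug_rev G a \<notin> \<Union>F" using F[of "ug_rev G a"] by (metis G.arev_arev)
    have t: "ug_tail G' (fa b) = fv (ug_tail G b)" "ug_rev G' (fa b) = fa (ug_rev G b)"
      "fa b \<in> ug_arcs G'" if "b \<in> ug_arcs G - \<Union>F" for b
      using c that unfolding forest_contraction_def by (blast dest: bij_betwE)+
    have "ug_head G' (fa a) = ug_tail G' (fa (ug_rev G a))"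
      using t(2)[of a] G'.tail_arev[OF t(3)[of a]] n a by simp
    also have "\<dots> = fv (ug_head G a)"
      using t(1)[of "ug_rev G a"] n' a by simp
    finally show "realization_map G F fv fa (arc_point G a t) = arc_point G' (fa a) t"
      using t(1)[of a] t(2)[of a] a n by (simp add: arc_point_def)
  next
    assume m: "a \<in> \<Union>F"
    have "arcs_ends (ug_dig G\<lparr>arcs := \<Union>F\<rparr>) = (\<lambda>a. (ug_tail G a, ug_head G a)) ` \<Union>F"
      by (simp add: arcs_ends_conv)
    then have "reachable (ug_dig G\<lparr>arcs := \<Union>F\<rparr>) (ug_tail G a) (ug_head G a)"
      unfolding reachable_def using m a by (intro rtrancl_on_into_rtrancl_on[OF rtrancl_on_refl]) auto
    then have "fv (ug_tail G a) = fv (ug_head G a)"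
      using c a G.tail_in_verts G.head_in_verts unfolding forest_contraction_def by blast
    then show "realization_map G F fv fa (arc_point G a t) = Vertex (fv (ug_tail G a))"
      using m a F[OF m] by (simp add: arc_point_def)
  }
qed

section \<open>Marked graphs and marked tropical curves\<close>

definition rose :: "nat \<Rightarrow> (unit, nat \<times> bool) ugraph" where
  "rose g =
     \<lparr>ug_dig = \<lparr>verts = {()}, arcs = {..<g} \<times> UNIV, tail = (\<lambda>_. ()), head = (\<lambda>_. ())\<rparr>,
      ug_rev = (\<lambda>(i, b). (i, if i < g then \<not> b else b))\<rparr>"

lemma bidirected_rose: "bidirected_digraph (ug_dig (rose g)) (ug_rev (rose g))"
  by unfold_locales (auto simp: rose_def)

text \<open>
  Every finite graph is isomorphic to one whose vertices and arcs are natural numbers, so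
  \<^typ>\<open>(nat, nat) ugraph\<close> contains all finite graphs up to isomorphism.
\<close>

type_synonym ('v, 'a) marking = "(unit, nat \<times> bool) gpoint \<Rightarrow> ('v, 'a) gpoint"

type_synonym ('v, 'a) marked_graph = "('v, 'a) ugraph \<times> ('v, 'a) marking"

abbreviation homotopic_markings ::
  "nat \<Rightarrow> ('v, 'a) ugraph \<Rightarrow> ('v, 'a) marking \<Rightarrow> ('v, 'a) marking \<Rightarrow> bool" where
  "homotopic_markings g G \<equiv> homotopic_with (\<lambda>_. True) (realization (rose g)) (realization G)"

definition stable_marked_graphs :: "nat \<Rightarrow> ('v, 'a) marked_graph set" where
  "stable_marked_graphs g =
     {(G, h). finite_connected_graph G \<and> genus G = int g \<and> stable_graph G \<and>
        homotopy_equivalence_map (realization (rose g)) (realization G) h}"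

definition marked_equiv :: "nat \<Rightarrow> (('v, 'a) marked_graph \<times> ('v, 'a) marked_graph) set" where
  "marked_equiv g =
     {((G, h), (G', h')). (G, h) \<in> stable_marked_graphs g \<and> (G', h') \<in> stable_marked_graphs g \<and>
        (\<exists>fv fa. graph_iso G G' fv fa \<and>
           homotopic_markings g G' (realization_map G {} fv fa \<circ> h) h')}"

definition marked_classes :: "nat \<Rightarrow> ('v, 'a) marked_graph set set" where
  "marked_classes g = stable_marked_graphs g // marked_equiv g"

text \<open>
  Length functions are finitely supported functions on the edges: the space of real functions on the
  edge set of \<^term>\<open>G\<close> is the subspace of those \<open>l\<close> with \<open>Poly_Mapping.keys l \<subseteq> ug_edges G\<close>.
\<close>

definition open_length_cone :: "('v, 'a) ugraph \<Rightarrow> ('a set \<Rightarrow>\<^sub>0 real) set" where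
  "open_length_cone G =
     {l. Poly_Mapping.keys l \<subseteq> ug_edges G \<and> (\<forall>e \<in> ug_edges G. 0 < Poly_Mapping.lookup l e)}"

definition length_cone :: "('v, 'a) ugraph \<Rightarrow> ('a set \<Rightarrow>\<^sub>0 real) set" where
  "length_cone G =
     {l. Poly_Mapping.keys l \<subseteq> ug_edges G \<and> (\<forall>e \<in> ug_edges G. 0 \<le> Poly_Mapping.lookup l e) \<and>
         acyclic_edges G {e \<in> ug_edges G. Poly_Mapping.lookup l e = 0}}"

definition length_lattice :: "('v, 'a) ugraph \<Rightarrow> ('a set \<Rightarrow>\<^sub>0 real) set" where
  "length_lattice G =
     {l. Poly_Mapping.keys l \<subseteq> ug_edges G \<and> (\<forall>e \<in> ug_edges G. Poly_Mapping.lookup l e \<in> \<int>)}"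

type_synonym ('v, 'a) marked_curve =
  "('v, 'a) ugraph \<times> ('a set \<Rightarrow>\<^sub>0 real) \<times> ('v, 'a) marking"

definition marked_curves :: "nat \<Rightarrow> ('v, 'a) marked_curve set" where
  "marked_curves g = {(G, l, h). (G, h) \<in> stable_marked_graphs g \<and> l \<in> open_length_cone G}"

definition curve_equiv :: "nat \<Rightarrow> (('v, 'a) marked_curve \<times> ('v, 'a) marked_curve) set" where
  "curve_equiv g =
     {((G, l, h), (G', l', h')). (G, l, h) \<in> marked_curves g \<and> (G', l', h') \<in> marked_curves g \<and>
        (\<exists>fv fa. graph_iso G G' fv fa \<and>
           (\<forall>e \<in> ug_edges G. Poly_Mapping.lookup l' (fa ` e) = Poly_Mapping.lookup l e) \<and>
           homotopic_markings g G' (realization_map G {} fv fa \<circ> h) h')}"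

section \<open>Ideal stacky fans\<close>

text \<open>
  A finite-dimensional real vector space with lattice is given by the lattice \<^term>\<open>N\<close> inside some
  ambient normed space; the vector space itself is \<^term>\<open>span N\<close>.
\<close>

definition is_lattice :: "'v::real_normed_vector set \<Rightarrow> bool" where
  "is_lattice N \<longleftrightarrow>
     (\<exists>B. finite B \<and> independent B \<and> N = {\<Sum>b\<in>B. of_int (k b) *\<^sub>R b | k. True})"

definition rational_polyhedral_cone :: "'v::real_normed_vector set \<Rightarrow> 'v set \<Rightarrow> bool" where
  "rational_polyhedral_cone N C \<longleftrightarrow> (\<exists>S. finite S \<and> S \<subseteq> N \<and> C = convex_cone hull S)"

definition ideal_cone :: "'v::real_normed_vector set \<Rightarrow> 'v set \<Rightarrow> bool" where
  "ideal_cone N \<sigma> \<longleftrightarrow>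
     (\<exists>C \<F>. rational_polyhedral_cone N C \<and> (\<forall>F \<in> \<F>. F face_of C \<and> F \<noteq> C) \<and> \<sigma> = C - \<Union>\<F>)"

definition ideal_face :: "'v::real_normed_vector set \<Rightarrow> 'v set \<Rightarrow> bool" where
  "ideal_face \<tau> \<sigma> \<longleftrightarrow> (\<exists>F. F face_of closure \<sigma> \<and> \<tau> = \<sigma> \<inter> F)"

definition lattice_preserving_inclusion ::
  "'v::real_normed_vector set \<Rightarrow> 'v set \<Rightarrow> 'v set \<Rightarrow> 'v set \<Rightarrow> ('v \<Rightarrow> 'v) \<Rightarrow> bool" where
  "lattice_preserving_inclusion N \<sigma> N' \<sigma>' L \<longleftrightarrow>
     linear L \<and> L ` span N \<subseteq> span N' \<and>
     inj_on L \<sigma> \<and> ideal_face (L ` \<sigma>) \<sigma>' \<and>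
     L ` (N \<inter> span \<sigma>) = N' \<inter> L ` span \<sigma>"

text \<open>
  Gluing data: cones \<^term>\<open>\<sigma> i\<close> for \<^term>\<open>i \<in> I\<close>, and a set \<^term>\<open>A\<close> of triples \<open>(i, j, L)\<close>, each standing for
  an inclusion \<open>L\<close> of \<open>\<sigma> i\<close> into \<open>\<sigma> j\<close>.
\<close>

definition gluing_equiv ::
  "'i set \<Rightarrow> ('i \<Rightarrow> 'v set) \<Rightarrow> ('i \<times> 'i \<times> ('v \<Rightarrow> 'v)) set \<Rightarrow> (('i \<times> 'v) \<times> ('i \<times> 'v)) set" where
  "gluing_equiv I \<sigma> A =
     (let r = {((i, x), (j, L x)) | i j L x. (i, j, L) \<in> A \<and> x \<in> \<sigma> i}
      in (r \<union> r\<inverse>)\<^sup>* \<inter> (Sigma I \<sigma> \<times> Sigma I \<sigma>))"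

definition glued_space ::
  "'i set \<Rightarrow> ('i \<Rightarrow> 'v::topological_space set) \<Rightarrow> ('i \<times> 'i \<times> ('v \<Rightarrow> 'v)) set \<Rightarrow>
     ('i \<times> 'v) set topology" where
  "glued_space I \<sigma> A =
     quotient_topology (sum_topology (\<lambda>i. top_of_set (\<sigma> i)) I) (gluing_equiv I \<sigma> A)"

definition glued_point ::
  "'i set \<Rightarrow> ('i \<Rightarrow> 'v set) \<Rightarrow> ('i \<times> 'i \<times> ('v \<Rightarrow> 'v)) set \<Rightarrow> 'i \<Rightarrow> 'v \<Rightarrow> ('i \<times> 'v) set" where
  "glued_point I \<sigma> A i x = gluing_equiv I \<sigma> A `` {(i, x)}"

definition ideal_stacky_fan ::
  "('i \<times> 'v::real_normed_vector) set topology \<Rightarrow> 'i set \<Rightarrow> ('i \<Rightarrow> 'v set) \<Rightarrow> ('i \<Rightarrow> 'v set) \<Rightarrow>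
     ('i \<times> 'i \<times> ('v \<Rightarrow> 'v)) set \<Rightarrow> bool" where
  "ideal_stacky_fan X I N \<sigma> A \<longleftrightarrow>
     (\<forall>i \<in> I. is_lattice (N i) \<and> ideal_cone (N i) (\<sigma> i)) \<and>
     (\<forall>(i, j, L) \<in> A. i \<in> I \<and> j \<in> I \<and> lattice_preserving_inclusion (N i) (\<sigma> i) (N j) (\<sigma> j) L) \<and>
     X = glued_space I \<sigma> A \<and>
     topspace X = (\<Union>i \<in> I. glued_point I \<sigma> A i ` rel_interior (\<sigma> i)) \<and>
     disjoint_family_on (\<lambda>i. glued_point I \<sigma> A i ` rel_interior (\<sigma> i)) I"

section \<open>The pure tropical Teichmueller space\<close>

text \<open>
  The linear map induced by a contraction \<open>\<pi>\<close> of \<^term>\<open>F\<close>: under the inclusion of edges induced by \<open>\<pi>\<close>,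
  the edge \<open>fa ` e\<close> of the target corresponds to the non-contracted edge \<open>e\<close>.
\<close>

definition length_map ::
  "('v, 'a) ugraph \<Rightarrow> 'a set set \<Rightarrow> ('a \<Rightarrow> 'b) \<Rightarrow> ('b set \<Rightarrow>\<^sub>0 real) \<Rightarrow> ('a set \<Rightarrow>\<^sub>0 real)" where
  "length_map G F fa l =
     (\<Sum>e \<in> ug_edges G - F. Poly_Mapping.single e (Poly_Mapping.lookup l (fa ` e)))"

definition specialization ::
  "nat \<Rightarrow> ('v, 'a) marked_graph \<Rightarrow> ('w, 'b) marked_graph \<Rightarrow>
     'a set set \<Rightarrow> ('v \<Rightarrow> 'w) \<Rightarrow> ('a \<Rightarrow> 'b) \<Rightarrow> bool" where
  "specialization g m m' F fv fa \<longleftrightarrow>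
     forest_contraction (fst m) (fst m') F fv fa \<and>
     homotopic_markings g (fst m') (realization_map (fst m) F fv fa \<circ> snd m) (snd m')"

text \<open>
  The disjoint union runs over the equivalence classes of stable marked graphs; \<^term>\<open>rep\<close>
  chooses a member \<open>(\<Gamma>, h)\<close> of every class \<^term>\<open>c\<close>, whose cone is then the cone of \<^term>\<open>c\<close>.
\<close>

context
  fixes g :: nat and rep :: "('v, 'a) marked_graph set \<Rightarrow> ('v, 'a) marked_graph"
begin

definition teich_cone :: "('v, 'a) marked_graph set \<Rightarrow> ('a set \<Rightarrow>\<^sub>0 real) set" where
  "teich_cone c = length_cone (fst (rep c))"

definition teich_open_cone :: "('v, 'a) marked_graph set \<Rightarrow> ('a set \<Rightarrow>\<^sub>0 real) set" where
  "teich_open_cone c = open_length_cone (fst (rep c))"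

definition teich_lattice :: "('v, 'a) marked_graph set \<Rightarrow> ('a set \<Rightarrow>\<^sub>0 real) set" where
  "teich_lattice c = length_lattice (fst (rep c))"

definition teich_maps ::
  "(('v, 'a) marked_graph set \<times> ('v, 'a) marked_graph set \<times>
     (('a set \<Rightarrow>\<^sub>0 real) \<Rightarrow> ('a set \<Rightarrow>\<^sub>0 real))) set" where
  "teich_maps =
     {(c', c, length_map (fst (rep c)) F fa) | c' c F fv fa.
        c \<in> marked_classes g \<and> c' \<in> marked_classes g \<and>
        specialization g (rep c) (rep c') F fv fa}"

definition pure_tropical_teichmueller ::
  "(('v, 'a) marked_graph set \<times> ('a set \<Rightarrow>\<^sub>0 real)) set topology" where
  "pure_tropical_teichmueller = glued_space (marked_classes g) teich_cone teich_maps"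

definition teich_point ::
  "('v, 'a) marked_graph set \<Rightarrow> ('a set \<Rightarrow>\<^sub>0 real) \<Rightarrow>
     (('v, 'a) marked_graph set \<times> ('a set \<Rightarrow>\<^sub>0 real)) set" where
  "teich_point c l = glued_point (marked_classes g) teich_cone teich_maps c l"

end

end

theory Submission
  imports Defs
begin

text \<open>
  Contracting the edges of length 0 assigns to every point of a cone the class of a marked pure
  tropical curve. This class does not change under the gluing maps, because a contraction followed
  by a contraction is a contraction. Conversely every point is glued to a point of an open cone, and
  two points of open cones with the same class are related by an isomorphism of marked metric
  graphs, so they lie in the same cone. Hence the glued space is in bijection with the curve classes.

  Two further inputs are needed. Contracting a forest is a homotopy equivalence: for a single edge,
  sliding one end of the edge to the other is a homotopy of the graph that descends to the quotient.
  An automorphism of a stable graph that is homotopic to the identity fixes every edge: it acts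
  trivially on homology, and a Lefschetz count then shows that its fixed subgraph is everything. So
  an open cone is embedded in the glued space.
\<close>

section \<open>The topology of the realization\<close>

text \<open>Everything is phrased through contractions of forests, isomorphisms being the case of
  the empty forest; composing and factoring them serves the gluing, the equivalence of marked graphs
  and that of curves alike. Gluing is generated by maps in one direction only, so two glued points
  are joined by a zigzag. Therefore a point is assigned the whole set \<open>contracts_to\<close> of
  positive-length curves that it contracts to: constancy along one arrow gives constancy along every
  zigzag, and no choice of contraction enters. Chasing cycles through contractions is avoided by the
  count |V| = |F| + number of components, which characterizes forests and passes to quotients. No
  homology groups are formed: one edge is wrapped around the unit circle, and the change of the
  logarithm along the track of a vertex turns a homotopy into a chain homotopy. Its values are only
  complex numbers, so the Lefschetz count first replaces them by integral chains obtained from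
  walks. Stability enters there as 3 > 2: in the trace comparison a moved vertex weighs 2, but it
  moves all of its at least 3 outgoing arcs.\<close>

lemma arc_point_in_gpoints:
  assumes "a \<in> ug_arcs G" "t \<in> {0..1}" shows "arc_point G a t \<in> gpoints G"
  using assms unfolding gpoints_def by blast

lemma continuous_map_arc_point:
  assumes "a \<in> ug_arcs G"
  shows "continuous_map (top_of_set {0..1}) (realization G) (arc_point G a)"
proof -
  have "{x \<in> {0..1}. arc_point G a x \<in> gpoints G} = {0..1}"
    using assms by (auto simp: gpoints_def)
  then show ?thesis
    using assms unfolding continuous_map_def topspace_realization
    by (auto simp: realization_def openin_final_topology gpoints_def)
qed

lemma openin_realization:
  "openin (realization G) U \<longleftrightarrow> U \<subseteq> gpoints G \<and>
     (\<forall>a \<in> ug_arcs G. openin (top_of_set {0..1}) {t \<in> {0..1}. arc_point G a t \<in> U})"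
  unfolding realization_def openin_final_topology by simp

lemma continuous_map_from_realization:
  assumes "\<And>a. a \<in> ug_arcs G \<Longrightarrow> continuous_map (top_of_set {0..1}) Y (\<lambda>t. f (arc_point G a t))"
    and "f \<in> gpoints G \<rightarrow> topspace Y"
  shows "continuous_map (realization G) Y f"
  unfolding continuous_map_def
proof (intro conjI allI impI)
  show "f \<in> topspace (realization G) \<rightarrow> topspace Y" using assms(2) by simp
  fix U assume U: "openin Y U"
  have mem: "arc_point G a t \<in> gpoints G" if "a \<in> ug_arcs G" "t \<in> {0..1}" for a t
    using that by (rule arc_point_in_gpoints)
  have eq: "{t \<in> {0..1}. arc_point G a t \<in> {x \<in> topspace (realization G). f x \<in> U}} =
        {t \<in> topspace (top_of_set {0..1}). f (arc_point G a t) \<in> U}" if "a \<in> ug_arcs G" for a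
    using that mem by auto
  show "openin (realization G) {x \<in> topspace (realization G). f x \<in> U}"
    unfolding openin_realization
    using openin_continuous_map_preimage[OF assms(1) U] eq by auto
qed

lemma gpoints_cases:
  assumes "x \<in> gpoints G"
  obtains (vertex) v where "v \<in> ug_verts G" "x = Vertex v"
    | (arc) a t where "a \<in> ug_arcs G" "t \<in> {0..1}" "x = arc_point G a t"
  using assms by (auto simp: gpoints_def)

lemma gpoints_conv_arcs:
  assumes "ug_verts G \<subseteq> ug_tail G ` ug_arcs G"
  shows "gpoints G = (\<Union>a \<in> ug_arcs G. arc_point G a ` {0..1})"
proof -
  have "Vertex v \<in> (\<Union>a \<in> ug_arcs G. arc_point G a ` {0..1})" if "v \<in> ug_verts G" for v
  proof -
    from that assms obtain a where a: "a \<in> ug_arcs G" "v = ug_tail G a" by blast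
    then have "Vertex v = arc_point G a 0" by (simp add: arc_point_def)
    then show ?thesis using a(1) by (intro UN_I[of a]) auto
  qed
  then show ?thesis by (auto simp: gpoints_def)
qed

text \<open>The final topology is recast as one quotient of the disjoint union of the arcs, the
  union being encoded as a product with a discrete space. A single quotient map can be multiplied
  with an interval, which homotopies require. The hypothesis gives surjectivity: every vertex is the
  start of an arc.\<close>

lemma quotient_map_arc_points:
  assumes "ug_verts G \<subseteq> ug_tail G ` ug_arcs G"
  shows "quotient_map (prod_topology (discrete_topology (ug_arcs G)) (top_of_set {0..1}))
           (realization G) (\<lambda>(a, t). arc_point G a t)"
  unfolding quotient_map_def
proof (intro conjI allI impI)
  show "(\<lambda>(a, t). arc_point G a t) ` topspace (prod_topology (discrete_topology (ug_arcs G)) (top_of_set {0..1}))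
      = topspace (realization G)"
    by (auto simp: gpoints_conv_arcs[OF assms])
  fix U assume U: "U \<subseteq> topspace (realization G)"
  let ?X = "prod_topology (discrete_topology (ug_arcs G)) (top_of_set {0..1::real})"
  let ?P = "{x \<in> topspace ?X. (case x of (a, t) \<Rightarrow> arc_point G a t) \<in> U}"
  have P: "?P = (\<Union>a \<in> ug_arcs G. {a} \<times> {t \<in> {0..1}. arc_point G a t \<in> U})" by auto
  show "openin ?X ?P = openin (realization G) U"
  proof
    assume o: "openin (realization G) U"
    show "openin ?X ?P" unfolding P
      using o by (auto simp: openin_realization openin_prod_Times_iff intro!: openin_Union)
  next
    assume o: "openin ?X ?P"
    have "openin (top_of_set {0..1}) {t \<in> {0..1}. arc_point G a t \<in> U}" if a: "a \<in> ug_arcs G" for a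
    proof -
      have "continuous_map (top_of_set {0..1}) ?X (\<lambda>t. (a, t))"
        using a by (simp add: continuous_map_pairedI continuous_map_const)
      note openin_continuous_map_preimage[OF this o]
      also have "{t \<in> topspace (top_of_set {0..1}). (a, t) \<in> ?P} = {t \<in> {0..1}. arc_point G a t \<in> U}"
        using a by auto
      finally show ?thesis .
    qed
    then show "openin (realization G) U" using U by (simp add: openin_realization)
  qed
qed

text \<open>Fixing the discrete coordinate cuts out open slices that cover the product, so
  continuity can be pasted slice by slice.\<close>

lemma continuous_map_prod_discrete:
  assumes "\<And>a. a \<in> A \<Longrightarrow> continuous_map (prod_topology Z X) Y (\<lambda>(z, x). f (z, a, x))"
  shows "continuous_map (prod_topology Z (prod_topology (discrete_topology A) X)) Y f"
proof -
  let ?W = "prod_topology Z (prod_topology (discrete_topology A) X)"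
  let ?T = "\<lambda>a. topspace Z \<times> {a} \<times> topspace X"
  show ?thesis
  proof (rule pasting_lemma[where I = A and T = ?T and f = "\<lambda>_. f"])
    fix a assume a: "a \<in> A"
    show "openin ?W (?T a)" using a by (simp add: openin_prod_Times_iff)
    have "continuous_map (subtopology ?W (?T a)) (prod_topology Z X) (\<lambda>(z, b, x). (z, x))"
      unfolding case_prod_unfold
      by (intro continuous_map_from_subtopology continuous_map_pairedI continuous_map_fst
           continuous_map_compose[OF continuous_map_snd continuous_map_snd, unfolded o_def])
    from continuous_map_compose[OF this assms[OF a]]
    show "continuous_map (subtopology ?W (?T a)) Y f"
      by (rule continuous_map_eq) auto
  qed auto
qed

text \<open>The product of a quotient map with the identity of a locally compact Hausdorff space is
  again a quotient map. Hence a homotopy on a realization may be checked for continuity on one arc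
  at a time.\<close>

lemma continuous_map_times_realization:
  assumes "ug_verts G \<subseteq> ug_tail G ` ug_arcs G"
    and "\<And>a. a \<in> ug_arcs G \<Longrightarrow>
      continuous_map (prod_topology (top_of_set {0..1}) (top_of_set {0..1})) Y
        (\<lambda>(t::real, s). f (t, arc_point G a s))"
  shows "continuous_map (prod_topology (top_of_set {0..1}) (realization G)) Y f"
proof -
  let ?I = "top_of_set {0..1::real}"
  let ?D = "prod_topology (discrete_topology (ug_arcs G)) ?I"
  have "locally_compact_space ?I"
    by (simp add: compact_imp_locally_compact_space compact_space_subtopology)
  then have q: "quotient_map (prod_topology ?I ?D) (prod_topology ?I (realization G))
      (\<lambda>(z, x). (z, case x of (a, t) \<Rightarrow> arc_point G a t))"
    by (intro quotient_map_prod_right quotient_map_arc_points[OF assms(1)])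
       (simp_all add: Hausdorff_space_subtopology)
  have "continuous_map (prod_topology ?I ?D) Y
      (f \<circ> (\<lambda>(z, x). (z, case x of (a, t) \<Rightarrow> arc_point G a t)))"
    by (intro continuous_map_prod_discrete) (use assms(2) in \<open>simp add: case_prod_unfold comp_def\<close>)
  then show ?thesis
    using continuous_compose_quotient_map_eq[OF q] by blast
qed

section \<open>Forests and components\<close>

locale bidirected_ugraph = bidirected_digraph "ug_dig G" "ug_rev G" for G :: "('v, 'a) ugraph"
begin

lemma ug_edge_eq_iff: "ug_edge G a = ug_edge G b \<longleftrightarrow> b = a \<or> b = ug_rev G a"
  unfolding ug_edge_def by (metis arev_arev doubleton_eq_iff insert_iff singletonD)

lemma ug_edge_rev [simp]: "ug_edge G (ug_rev G a) = ug_edge G a"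
  by (simp add: ug_edge_eq_iff)

lemma ug_edge_in_ug_edges: "ug_edge G a \<in> ug_edges G \<longleftrightarrow> a \<in> ug_arcs G"
proof
  assume "ug_edge G a \<in> ug_edges G"
  then obtain b where "b \<in> ug_arcs G" "ug_edge G a = ug_edge G b" by (auto simp: ug_edges_def)
  then show "a \<in> ug_arcs G" by (metis arev_arev arev_in_arcs ug_edge_eq_iff)
qed (simp add: ug_edges_def)

lemma mem_Union_edges:
  assumes "F \<subseteq> ug_edges G"
  shows "a \<in> \<Union>F \<longleftrightarrow> ug_edge G a \<in> F"
proof
  assume "a \<in> \<Union>F"
  then obtain e where e: "e \<in> F" "a \<in> e" by blast
  then obtain b where "e = ug_edge G b" using assms by (auto simp: ug_edges_def)
  with e have "e = ug_edge G a" by (auto simp: ug_edge_def)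
  with e show "ug_edge G a \<in> F" by simp
qed (auto simp: ug_edge_def)

lemma Union_edges_subset: "F \<subseteq> ug_edges G \<Longrightarrow> \<Union>F \<subseteq> ug_arcs G"
  using mem_Union_edges ug_edge_in_ug_edges by blast

lemma arc_point_rev: "a \<in> ug_arcs G \<Longrightarrow> arc_point G (ug_rev G a) t = arc_point G a (1 - t)"
  by (auto simp: arc_point_def)

lemma arc_point_eq_iff:
  assumes "a \<in> ug_arcs G" "b \<in> ug_arcs G" "s \<in> {0<..<1}" "t \<in> {0..1}"
  shows "arc_point G a s = arc_point G b t \<longleftrightarrow> b = a \<and> t = s \<or> b = ug_rev G a \<and> t = 1 - s"
  using assms arev_neq[of a] arev_neq[of b] by (auto simp: arc_point_def doubleton_eq_iff)

text \<open>An arc and its reverse have the same two ends. A second occurrence of the edge of the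
  first arc \<open>b\<close> would bring the path back to the tail of \<open>b\<close>, which a
  simple path does not revisit.\<close>

lemma apath_distinct_edges:
  assumes "apath u p v"
  shows "distinct (map (ug_edge G) p)"
  using assms
proof (induction p arbitrary: u)
  case (Cons b es)
  then have b: "b \<in> ug_arcs G" "apath (ug_head G b) es v"
      "ug_tail G b \<notin> set (awalk_verts (ug_head G b) es)"
    by (auto simp: apath_Cons_iff)
  have "ug_edge G b \<noteq> ug_edge G c" if "c \<in> set es" for c
    using that b awalk_verts_arc1[OF that] awalk_verts_arc2[OF awalkI_apath[OF b(2)] that]
    by (auto simp: ug_edge_eq_iff)
  with Cons.IH[OF b(2)] show ?case by auto
qed simp

end

text \<open>Connectivity inside \<open>F\<close> is expressed by the reflexive-transitive closure of
  this relation. For \<open>F \<subseteq> ug_edges G\<close> both orientations of each edge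
  contribute, and no vertex set has to be carried along as in \<open>reachable\<close>.\<close>

definition edge_rel :: "('v, 'a) ugraph \<Rightarrow> 'a set set \<Rightarrow> ('v \<times> 'v) set" where
  "edge_rel G F = (\<lambda>a. (ug_tail G a, ug_head G a)) ` \<Union>F"

lemma edge_rel_mono: "F \<subseteq> F' \<Longrightarrow> edge_rel G F \<subseteq> edge_rel G F'"
  by (auto simp: edge_rel_def)

context bidirected_ugraph
begin

lemma sym_edge_rel: "F \<subseteq> ug_edges G \<Longrightarrow> sym (edge_rel G F)"
  unfolding edge_rel_def
  by (rule symI) (use mem_Union_edges ug_edge_rev ug_edge_in_ug_edges in
    \<open>smt (verit, best) Pair_inject head_arev image_iff subset_iff tail_arev\<close>)

lemma edge_rel_subset: "F \<subseteq> ug_edges G \<Longrightarrow> edge_rel G F \<subseteq> ug_verts G \<times> ug_verts G"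
  using Union_edges_subset by (fastforce simp: edge_rel_def)

lemma edge_rel_insert:
  assumes "a \<in> ug_arcs G"
  shows "edge_rel G (insert (ug_edge G a) F) =
    insert (ug_tail G a, ug_head G a) (insert (ug_head G a, ug_tail G a) (edge_rel G F))"
  using assms by (auto simp: edge_rel_def ug_edge_def)

lemma reachable_restrict_iff:
  assumes "F \<subseteq> ug_edges G"
  shows "reachable (ug_dig G\<lparr>arcs := \<Union>F\<rparr>) u v \<longleftrightarrow>
     u \<in> ug_verts G \<and> v \<in> ug_verts G \<and> (u, v) \<in> (edge_rel G F)\<^sup>*"
proof -
  have e: "arcs_ends (ug_dig G\<lparr>arcs := \<Union>F\<rparr>) = edge_rel G F"
    by (simp add: arcs_ends_conv edge_rel_def)
  show ?thesis
    unfolding reachable_def e using edge_rel_subset[OF assms]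
    by (auto dest: in_rtrancl_on_in_F rtrancl_on_rtranclI intro: rtrancl_consistent_rtrancl_on)
qed

lemma wf_digraph_restrict:
  assumes "F \<subseteq> ug_edges G" shows "wf_digraph (ug_dig G\<lparr>arcs := \<Union>F\<rparr>)"
  using Union_edges_subset[OF assms] by unfold_locales auto

lemma awalk_verts_restrict: "pre_digraph.awalk_verts (ug_dig G\<lparr>arcs := A\<rparr>) u p = awalk_verts u p"
  by (simp add: pre_digraph.awalk_verts_conv)

lemma cas_restrict: "pre_digraph.cas (ug_dig G\<lparr>arcs := A\<rparr>) u p v = cas u p v"
  by (induction p arbitrary: u) (simp_all add: pre_digraph.cas.simps)

lemma edge_rel_apath:
  assumes "F \<subseteq> ug_edges G" "u \<in> ug_verts G" "v \<in> ug_verts G" "(u, v) \<in> (edge_rel G F)\<^sup>*"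
  obtains p where "apath u p v" "ug_edge G ` set p \<subseteq> F"
proof -
  let ?H = "ug_dig G\<lparr>arcs := \<Union>F\<rparr>"
  interpret H: wf_digraph ?H by (rule wf_digraph_restrict) fact
  have "reachable ?H u v" using assms by (simp add: reachable_restrict_iff)
  then obtain p where "H.apath u p v" using H.reachable_apath by blast
  then have "apath u p v" "set p \<subseteq> \<Union>F"
    unfolding H.apath_def H.awalk_def apath_def awalk_def awalk_verts_restrict cas_restrict
    using Union_edges_subset[OF assms(1)] by auto
  then show ?thesis using that mem_Union_edges[OF assms(1)] by blast
qed

lemma awalk_edge_rel:
  assumes "awalk u p v" "ug_edge G ` set p \<subseteq> F"
  shows "(u, v) \<in> (edge_rel G F)\<^sup>*"
  using assms
proof (induction p arbitrary: u)
  case Nil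
  then show ?case by (simp add: awalk_Nil_iff)
next
  case (Cons a p)
  then have "(ug_tail G a, ug_head G a) \<in> edge_rel G F"
    by (auto simp: edge_rel_def ug_edge_def)
  with Cons show ?case by (auto simp: awalk_Cons_iff intro: converse_rtrancl_into_rtrancl)
qed

lemma acyclic_edges_empty: "acyclic_edges G {}"
  by (auto simp: acyclic_edges_def ug_cycle_def cycle_def)

lemma acyclic_edges_mono: "acyclic_edges G F \<Longrightarrow> F' \<subseteq> F \<Longrightarrow> acyclic_edges G F'"
  unfolding acyclic_edges_def by blast

text \<open>A simple path in \<open>F\<close> from the head of \<open>a\<close> to its tail,
  preceded by \<open>a\<close>, is a cycle. Conversely a cycle through the new edge uses it once,
  and the rest of that cycle joins its ends inside \<open>F\<close>.\<close>

lemma acyclic_edges_insert_iff: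
  assumes F: "F \<subseteq> ug_edges G" and a: "a \<in> ug_arcs G" "ug_edge G a \<notin> F"
  shows "acyclic_edges G (insert (ug_edge G a) F) \<longleftrightarrow>
    acyclic_edges G F \<and> (ug_tail G a, ug_head G a) \<notin> (edge_rel G F)\<^sup>*"
proof -
  have sym: "(v, u) \<in> (edge_rel G F)\<^sup>*" if "(u, v) \<in> (edge_rel G F)\<^sup>*" for u v
    using sym_rtrancl[OF sym_edge_rel[OF F]] that by (meson symD)
  have "\<exists>p. ug_cycle G p \<and> ug_edge G ` set p \<subseteq> insert (ug_edge G a) F"
    if conn: "(ug_tail G a, ug_head G a) \<in> (edge_rel G F)\<^sup>*"
  proof -
    obtain p where p: "apath (ug_head G a) p (ug_tail G a)" "ug_edge G ` set p \<subseteq> F"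
      using edge_rel_apath[OF F _ _ sym[OF conn]] a(1) head_in_verts tail_in_verts by metis
    have "awalk (ug_tail G a) (a # p) (ug_tail G a)" "distinct (tl (awalk_verts (ug_tail G a) (a # p)))"
      using p(1) a by (auto simp: apath_def awalk_Cons_iff)
    then have "cycle (a # p)" unfolding cycle_def by blast
    then have "ug_cycle G (a # p)"
      using apath_distinct_edges[OF p(1)] p(2) a(2) by (auto simp: ug_cycle_def)
    with p(2) show ?thesis by (intro exI[of _ "a # p"]) auto
  qed
  moreover have "(ug_tail G a, ug_head G a) \<in> (edge_rel G F)\<^sup>*"
    if ac: "acyclic_edges G F" and p: "ug_cycle G p" "ug_edge G ` set p \<subseteq> insert (ug_edge G a) F" for p
  proof -
    from ac p obtain b where b: "b \<in> set p" "ug_edge G b = ug_edge G a"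
      unfolding acyclic_edges_def by (metis image_subset_iff insert_iff)
    then obtain p1 p2 where s: "p = p1 @ b # p2" by (meson split_list)
    \<comment> \<open>Distinctness of the edges of a \<open>ug_cycle\<close> keeps the new edge out
      of both remaining pieces.\<close>
    have "ug_edge G a \<notin> ug_edge G ` (set p1 \<union> set p2)"
      using p(1) b(2) by (auto simp: ug_cycle_def s)
    then have sub: "ug_edge G ` set p1 \<subseteq> F" "ug_edge G ` set p2 \<subseteq> F"
      using p(2) by (auto simp: s)
    obtain u where u: "awalk u p u" using p(1) by (auto simp: ug_cycle_def cycle_def)
    then have "awalk u p1 (ug_tail G b)" "awalk (ug_head G b) p2 u"
      by (auto simp: s awalk_Cons_iff)
    \<comment> \<open>The rest of the cycle is read from the head of \<open>b\<close> along
      \<open>p2\<close> to the base point and on along \<open>p1\<close> to the tail of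
      \<open>b\<close>.\<close>
    from this[THEN awalk_edge_rel] sub
    have "(ug_head G b, ug_tail G b) \<in> (edge_rel G F)\<^sup>*"
      by (blast intro: rtrancl_trans)
    moreover have "b = a \<or> b = ug_rev G a" using b(2) by (metis ug_edge_eq_iff)
    ultimately show ?thesis using sym a by auto
  qed
  ultimately show ?thesis
    unfolding acyclic_edges_def by (meson subset_insertI2)
qed

end

section \<open>Counting components: a numerical criterion for forests\<close>

definition edge_component :: "('v, 'a) ugraph \<Rightarrow> 'a set set \<Rightarrow> 'v \<Rightarrow> 'v set" where
  "edge_component G F u = {v \<in> ug_verts G. (u, v) \<in> (edge_rel G F)\<^sup>*}"

text \<open>Components are counted by whichever function separates them, be it
  \<open>edge_component\<close> or the vertex map of a contraction.\<close>

lemma card_image_eq_if_same_kernel: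
  assumes "\<And>x y. x \<in> A \<Longrightarrow> y \<in> A \<Longrightarrow> f x = f y \<longleftrightarrow> h x = h y"
  shows "card (f ` A) = card (h ` A)"
proof -
  have "bij_betw (\<lambda>z. h (inv_into A f z)) (f ` A) (h ` A)"
  proof (rule bij_betw_imageI)
    show "inj_on (\<lambda>z. h (inv_into A f z)) (f ` A)"
      by (rule inj_onI) (metis assms f_inv_into_f inv_into_into)
    have "h (inv_into A f (f x)) = h x" if "x \<in> A" for x
      by (metis assms f_inv_into_f imageI inv_into_into that)
    then show "(\<lambda>z. h (inv_into A f z)) ` f ` A = h ` A" by (auto simp: image_image)
  qed
  then show ?thesis by (rule bij_betw_same_card)
qed

context bidirected_ugraph
begin

lemma edge_component_eq_iff:
  assumes "F \<subseteq> ug_edges G" "u \<in> ug_verts G" "v \<in> ug_verts G"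
  shows "edge_component G F u = edge_component G F v \<longleftrightarrow> (u, v) \<in> (edge_rel G F)\<^sup>*"
proof -
  have "sym ((edge_rel G F)\<^sup>*)" by (rule sym_rtrancl[OF sym_edge_rel[OF assms(1)]])
  then show ?thesis using assms(2,3)
    by (auto simp: edge_component_def set_eq_iff dest: symD intro: rtrancl_trans)
qed

text \<open>The new edge merges the components of its two ends and leaves all others alone; if the
  ends already share a component, nothing changes.\<close>

lemma card_edge_component_insert:
  assumes fin: "finite (ug_verts G)" and F: "F \<subseteq> ug_edges G" and a: "a \<in> ug_arcs G"
  defines "c \<equiv> \<lambda>F. card (edge_component G F ` ug_verts G)"
  shows "c F = c (insert (ug_edge G a) F) + (if (ug_tail G a, ug_head G a) \<in> (edge_rel G F)\<^sup>* then 0 else 1)"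
proof -
  let ?F = "insert (ug_edge G a) F" and ?u = "ug_tail G a" and ?w = "ug_head G a"
  let ?R = "(edge_rel G F)\<^sup>*" and ?h = "edge_component G F"
  have F': "?F \<subseteq> ug_edges G" using F a by (simp add: ug_edge_in_ug_edges)
  have uw: "?u \<in> ug_verts G" "?w \<in> ug_verts G" using a by auto
  have symR: "(y, x) \<in> ?R" if "(x, y) \<in> ?R" for x y
    using sym_rtrancl[OF sym_edge_rel[OF F]] that by (meson symD)
  note eqF = edge_component_eq_iff[OF F] and eqF' = edge_component_eq_iff[OF F']
  have R': "(x, y) \<in> (edge_rel G ?F)\<^sup>* \<longleftrightarrow>
      (x, y) \<in> ?R \<or> (x, ?u) \<in> ?R \<and> (?w, y) \<in> ?R \<or> (x, ?w) \<in> ?R \<and> (?u, y) \<in> ?R" for x y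
    unfolding edge_rel_insert[OF a] rtrancl_insert using symR by (auto intro: rtrancl_trans)
  have ker: "edge_component G ?F x = edge_component G ?F y \<longleftrightarrow>
      ?h x = ?h y \<or> ?h x = ?h ?u \<and> ?h ?w = ?h y \<or> ?h x = ?h ?w \<and> ?h ?u = ?h y"
    if "x \<in> ug_verts G" "y \<in> ug_verts G" for x y
    using that uw by (simp only: eqF eqF' R')
  have R_iff: "(?u, ?w) \<in> ?R \<longleftrightarrow> ?h ?u = ?h ?w" using uw by (simp only: eqF)
  show ?thesis
  proof (cases "?h ?u = ?h ?w")
    case True
    have "c ?F = c F"
      unfolding c_def
      by (rule card_image_eq_if_same_kernel) (use True ker in auto)
    with True show ?thesis by (simp add: R_iff)
  next
    case False
    \<comment> \<open>\<open>?f\<close> relabels the component of the head as that of the tail. It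
      has the same fibres as the component map of the enlarged edge set, and its image lacks exactly
      one old component.\<close>
    let ?f = "\<lambda>x. if ?h x = ?h ?w then ?h ?u else ?h x"
    have "c ?F = card (?f ` ug_verts G)"
      unfolding c_def
      by (rule card_image_eq_if_same_kernel) (auto simp: ker)
    also have "?f ` ug_verts G = ?h ` ug_verts G - {?h ?w}"
      using uw False by auto
    also have "card \<dots> = c F - 1" unfolding c_def using uw fin by simp
    finally have "c ?F = c F - 1" .
    moreover have "c F > 0" unfolding c_def using uw fin by (auto simp: card_gt_0_iff)
    ultimately show ?thesis using False by (simp add: R_iff)
  qed
qed

text \<open>An added edge either joins two components, which keeps the right-hand side unchanged, or
  closes a cycle, which raises it by one. The criterion replaces the handling of explicit cycles
  under contractions.\<close>

lemma acyclic_edges_iff_card: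
  assumes fin: "finite (ug_verts G)" "finite (ug_arcs G)" and F: "F \<subseteq> ug_edges G"
  shows "acyclic_edges G F \<longleftrightarrow> card (ug_verts G) = card F + card (edge_component G F ` ug_verts G)"
proof -
  have "finite F" using F fin(2) by (auto simp: ug_edges_def intro: finite_subset)
  \<comment> \<open>The inequality is part of the induction: once the right-hand side is too large,
    it can never return to equality.\<close>
  then have "card (ug_verts G) \<le> card F + card (edge_component G F ` ug_verts G) \<and>
    (acyclic_edges G F \<longleftrightarrow> card (ug_verts G) = card F + card (edge_component G F ` ug_verts G))"
    using F
  proof (induction F)
    case empty
    have "card (edge_component G {} ` ug_verts G) = card (ug_verts G)"
      by (rule card_image) (auto simp: inj_on_def edge_component_eq_iff edge_rel_def)
    then show ?case by (simp add: acyclic_edges_empty)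
  next
    case (insert e F)
    then obtain a where a: "a \<in> ug_arcs G" "e = ug_edge G a" by (auto simp: ug_edges_def)
    from insert.prems have F: "F \<subseteq> ug_edges G" by simp
    show ?case
      using insert.IH[OF F] insert.hyps card_edge_component_insert[OF fin(1) F a(1)]
        acyclic_edges_insert_iff[OF F a(1)]
      unfolding a(2) by auto
  qed
  then show ?thesis by blast
qed

end

section \<open>Forest contractions\<close>

locale ugraph_contraction = G: bidirected_ugraph G + G': bidirected_ugraph G'
  for G :: "('v, 'a) ugraph" and G' :: "('w, 'b) ugraph" +
  fixes F :: "'a set set" and fv :: "'v \<Rightarrow> 'w" and fa :: "'a \<Rightarrow> 'b"
  assumes contraction: "forest_contraction G G' F fv fa"
begin

lemma F_subset: "F \<subseteq> ug_edges G"
  and acyclic_F: "acyclic_edges G F"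
  and fv_image: "fv ` ug_verts G = ug_verts G'"
  and bij_betw_fa: "bij_betw fa (ug_arcs G - \<Union>F) (ug_arcs G')"
  using contraction by (auto simp: forest_contraction_def)

lemma fv_eq_iff:
  "u \<in> ug_verts G \<Longrightarrow> v \<in> ug_verts G \<Longrightarrow> fv u = fv v \<longleftrightarrow> (u, v) \<in> (edge_rel G F)\<^sup>*"
  using contraction unfolding forest_contraction_def
  by (auto simp: G.reachable_restrict_iff)

lemma fv_in_verts: "v \<in> ug_verts G \<Longrightarrow> fv v \<in> ug_verts G'"
  using fv_image by blast

lemma mem_Union_F: "a \<in> \<Union>F \<longleftrightarrow> ug_edge G a \<in> F"
  using F_subset by (rule G.mem_Union_edges)

lemma rev_mem_Union_F: "ug_rev G a \<in> \<Union>F \<longleftrightarrow> a \<in> \<Union>F"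
  by (simp only: mem_Union_F G.ug_edge_rev)

lemma fa_in_arcs: "a \<in> ug_arcs G \<Longrightarrow> a \<notin> \<Union>F \<Longrightarrow> fa a \<in> ug_arcs G'"
  using bij_betw_fa bij_betwE by blast

lemma tail_fa: "a \<in> ug_arcs G \<Longrightarrow> a \<notin> \<Union>F \<Longrightarrow> ug_tail G' (fa a) = fv (ug_tail G a)"
  and rev_fa: "a \<in> ug_arcs G \<Longrightarrow> a \<notin> \<Union>F \<Longrightarrow> ug_rev G' (fa a) = fa (ug_rev G a)"
  using contraction by (auto simp: forest_contraction_def)

lemma head_fa:
  assumes "a \<in> ug_arcs G" "a \<notin> \<Union>F" shows "ug_head G' (fa a) = fv (ug_head G a)"
proof -
  have "ug_head G' (fa a) = ug_tail G' (fa (ug_rev G a))"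
    using G'.tail_arev[OF fa_in_arcs[OF assms]] rev_fa[OF assms] by simp
  also have "\<dots> = fv (ug_head G a)"
    using tail_fa[of "ug_rev G a"] assms rev_mem_Union_F G.tail_arev G.arev_in_arcs by metis
  finally show ?thesis .
qed

lemma fv_tail_eq_head:
  assumes "a \<in> \<Union>F" shows "fv (ug_head G a) = fv (ug_tail G a)"
proof -
  have a: "a \<in> ug_arcs G" using assms G.Union_edges_subset[OF F_subset] by blast
  have "(ug_tail G a, ug_head G a) \<in> edge_rel G F" using assms by (auto simp: edge_rel_def)
  then show ?thesis using a fv_eq_iff[of "ug_tail G a" "ug_head G a"] by auto
qed

lemma fa_eq_iff:
  "a \<in> ug_arcs G \<Longrightarrow> a \<notin> \<Union>F \<Longrightarrow> b \<in> ug_arcs G \<Longrightarrow> b \<notin> \<Union>F \<Longrightarrow> fa a = fa b \<longleftrightarrow> a = b"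
  using bij_betw_fa unfolding bij_betw_def inj_on_def by blast

lemma arc'_cases:
  assumes "b \<in> ug_arcs G'"
  obtains a where "a \<in> ug_arcs G" "a \<notin> \<Union>F" "b = fa a"
  using assms bij_betw_fa unfolding bij_betw_def by blast

lemma fa_image_ug_edge:
  "a \<in> ug_arcs G \<Longrightarrow> a \<notin> \<Union>F \<Longrightarrow> fa ` ug_edge G a = ug_edge G' (fa a)"
  by (simp add: ug_edge_def rev_fa)

lemma edge_cases:
  assumes "e \<in> ug_edges G - F"
  obtains a where "a \<in> ug_arcs G" "a \<notin> \<Union>F" "e = ug_edge G a" "fa ` e = ug_edge G' (fa a)"
proof -
  obtain a where a: "a \<in> ug_arcs G" "e = ug_edge G a" using assms by (auto simp: ug_edges_def)
  then show ?thesis using assms that mem_Union_F fa_image_ug_edge by blast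
qed

lemma bij_betw_edges: "bij_betw (\<lambda>e. fa ` e) (ug_edges G - F) (ug_edges G')"
proof (rule bij_betw_imageI)
  have "\<Union>(ug_edges G - F) \<subseteq> ug_arcs G - \<Union>F"
  proof
    fix a assume "a \<in> \<Union>(ug_edges G - F)"
    then have "ug_edge G a \<in> ug_edges G - F" by (simp only: G.mem_Union_edges[OF Diff_subset])
    then show "a \<in> ug_arcs G - \<Union>F" by (simp only: G.ug_edge_in_ug_edges mem_Union_F Diff_iff not_False_eq_True simp_thms)
  qed
  then show "inj_on (\<lambda>e. fa ` e) (ug_edges G - F)"
    using bij_betw_fa unfolding bij_betw_def by (blast intro: inj_on_image inj_on_subset)
  show "(\<lambda>e. fa ` e) ` (ug_edges G - F) = ug_edges G'"
  proof (intro equalityI subsetI)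
    fix e' assume "e' \<in> (\<lambda>e. fa ` e) ` (ug_edges G - F)"
    then show "e' \<in> ug_edges G'"
      by (auto elim!: edge_cases simp: G'.ug_edge_in_ug_edges fa_in_arcs)
  next
    fix e' assume "e' \<in> ug_edges G'"
    then obtain b where "b \<in> ug_arcs G'" "e' = ug_edge G' b" by (auto simp: ug_edges_def)
    then obtain a where "a \<in> ug_arcs G" "a \<notin> \<Union>F" "e' = fa ` ug_edge G a"
      by (metis arc'_cases fa_image_ug_edge)
    then show "e' \<in> (\<lambda>e. fa ` e) ` (ug_edges G - F)"
      using mem_Union_F G.ug_edge_in_ug_edges by blast
  qed
qed

text \<open>The fibres of \<open>fv\<close> are the components of \<open>F\<close>, and uncontracted
  arcs correspond one to one. A path downstairs therefore lifts arc by arc, the gaps between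
  consecutive lifts being bridged inside \<open>F\<close>.\<close>

lemma edge_rel_contraction_iff:
  assumes Z: "F \<subseteq> Z" "Z \<subseteq> ug_edges G" and "x \<in> ug_verts G" "y \<in> ug_verts G"
  shows "(fv x, fv y) \<in> (edge_rel G' ((\<lambda>e. fa ` e) ` (Z - F)))\<^sup>* \<longleftrightarrow> (x, y) \<in> (edge_rel G Z)\<^sup>*"
    (is "_ \<in> ?R'\<^sup>* \<longleftrightarrow> _ \<in> ?R\<^sup>*")
proof
  assume "(x, y) \<in> ?R\<^sup>*"
  then show "(fv x, fv y) \<in> ?R'\<^sup>*"
  proof (induction rule: rtrancl_induct)
    case (step y z)
    then obtain a where a: "a \<in> \<Union>Z" "y = ug_tail G a" "z = ug_head G a"
      by (auto simp: edge_rel_def)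
    show ?case
    proof (cases "a \<in> \<Union>F")
      case True
      then show ?thesis using step.IH a(2,3) fv_tail_eq_head by simp
    next
      case False
      have "a \<in> ug_arcs G" using a(1) G.Union_edges_subset[OF Z(2)] by blast
      moreover have "ug_edge G a \<in> Z - F"
        using a(1) False unfolding mem_Union_F G.mem_Union_edges[OF Z(2)] by blast
      ultimately have "a \<in> ug_arcs G" "ug_edge G a \<in> Z - F" by blast+
      then have "fa a \<in> \<Union>((\<lambda>e. fa ` e) ` (Z - F))"
        by (intro UnionI[of "fa ` ug_edge G a"] imageI) (simp_all add: ug_edge_def)
      then have "(ug_tail G' (fa a), ug_head G' (fa a)) \<in> ?R'"
        unfolding edge_rel_def by blast
      then have "(fv y, fv z) \<in> ?R'"
        using tail_fa head_fa False \<open>a \<in> ug_arcs G\<close> a(2,3) by simp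
      with step.IH show ?thesis by (rule rtrancl_into_rtrancl)
    qed
  qed simp
next
  have F_Z: "(edge_rel G F)\<^sup>* \<subseteq> ?R\<^sup>*" by (intro rtrancl_mono edge_rel_mono Z)
  assume "(fv x, fv y) \<in> ?R'\<^sup>*"
  \<comment> \<open>The claim is made for all preimages of the current vertex, because the lift of
    the next arc may start at another preimage than the one where the previous lift ended.\<close>
  then have "\<forall>y \<in> ug_verts G. v = fv y \<longrightarrow> (x, y) \<in> ?R\<^sup>*" if "v = fv y" for v
    unfolding that
  proof (induction rule: rtrancl_induct)
    case base
    then show ?case using assms(3) fv_eq_iff F_Z by blast
  next
    case (step v w)
    then obtain e b where b: "e \<in> Z - F" "b \<in> fa ` e" "v = ug_tail G' b" "w = ug_head G' b"
      by (auto simp: edge_rel_def)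
    then obtain c where "c \<in> e" "b = fa c" by blast
    then have "c \<in> \<Union>(Z - F)" using b(1) by blast
    then have c: "c \<in> ug_arcs G" "c \<notin> \<Union>F" "c \<in> \<Union>Z"
      using Z G.mem_Union_edges[of "Z - F" c] mem_Union_F G.ug_edge_in_ug_edges[of c] by auto
    have "v = fv (ug_tail G c)" "w = fv (ug_head G c)"
      using tail_fa head_fa c b(3,4) \<open>b = fa c\<close> by simp_all
    moreover have "(ug_tail G c, ug_head G c) \<in> ?R" using c(3) by (auto simp: edge_rel_def)
    ultimately have "w = fv (ug_head G c)" "(x, ug_head G c) \<in> ?R\<^sup>*"
      using step.IH c(1) by (auto intro: rtrancl_into_rtrancl)
    then show ?case
      using fv_eq_iff[of "ug_head G c"] F_Z c(1) by (auto intro: rtrancl_trans)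
  qed
  with assms(4) show "(x, y) \<in> ?R\<^sup>*" by blast
qed

lemma fa_image_subset: "Z \<subseteq> ug_edges G \<Longrightarrow> (\<lambda>e. fa ` e) ` (Z - F) \<subseteq> ug_edges G'"
  using bij_betw_edges unfolding bij_betw_def by blast

lemma card_fa_image:
  "Z \<subseteq> ug_edges G \<Longrightarrow> card ((\<lambda>e. fa ` e) ` (Z - F)) = card (Z - F)"
  using bij_betw_edges unfolding bij_betw_def by (intro card_image) (blast intro: inj_on_subset)

end

lemma ugraph_contractionI:
  "bidirected_ugraph G \<Longrightarrow> bidirected_ugraph G' \<Longrightarrow> forest_contraction G G' F fv fa \<Longrightarrow>
     ugraph_contraction G G' F fv fa"
  by (simp add: ugraph_contraction_def ugraph_contraction_axioms_def)

locale finite_ugraph_contraction = ugraph_contraction G G' F fv fa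
  for G :: "('v, 'a) ugraph" and G' :: "('w, 'b) ugraph" and F fv fa +
  assumes finite_verts: "finite (ug_verts G)" and finite_arcs: "finite (ug_arcs G)"
begin

lemma finite_edges: "finite (ug_edges G)"
  using finite_arcs by (simp add: ug_edges_def)

lemma finite_verts': "finite (ug_verts G')"
  using finite_verts fv_image by (metis finite_imageI)

lemma finite_arcs': "finite (ug_arcs G')"
  using finite_arcs bij_betw_finite[OF bij_betw_fa] by blast

text \<open>The vertices downstairs are the components of the forest \<open>F\<close>, so the forest
  count for \<open>F\<close> is the formula.\<close>

lemma card_verts: "card (ug_verts G) = card F + card (ug_verts G')"
proof -
  have "card (edge_component G F ` ug_verts G) = card (fv ` ug_verts G)"
    by (rule card_image_eq_if_same_kernel) (simp add: G.edge_component_eq_iff F_subset fv_eq_iff)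
  then show ?thesis
    using G.acyclic_edges_iff_card[OF finite_verts finite_arcs F_subset] acyclic_F fv_image by simp
qed

lemma card_edges: "card (ug_edges G) = card F + card (ug_edges G')"
  using bij_betw_same_card[OF bij_betw_edges] card_mono[OF finite_edges F_subset]
    card_Diff_subset[OF finite_subset[OF F_subset finite_edges] F_subset]
  by linarith

lemma genus_contraction: "genus G' = genus G"
  unfolding genus_def using card_verts card_edges by simp

text \<open>Contracting \<open>F\<close> lowers the number of vertices and the size of
  \<open>Z\<close> both by |F| and keeps the number of components, so the numerical criterion holds
  upstairs iff it holds downstairs. No cycle has to be lifted or projected.\<close>

lemma acyclic_edges_contraction_iff:
  assumes Z: "F \<subseteq> Z" "Z \<subseteq> ug_edges G"
  shows "acyclic_edges G' ((\<lambda>e. fa ` e) ` (Z - F)) \<longleftrightarrow> acyclic_edges G Z"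
proof -
  let ?Z' = "(\<lambda>e. fa ` e) ` (Z - F)"
  have Z': "?Z' \<subseteq> ug_edges G'" by (rule fa_image_subset[OF Z(2)])
  have "card (edge_component G' ?Z' ` ug_verts G') = card ((\<lambda>x. edge_component G' ?Z' (fv x)) ` ug_verts G)"
    by (simp add: fv_image[symmetric] image_image)
  also have "\<dots> = card (edge_component G Z ` ug_verts G)"
    by (rule card_image_eq_if_same_kernel)
       (simp add: G.edge_component_eq_iff[OF Z(2)] G'.edge_component_eq_iff[OF Z'] fv_in_verts
          edge_rel_contraction_iff[OF Z])
  moreover have "card Z = card F + card ?Z'"
    using card_fa_image[OF Z(2)] card_mono[OF finite_subset[OF Z(2) finite_edges] Z(1)]
      card_Diff_subset[OF finite_subset[OF F_subset finite_edges] Z(1)]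
    by linarith
  ultimately show ?thesis
    using card_verts
    unfolding G.acyclic_edges_iff_card[OF finite_verts finite_arcs Z(2)]
      G'.acyclic_edges_iff_card[OF finite_verts' finite_arcs' Z']
    by linarith
qed

end

section \<open>Composition and factorization of contractions\<close>

text \<open>Well-definedness of the vertex map induced on \<open>G1\<close>: the chosen preimage of
  \<open>p v\<close> is joined to \<open>v\<close> by a path in \<open>F0\<close>, and
  \<open>fv\<close> is constant along it.\<close>

lemma fv_factor:
  assumes "ugraph_contraction G G1 F0 p q" "ugraph_contraction G G2 F fv fa" "F0 \<subseteq> F" and v: "v \<in> ug_verts G"
  shows "fv (inv_into (ug_verts G) p (p v)) = fv v"
proof -
  interpret A: ugraph_contraction G G1 F0 p q by fact
  interpret C: ugraph_contraction G G2 F fv fa by fact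
  let ?v = "inv_into (ug_verts G) p (p v)"
  have v': "?v \<in> ug_verts G" "p ?v = p v" using v by (auto simp: inv_into_into f_inv_into_f)
  then have "(?v, v) \<in> (edge_rel G F0)\<^sup>*" using v by (simp add: A.fv_eq_iff)
  then have "(?v, v) \<in> (edge_rel G F)\<^sup>*" using rtrancl_mono[OF edge_rel_mono[OF assms(3)]] by blast
  then show ?thesis using C.fv_eq_iff[OF v'(1) v] by simp
qed

lemma mem_Union_comp:
  assumes "ugraph_contraction G G1 F p q" "ugraph_contraction G1 G2 F1 p1 q1" and a: "a \<in> ug_arcs G"
  shows "a \<in> \<Union>(F \<union> {e \<in> ug_edges G - F. q ` e \<in> F1}) \<longleftrightarrow> a \<in> \<Union>F \<or> q a \<in> \<Union>F1"
proof -
  interpret A: ugraph_contraction G G1 F p q by fact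
  interpret B: ugraph_contraction G1 G2 F1 p1 q1 by fact
  define Z where "Z = F \<union> {e \<in> ug_edges G - F. q ` e \<in> F1}"
  have Z: "F \<subseteq> Z" "Z \<subseteq> ug_edges G" using A.F_subset by (auto simp: Z_def)
  show ?thesis
    unfolding Z_def[symmetric]
  proof (cases "a \<in> \<Union>F")
    case False
    then have "ug_edge G a \<notin> F" by (simp only: A.mem_Union_F simp_thms)
    then show "a \<in> \<Union>Z \<longleftrightarrow> a \<in> \<Union>F \<or> q a \<in> \<Union>F1"
      unfolding A.G.mem_Union_edges[OF Z(2)] A.mem_Union_F B.mem_Union_F
      using A.fa_image_ug_edge[OF a False] a by (simp add: Z_def A.G.ug_edge_in_ug_edges)
  qed (use Z(1) in blast)
qed

lemma mem_Union_factor: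
  assumes "ugraph_contraction G G1 F0 p q" and F: "F \<subseteq> ug_edges G" "F0 \<subseteq> F" and a: "a \<in> ug_arcs G" "a \<notin> \<Union>F0"
  shows "q a \<in> \<Union>((\<lambda>e. q ` e) ` (F - F0)) \<longleftrightarrow> a \<in> \<Union>F"
proof -
  interpret A: ugraph_contraction G G1 F0 p q by fact
  define F1 where "F1 = (\<lambda>e. q ` e) ` (F - F0)"
  have F1: "F1 \<subseteq> ug_edges G1" unfolding F1_def by (rule A.fa_image_subset[OF F(1)])
  have "ug_edge G a \<notin> F0" using a by (simp only: A.mem_Union_F simp_thms)
  moreover have "q ` ug_edge G a \<in> F1 \<longleftrightarrow> ug_edge G a \<in> F - F0"
    using A.bij_betw_edges F(1) A.G.ug_edge_in_ug_edges[of a] a(1) \<open>ug_edge G a \<notin> F0\<close>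
    unfolding bij_betw_def F1_def by (intro inj_on_image_mem_iff[where B = "ug_edges G - F0"]) auto
  ultimately show ?thesis
    unfolding F1_def[symmetric] A.G'.mem_Union_edges[OF F1] A.G.mem_Union_edges[OF F(1)]
      A.fa_image_ug_edge[OF a, symmetric] by blast
qed

text \<open>The composite contracts \<open>F\<close> together with the edges that become edges of
  \<open>F1\<close>. Acyclicity of this union is pulled back from \<open>F1\<close> by the component
  count, and the condition on vertices by the correspondence of paths.\<close>

lemma forest_contraction_comp:
  assumes "finite_ugraph_contraction G G1 F p q" "ugraph_contraction G1 G2 F1 p1 q1"
  shows "forest_contraction G G2 (F \<union> {e \<in> ug_edges G - F. q ` e \<in> F1}) (\<lambda>v. p1 (p v)) (\<lambda>a. q1 (q a))"
proof -
  define Z where "Z = F \<union> {e \<in> ug_edges G - F. q ` e \<in> F1}"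
  interpret A: finite_ugraph_contraction G G1 F p q by fact
  interpret B: ugraph_contraction G1 G2 F1 p1 q1 by fact
  have Z: "F \<subseteq> Z" "Z \<subseteq> ug_edges G" using A.F_subset by (auto simp: Z_def)
  have Z': "(\<lambda>e. q ` e) ` (Z - F) = F1"
  proof -
    have "e \<in> (\<lambda>e. q ` e) ` (Z - F)" if e: "e \<in> F1" for e
    proof -
      have "e \<in> (\<lambda>e. q ` e) ` (ug_edges G - F)"
        using e B.F_subset A.bij_betw_edges unfolding bij_betw_def by (simp only: subset_iff)
      then show ?thesis using e by (auto simp: Z_def)
    qed
    moreover have "(\<lambda>e. q ` e) ` (Z - F) \<subseteq> F1" by (auto simp: Z_def)
    ultimately show ?thesis by blast
  qed
  have mem: "a \<in> \<Union>Z \<longleftrightarrow> a \<in> \<Union>F \<or> q a \<in> \<Union>F1" if "a \<in> ug_arcs G" for a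
    unfolding Z_def by (rule mem_Union_comp[OF A.ugraph_contraction_axioms assms(2) that])
  have "q ` (ug_arcs G - \<Union>Z) = ug_arcs G1 - \<Union>F1"
  proof (intro equalityI subsetI)
    fix b assume "b \<in> q ` (ug_arcs G - \<Union>Z)"
    then obtain a where a: "a \<in> ug_arcs G" "a \<notin> \<Union>Z" "b = q a" by blast
    then show "b \<in> ug_arcs G1 - \<Union>F1" using mem[OF a(1)] A.fa_in_arcs[OF a(1)] by blast
  next
    fix b assume b: "b \<in> ug_arcs G1 - \<Union>F1"
    then obtain a where a: "a \<in> ug_arcs G" "a \<notin> \<Union>F" "b = q a" by (blast elim: A.arc'_cases)
    then show "b \<in> q ` (ug_arcs G - \<Union>Z)" using b mem[OF a(1)] by blast
  qed
  moreover have "inj_on q (ug_arcs G - \<Union>Z)"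
    using bij_betw_imp_inj_on[OF A.bij_betw_fa] Z(1) by (elim inj_on_subset) blast
  ultimately have bij: "bij_betw (\<lambda>a. q1 (q a)) (ug_arcs G - \<Union>Z) (ug_arcs G2)"
    using bij_betw_trans[OF bij_betw_imageI B.bij_betw_fa] by (simp add: comp_def)
  have rev: "ug_tail G2 (q1 (q a)) = p1 (p (ug_tail G a)) \<and> ug_rev G2 (q1 (q a)) = q1 (q (ug_rev G a))"
    if a: "a \<in> ug_arcs G - \<Union>Z" for a
  proof -
    have 1: "a \<in> ug_arcs G" "a \<notin> \<Union>F" "q a \<notin> \<Union>F1" using mem a by blast+
    show ?thesis
      using B.tail_fa[OF A.fa_in_arcs[OF 1(1,2)] 1(3)] B.rev_fa[OF A.fa_in_arcs[OF 1(1,2)] 1(3)]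
        A.tail_fa[OF 1(1,2)] A.rev_fa[OF 1(1,2)] by simp
  qed
  have ac: "acyclic_edges G Z"
    using A.acyclic_edges_contraction_iff[OF Z] unfolding Z' using B.acyclic_F by simp
  have ker: "p1 (p u) = p1 (p v) \<longleftrightarrow> reachable (ug_dig G\<lparr>arcs := \<Union>Z\<rparr>) u v"
    if "u \<in> ug_verts G" "v \<in> ug_verts G" for u v
    using that A.edge_rel_contraction_iff[OF Z that] unfolding Z'
    by (simp only: A.G.reachable_restrict_iff[OF Z(2)] B.fv_eq_iff A.fv_in_verts simp_thms)
  show ?thesis
    unfolding forest_contraction_def Z_def[symmetric]
    using Z(2) ac bij rev ker A.fv_image B.fv_image by (auto simp: image_image[symmetric])
qed

text \<open>If the smaller forest \<open>F0\<close> is contracted first, what remains of the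
  contraction of \<open>F\<close> is again a contraction. For \<open>F0 = F\<close> this compares
  two contractions of one forest by an isomorphism; for empty forests it inverts an
  isomorphism.\<close>

lemma forest_contraction_factor:
  assumes "finite_ugraph_contraction G G1 F0 p q" "ugraph_contraction G G2 F fv fa" "F0 \<subseteq> F"
    and fv1: "\<And>v. v \<in> ug_verts G \<Longrightarrow> fv1 (p v) = fv v"
    and fa1: "\<And>a. a \<in> ug_arcs G \<Longrightarrow> a \<notin> \<Union>F \<Longrightarrow> fa1 (q a) = fa a"
  shows "forest_contraction G1 G2 ((\<lambda>e. q ` e) ` (F - F0)) fv1 fa1"
proof -
  define F1 where "F1 = (\<lambda>e. q ` e) ` (F - F0)"
  interpret A: finite_ugraph_contraction G G1 F0 p q by fact
  interpret B: ugraph_contraction G G2 F fv fa by fact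
  have F1: "F1 \<subseteq> ug_edges G1" unfolding F1_def by (rule A.fa_image_subset[OF B.F_subset])
  have mem: "q a \<in> \<Union>F1 \<longleftrightarrow> a \<in> \<Union>F" if "a \<in> ug_arcs G" "a \<notin> \<Union>F0" for a
    unfolding F1_def by (rule mem_Union_factor[OF A.ugraph_contraction_axioms B.F_subset assms(3) that])
  have arcs1: "ug_arcs G1 - \<Union>F1 = q ` (ug_arcs G - \<Union>F)"
  proof (intro equalityI subsetI)
    fix b assume b: "b \<in> ug_arcs G1 - \<Union>F1"
    then obtain a where a: "a \<in> ug_arcs G" "a \<notin> \<Union>F0" "b = q a" by (blast elim: A.arc'_cases)
    then show "b \<in> q ` (ug_arcs G - \<Union>F)" using b mem[OF a(1,2)] by blast
  next
    fix b assume "b \<in> q ` (ug_arcs G - \<Union>F)"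
    then obtain a where a: "a \<in> ug_arcs G" "a \<notin> \<Union>F" "b = q a" by blast
    then have "a \<notin> \<Union>F0" using assms(3) by blast
    then show "b \<in> ug_arcs G1 - \<Union>F1" using a mem[OF a(1)] A.fa_in_arcs[OF a(1)] by blast
  qed
  have bij: "bij_betw fa1 (ug_arcs G1 - \<Union>F1) (ug_arcs G2)"
    unfolding arcs1
  proof (rule bij_betw_imageI)
    show "inj_on fa1 (q ` (ug_arcs G - \<Union>F))"
    proof (rule inj_onI)
      fix b c assume "b \<in> q ` (ug_arcs G - \<Union>F)" "c \<in> q ` (ug_arcs G - \<Union>F)" "fa1 b = fa1 c"
      moreover from this obtain x y where xy: "x \<in> ug_arcs G" "x \<notin> \<Union>F" "b = q x"
          "y \<in> ug_arcs G" "y \<notin> \<Union>F" "c = q y" by (elim imageE DiffE)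
      ultimately have "fa x = fa y" using fa1[OF xy(1,2)] fa1[OF xy(4,5)] by simp
      then have "x = y" using B.fa_eq_iff[OF xy(1,2,4,5)] by blast
      then show "b = c" using xy by simp
    qed
    have "fa1 ` q ` (ug_arcs G - \<Union>F) = fa ` (ug_arcs G - \<Union>F)"
      unfolding image_image by (rule image_cong[OF refl]) (metis DiffE fa1)
    then show "fa1 ` q ` (ug_arcs G - \<Union>F) = ug_arcs G2"
      using B.bij_betw_fa by (simp only: bij_betw_def)
  qed
  have rev: "ug_tail G2 (fa1 b) = fv1 (ug_tail G1 b) \<and> ug_rev G2 (fa1 b) = fa1 (ug_rev G1 b)"
    if "b \<in> ug_arcs G1 - \<Union>F1" for b
  proof -
    from that obtain a where a: "a \<in> ug_arcs G" "a \<notin> \<Union>F" "b = q a" unfolding arcs1 by blast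
    then have a0: "a \<notin> \<Union>F0" using assms(3) by blast
    have "ug_rev G a \<notin> \<Union>F" using a(2) B.rev_mem_Union_F by metis
    then show ?thesis
      using a A.tail_fa[OF a(1) a0] A.rev_fa[OF a(1) a0] B.tail_fa[OF a(1,2)] B.rev_fa[OF a(1,2)]
        fa1[OF a(1,2)] fa1[of "ug_rev G a"] fv1 A.G.tail_in_verts A.G.arev_in_arcs by metis
  qed
  have ac: "acyclic_edges G1 F1"
    using A.acyclic_edges_contraction_iff[OF assms(3) B.F_subset] B.acyclic_F by (simp add: F1_def)
  have ker: "fv1 u = fv1 v \<longleftrightarrow> reachable (ug_dig G1\<lparr>arcs := \<Union>F1\<rparr>) u v"
    if uv: "u \<in> ug_verts G1" "v \<in> ug_verts G1" for u v
  proof -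
    obtain x y where xy: "x \<in> ug_verts G" "y \<in> ug_verts G" "u = p x" "v = p y"
      using uv A.fv_image by blast
    then show ?thesis
      using A.edge_rel_contraction_iff[OF assms(3) B.F_subset xy(1,2)] uv B.fv_eq_iff[OF xy(1,2)]
      by (simp only: F1_def[symmetric] fv1 A.G'.reachable_restrict_iff[OF F1] simp_thms)
  qed
  have im: "fv1 ` ug_verts G1 = ug_verts G2"
    unfolding A.fv_image[symmetric] B.fv_image[symmetric] image_image
    by (rule image_cong) (simp_all add: fv1)
  show ?thesis
    unfolding forest_contraction_def F1_def[symmetric] using F1 ac im ker bij rev by blast
qed

text \<open>Contracting the empty forest makes the vertex map injective. This puts isomorphisms
  under the results on contractions.\<close>

lemma graph_iso_iff_forest_contraction:
  assumes "bidirected_ugraph G"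
  shows "graph_iso G G' fv fa \<longleftrightarrow> forest_contraction G G' {} fv fa"
proof -
  interpret bidirected_ugraph G by fact
  have r: "reachable (ug_dig G\<lparr>arcs := {}\<rparr>) u v \<longleftrightarrow> u = v" if "u \<in> ug_verts G" "v \<in> ug_verts G" for u v
    using that reachable_restrict_iff[of "{}" u v] by (simp add: edge_rel_def)
  have "(\<forall>u\<in>ug_verts G. \<forall>v\<in>ug_verts G. fv u = fv v \<longleftrightarrow> reachable (ug_dig G\<lparr>arcs := {}\<rparr>) u v) \<longleftrightarrow>
      inj_on fv (ug_verts G)"
    unfolding inj_on_def using r by blast
  then show ?thesis
    by (simp only: graph_iso_def forest_contraction_def bij_betw_def Union_empty Diff_empty
         acyclic_edges_empty empty_subsetI simp_thms conj_ac)
qed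

lemma fcg_bidirected_ugraph: "finite_connected_graph G \<Longrightarrow> bidirected_ugraph G"
  by (simp add: finite_connected_graph_def bidirected_ugraph_def)

lemma fcg_finite: "finite_connected_graph G \<Longrightarrow> finite (ug_verts G) \<and> finite (ug_arcs G)"
  using fin_digraph.finite_verts fin_digraph.finite_arcs by (auto simp: finite_connected_graph_def)

context bidirected_ugraph
begin

lemma connected_iff_edge_rel:
  "Digraph_Component.connected (ug_dig G) \<longleftrightarrow> ug_verts G \<noteq> {} \<and>
     (\<forall>u \<in> ug_verts G. \<forall>v \<in> ug_verts G. (u, v) \<in> (edge_rel G (ug_edges G))\<^sup>*)"
proof -
  have "\<Union>(ug_edges G) = ug_arcs G" by (auto simp: ug_edges_def ug_edge_def)
  then have e: "edge_rel G (ug_edges G) = arcs_ends (ug_dig G)"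
    by (simp add: edge_rel_def arcs_ends_conv)
  have "r\<^sup>s = r" if "sym r" for r :: "('v \<times> 'v) set"
    using that by (auto simp: symcl_def sym_def)
  from this[OF sym_edge_rel[OF subset_refl]]
  have s: "(arcs_ends (ug_dig G))\<^sup>s = edge_rel G (ug_edges G)" by (simp add: e)
  have "(u, v) \<in> rtrancl_on (ug_verts G) (edge_rel G (ug_edges G)) \<longleftrightarrow> (u, v) \<in> (edge_rel G (ug_edges G))\<^sup>*"
    if "u \<in> ug_verts G" "v \<in> ug_verts G" for u v
  proof
    assume "(u, v) \<in> (edge_rel G (ug_edges G))\<^sup>*"
    then show "(u, v) \<in> rtrancl_on (ug_verts G) (edge_rel G (ug_edges G))"
      by (rule rtrancl_consistent_rtrancl_on) (use that edge_rel_subset[of "ug_edges G"] in auto)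
  qed (rule rtrancl_on_rtranclI)
  then show ?thesis unfolding connected_conv s by simp
qed

end

context finite_ugraph_contraction
begin

lemma finite_connected_graph_contraction:
  assumes "finite_connected_graph G"
  shows "finite_connected_graph G'"
proof -
  have "(\<lambda>e. fa ` e) ` (ug_edges G - F) = ug_edges G'"
    using bij_betw_edges by (simp add: bij_betw_def)
  then have tr: "(fv x, fv y) \<in> (edge_rel G' (ug_edges G'))\<^sup>*"
    if "(x, y) \<in> (edge_rel G (ug_edges G))\<^sup>*" "x \<in> ug_verts G" "y \<in> ug_verts G" for x y
    using edge_rel_contraction_iff[OF F_subset subset_refl that(2,3)] that(1) by simp
  have c: "ug_verts G \<noteq> {}" "\<And>u v. u \<in> ug_verts G \<Longrightarrow> v \<in> ug_verts G \<Longrightarrow> (u, v) \<in> (edge_rel G (ug_edges G))\<^sup>*"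
    using assms unfolding finite_connected_graph_def G.connected_iff_edge_rel by simp_all
  have "ug_verts G' \<noteq> {}" using c(1) fv_image by (metis image_is_empty)
  moreover have "(u, v) \<in> (edge_rel G' (ug_edges G'))\<^sup>*" if uv: "u \<in> ug_verts G'" "v \<in> ug_verts G'" for u v
  proof -
    obtain x y where xy: "u = fv x" "x \<in> ug_verts G" "v = fv y" "y \<in> ug_verts G"
      using uv unfolding fv_image[symmetric] by (elim imageE)
    show ?thesis unfolding xy(1,3) by (rule tr[OF c(2)[OF xy(2,4)] xy(2,4)])
  qed
  ultimately have "Digraph_Component.connected (ug_dig G')"
    unfolding G'.connected_iff_edge_rel by simp
  moreover have "fin_digraph (ug_dig G')"
    using finite_verts' finite_arcs' G'.wf_digraph_axioms
    by (simp add: fin_digraph_def fin_digraph_axioms_def)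
  ultimately show ?thesis
    unfolding finite_connected_graph_def using G'.bidirected_digraph by simp
qed

end

lemma finite_ugraph_contractionI:
  assumes "finite_connected_graph G" "bidirected_ugraph G'" "forest_contraction G G' F fv fa"
  shows "finite_ugraph_contraction G G' F fv fa"
  using assms fcg_finite[OF assms(1)] fcg_bidirected_ugraph[OF assms(1)]
  by (simp add: finite_ugraph_contraction_def finite_ugraph_contraction_axioms_def ugraph_contractionI)

text \<open>The vertices are representatives \<open>\<rho> v\<close> of the components, so that the
  contracted graph has the same types as \<open>G\<close>; arcs keep their names. A reversal must
  fix everything that is not an arc, hence the identity on contracted arcs.\<close>

definition contract_forest :: "('v, 'a) ugraph \<Rightarrow> 'a set set \<Rightarrow> ('v \<Rightarrow> 'v) \<Rightarrow> ('v, 'a) ugraph" where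
  "contract_forest G F \<rho> =
     \<lparr>ug_dig = \<lparr>verts = \<rho> ` ug_verts G, arcs = ug_arcs G - \<Union>F,
        tail = \<lambda>a. \<rho> (ug_tail G a), head = \<lambda>a. \<rho> (ug_head G a)\<rparr>,
      ug_rev = \<lambda>a. if a \<in> \<Union>F then a else ug_rev G a\<rparr>"

lemma (in bidirected_ugraph) contraction_exists:
  assumes F: "F \<subseteq> ug_edges G" "acyclic_edges G F"
  obtains \<rho> G' where "bidirected_ugraph G'" "forest_contraction G (G' :: ('v, 'a) ugraph) F \<rho> (\<lambda>a. a)"
proof -
  \<comment> \<open>The choice is made from the component as a set, so all vertices of one component
    get the same representative.\<close>
  define \<rho> where "\<rho> v = (SOME u. u \<in> edge_component G F v)" for v
  let ?G' = "contract_forest G F \<rho>"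
  have \<rho>: "\<rho> v \<in> ug_verts G" "(v, \<rho> v) \<in> (edge_rel G F)\<^sup>*" if "v \<in> ug_verts G" for v
  proof -
    have "v \<in> edge_component G F v" using that by (simp add: edge_component_def)
    then have "\<rho> v \<in> edge_component G F v" unfolding \<rho>_def by (rule someI)
    then show "\<rho> v \<in> ug_verts G" "(v, \<rho> v) \<in> (edge_rel G F)\<^sup>*" by (auto simp: edge_component_def)
  qed
  have \<rho>_eq: "\<rho> u = \<rho> v \<longleftrightarrow> (u, v) \<in> (edge_rel G F)\<^sup>*" if "u \<in> ug_verts G" "v \<in> ug_verts G" for u v
  proof
    assume "\<rho> u = \<rho> v"
    then have "(u, \<rho> v) \<in> (edge_rel G F)\<^sup>*" using \<rho>(2)[OF that(1)] by simp
    moreover have "(\<rho> v, v) \<in> (edge_rel G F)\<^sup>*"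
      using \<rho>(2)[OF that(2)] by (rule symD[OF sym_rtrancl[OF sym_edge_rel[OF F(1)]]])
    ultimately show "(u, v) \<in> (edge_rel G F)\<^sup>*" by (rule rtrancl_trans)
  next
    assume "(u, v) \<in> (edge_rel G F)\<^sup>*"
    then have "edge_component G F u = edge_component G F v" using that F(1) by (simp add: edge_component_eq_iff)
    then show "\<rho> u = \<rho> v" by (simp add: \<rho>_def)
  qed
  have rev: "ug_rev G a \<in> \<Union>F \<longleftrightarrow> a \<in> \<Union>F" for a
    unfolding mem_Union_edges[OF F(1)] by simp
  have "wf_digraph (ug_dig ?G')"
    by unfold_locales (auto simp: contract_forest_def)
  then have "bidirected_digraph (ug_dig ?G') (ug_rev ?G')"
  proof (rule wf_digraph.bidirected_digraphI)
    have arcs: "ug_arcs ?G' = ug_arcs G - \<Union>F" and r: "ug_rev ?G' a = (if a \<in> \<Union>F then a else ug_rev G a)" for a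
      by (simp_all add: contract_forest_def)
    fix a
    show "ug_rev ?G' a = a" if "a \<notin> ug_arcs ?G'"
      unfolding r using that arev_eq[of a] by (cases "a \<in> \<Union>F") (simp_all only: arcs Diff_iff simp_thms if_True if_False)
    assume "a \<in> ug_arcs ?G'"
    then have a: "a \<in> ug_arcs G" "a \<notin> \<Union>F" by (simp_all only: arcs Diff_iff not_False_eq_True)
    then have a': "(a \<in> \<Union>F) = False" "(ug_rev G a \<in> \<Union>F) = False" by (simp_all only: rev)
    show "ug_rev ?G' a \<noteq> a" using arev_neq[OF a(1)] by (simp only: r a' if_False simp_thms)
    show "ug_rev ?G' (ug_rev ?G' a) = a" by (simp only: r a' if_False arev_arev)
    have "ug_tail ?G' (ug_rev G a) = ug_head ?G' a" using a(1) by (simp add: contract_forest_def)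
    then show "ug_tail ?G' (ug_rev ?G' a) = ug_head ?G' a" by (simp only: r a' if_False)
  qed
  then have "bidirected_ugraph ?G'" by (simp add: bidirected_ugraph_def)
  moreover have "forest_contraction G ?G' F \<rho> (\<lambda>a. a)"
    unfolding forest_contraction_def reachable_restrict_iff[OF F(1)]
    using F \<rho>_eq by (simp add: contract_forest_def bij_betw_def inj_on_def del: Union_iff)
  ultimately show ?thesis by (rule that)
qed

section \<open>Induced maps of realizations\<close>

context ugraph_contraction
begin

abbreviation \<pi> :: "('v, 'a) gpoint \<Rightarrow> ('w, 'b) gpoint" where
  "\<pi> \<equiv> realization_map G F fv fa"

lemma
  assumes "a \<in> ug_arcs G"
  shows map_arc_point: "a \<notin> \<Union>F \<Longrightarrow> \<pi> (arc_point G a t) = arc_point G' (fa a) t"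
    and map_arc_point_contracted: "a \<in> \<Union>F \<Longrightarrow> \<pi> (arc_point G a t) = Vertex (fv (ug_tail G a))"
  using realization_map_arc_point[OF G.bidirected_digraph G'.bidirected_digraph contraction assms] by blast+

lemma map_image_gpoints: "\<pi> ` gpoints G = gpoints G'"
proof (intro equalityI subsetI)
  fix y assume "y \<in> \<pi> ` gpoints G"
  then obtain x where x: "x \<in> gpoints G" "y = \<pi> x" by blast
  from x(1) show "y \<in> gpoints G'"
  proof (cases rule: gpoints_cases)
    case (vertex v)
    then show ?thesis using x(2) by (simp add: fv_in_verts gpoints_def)
  next
    case (arc a t)
    show ?thesis
    proof (cases "a \<in> \<Union>F")
      case True
      show ?thesis
        unfolding x(2) arc(3) map_arc_point_contracted[OF arc(1) True]
        using fv_in_verts[OF G.tail_in_verts[OF arc(1)]] by (simp add: gpoints_def)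
    next
      case False
      show ?thesis
        unfolding x(2) arc(3) map_arc_point[OF arc(1) False]
        by (rule arc_point_in_gpoints[OF fa_in_arcs[OF arc(1) False] arc(2)])
    qed
  qed
next
  fix y assume "y \<in> gpoints G'"
  then show "y \<in> \<pi> ` gpoints G"
  proof (cases rule: gpoints_cases)
    case (vertex v)
    then obtain u where "u \<in> ug_verts G" "v = fv u" using fv_image by blast
    then show ?thesis using vertex(2) by (intro image_eqI[of _ _ "Vertex u"]) (auto simp: gpoints_def)
  next
    case (arc b t)
    from arc(1) obtain a where "a \<in> ug_arcs G" "a \<notin> \<Union>F" "b = fa a" by (rule arc'_cases)
    then show ?thesis
      using arc(2,3) map_arc_point[of a t] arc_point_in_gpoints[of a G t]
      by (intro image_eqI[of _ _ "arc_point G a t"]) (simp_all only: simp_thms)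
  qed
qed

lemma continuous_map_realization_map: "continuous_map (realization G) (realization G') \<pi>"
proof (rule continuous_map_from_realization)
  show "\<pi> \<in> gpoints G \<rightarrow> topspace (realization G')" using map_image_gpoints by auto
  fix a assume a: "a \<in> ug_arcs G"
  show "continuous_map (top_of_set {0..1}) (realization G') (\<lambda>t. \<pi> (arc_point G a t))"
  proof (cases "a \<in> \<Union>F")
    case True
    then show ?thesis using fv_in_verts[OF G.tail_in_verts[OF a]]
      by (simp only: map_arc_point_contracted[OF a] continuous_map_const topspace_realization)
         (simp add: gpoints_def)
  next
    case False
    then show ?thesis using continuous_map_arc_point[OF fa_in_arcs[OF a]]
      by (simp only: map_arc_point[OF a] simp_thms)
  qed
qed

text \<open>Openness in \<open>G'\<close> is tested on arcs, and every arc of \<open>G'\<close> is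
  the image of an uncontracted arc of \<open>G\<close> with the same parameter.\<close>

lemma quotient_map_realization_map: "quotient_map (realization G) (realization G') \<pi>"
  unfolding quotient_map_def
proof (intro conjI allI impI)
  show "\<pi> ` topspace (realization G) = topspace (realization G')"
    by (simp add: map_image_gpoints)
  fix U assume U: "U \<subseteq> topspace (realization G')"
  show "openin (realization G) {x \<in> topspace (realization G). \<pi> x \<in> U} = openin (realization G') U"
  proof
    assume o: "openin (realization G) {x \<in> topspace (realization G). \<pi> x \<in> U}"
    have "openin (top_of_set {0..1}) {t \<in> {0..1}. arc_point G' b t \<in> U}" if b: "b \<in> ug_arcs G'" for b
    proof -
      obtain a where a: "a \<in> ug_arcs G" "a \<notin> \<Union>F" "b = fa a" using b by (rule arc'_cases)
      have "{t \<in> {0..1}. arc_point G a t \<in> {x \<in> topspace (realization G). \<pi> x \<in> U}} =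
          {t \<in> {0..1}. arc_point G' b t \<in> U}"
        by (rule Collect_cong) (simp add: map_arc_point[OF a(1,2)] arc_point_in_gpoints[OF a(1)] a(3) cong: conj_cong)
      moreover have "openin (top_of_set {0..1})
          {t \<in> {0..1}. arc_point G a t \<in> {x \<in> topspace (realization G). \<pi> x \<in> U}}"
        using o a(1) unfolding openin_realization by (elim conjE bspec)
      ultimately show ?thesis by (simp only:)
    qed
    then show "openin (realization G') U" using U by (simp add: openin_realization)
  qed (use continuous_map_realization_map in \<open>simp add: continuous_map_def\<close>)
qed

end

text \<open>An arc is collapsed by the first map, only by the second, or by neither;
  \<open>mem\<close> says that the composite collapses it in the first two cases.\<close>

lemma realization_map_comp:
  assumes "ugraph_contraction G G1 F p q" "ugraph_contraction G1 G2 F1 p1 q1"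
    and "ugraph_contraction G G2 F2 p2 q2"
    and mem: "\<And>a. a \<in> ug_arcs G \<Longrightarrow> a \<in> \<Union>F2 \<longleftrightarrow> a \<in> \<Union>F \<or> q a \<in> \<Union>F1"
    and p2: "\<And>v. v \<in> ug_verts G \<Longrightarrow> p2 v = p1 (p v)"
    and q2: "\<And>a. a \<in> ug_arcs G \<Longrightarrow> a \<notin> \<Union>F2 \<Longrightarrow> q2 a = q1 (q a)"
    and x: "x \<in> gpoints G"
  shows "realization_map G1 F1 p1 q1 (realization_map G F p q x) = realization_map G F2 p2 q2 x"
proof -
  interpret A: ugraph_contraction G G1 F p q by fact
  interpret B: ugraph_contraction G1 G2 F1 p1 q1 by fact
  interpret C: ugraph_contraction G G2 F2 p2 q2 by fact
  from x show ?thesis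
  proof (cases rule: gpoints_cases)
    case (vertex v)
    then show ?thesis by (simp add: p2)
  next
    case (arc a t)
    note a = arc(1)
    show ?thesis
    proof (cases "a \<in> \<Union>F")
      case True
      then have F2: "a \<in> \<Union>F2" by (simp only: mem[OF a] simp_thms)
      show ?thesis
        unfolding arc(3) A.map_arc_point_contracted[OF a True] C.map_arc_point_contracted[OF a F2]
          p2[OF A.G.tail_in_verts[OF a]] by simp
    next
      case False
      note qa = A.fa_in_arcs[OF a False]
      show ?thesis
      proof (cases "q a \<in> \<Union>F1")
        case True
        then have F2: "a \<in> \<Union>F2" by (simp only: mem[OF a] simp_thms)
        show ?thesis
          unfolding arc(3) A.map_arc_point[OF a False] B.map_arc_point_contracted[OF qa True]
            C.map_arc_point_contracted[OF a F2] A.tail_fa[OF a False] p2[OF A.G.tail_in_verts[OF a]] ..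
      next
        case F1: False
        with False have F2: "a \<notin> \<Union>F2" by (simp only: mem[OF a] simp_thms)
        show ?thesis
          unfolding arc(3) A.map_arc_point[OF a False] B.map_arc_point[OF qa F1] C.map_arc_point[OF a F2]
            q2[OF a F2] ..
      qed
    qed
  qed
qed

lemma homotopy_equivalence_map_compose:
  assumes "homotopy_equivalence_map X Y f" "homotopy_equivalence_map Y Z f'"
  shows "homotopy_equivalence_map X Z (f' \<circ> f)"
proof -
  obtain g where g: "continuous_map X Y f" "continuous_map Y X g"
      "homotopic_with (\<lambda>_. True) X X (g \<circ> f) id" "homotopic_with (\<lambda>_. True) Y Y (f \<circ> g) id"
    using assms(1) by (auto simp: homotopy_equivalence_map_def)
  obtain g' where g': "continuous_map Y Z f'" "continuous_map Z Y g'"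
      "homotopic_with (\<lambda>_. True) Y Y (g' \<circ> f') id" "homotopic_with (\<lambda>_. True) Z Z (f' \<circ> g') id"
    using assms(2) by (auto simp: homotopy_equivalence_map_def)
  have "homotopic_with (\<lambda>_. True) X Y ((g' \<circ> f') \<circ> f) (id \<circ> f)"
    by (rule homotopic_with_compose_continuous_map_right[OF g'(3) g(1)]) simp
  from homotopic_with_compose_continuous_map_left[OF this g(2), of "\<lambda>_. True"]
  have 1: "homotopic_with (\<lambda>_. True) X X (g \<circ> ((g' \<circ> f') \<circ> f)) (g \<circ> f)" by simp
  have "homotopic_with (\<lambda>_. True) Z Y ((f \<circ> g) \<circ> g') (id \<circ> g')"
    by (rule homotopic_with_compose_continuous_map_right[OF g(4) g'(2)]) simp
  from homotopic_with_compose_continuous_map_left[OF this g'(1), of "\<lambda>_. True"]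
  have 2: "homotopic_with (\<lambda>_. True) Z Z (f' \<circ> ((f \<circ> g) \<circ> g')) (f' \<circ> g')" by simp
  show ?thesis
    unfolding homotopy_equivalence_map_def
  proof (intro exI[of _ "g \<circ> g'"] conjI)
    show "homotopic_with (\<lambda>_. True) X X ((g \<circ> g') \<circ> (f' \<circ> f)) id"
      using homotopic_with_trans[OF 1 g(3)] by (simp only: comp_assoc)
    show "homotopic_with (\<lambda>_. True) Z Z ((f' \<circ> f) \<circ> (g \<circ> g')) id"
      using homotopic_with_trans[OF 2 g'(4)] by (simp only: comp_assoc)
  qed (rule continuous_map_compose[OF g(1) g'(1)] continuous_map_compose[OF g'(2) g(2)])+
qed

text \<open>A composite of realization maps is known to equal the realization map of the composite
  only at points of the graph, so agreement on the topological space has to suffice.\<close>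

lemma homotopy_equivalence_map_eq:
  assumes "homotopy_equivalence_map X Y f" "\<And>x. x \<in> topspace X \<Longrightarrow> f' x = f x"
  shows "homotopy_equivalence_map X Y f'"
proof -
  obtain g where g: "continuous_map X Y f" "continuous_map Y X g"
      "homotopic_with (\<lambda>_. True) X X (g \<circ> f) id" "homotopic_with (\<lambda>_. True) Y Y (f \<circ> g) id"
    using assms(1) by (auto simp: homotopy_equivalence_map_def)
  have "g y \<in> topspace X" if "y \<in> topspace Y" for y
    using g(2) that by (auto simp: continuous_map_def)
  then show ?thesis
    unfolding homotopy_equivalence_map_def
    by (intro exI[of _ g] conjI g(2) continuous_map_eq[OF g(1)]
        homotopic_with_eq[OF g(3)] homotopic_with_eq[OF g(4)])
       (simp_all add: assms(2))
qed

lemma homotopic_with_pointwise: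
  "homotopic_with (\<lambda>_. True) X Y f g \<Longrightarrow> (\<And>x. x \<in> topspace X \<Longrightarrow> f' x = f x) \<Longrightarrow>
     (\<And>x. x \<in> topspace X \<Longrightarrow> g' x = g x) \<Longrightarrow> homotopic_with (\<lambda>_. True) X Y f' g'"
  by (rule homotopic_with_eq) auto

section \<open>Contractions are homotopy equivalences\<close>

lemma quotient_map_lift:
  assumes "quotient_map X Y f" "continuous_map X Z h"
    and "\<And>x y. x \<in> topspace X \<Longrightarrow> y \<in> topspace X \<Longrightarrow> f x = f y \<Longrightarrow> h x = h y"
  shows "\<exists>k. continuous_map Y Z k \<and> (\<forall>x \<in> topspace X. k (f x) = h x)"
  by (rule quotient_map_lift_exists[OF assms(1,2)]) (use assms(3) in blast)+

lemma homotopic_with_trueI: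
  assumes "continuous_map (prod_topology (top_of_set {0..1::real}) X) Y h"
    and "\<And>x. x \<in> topspace X \<Longrightarrow> h (0, x) = p x" "\<And>x. x \<in> topspace X \<Longrightarrow> h (1, x) = q x"
  shows "homotopic_with (\<lambda>_. True) X Y p q"
  unfolding homotopic_with[where P = "\<lambda>_. True", OF refl] using assms by blast

text \<open>
  The homotopy collapsing the arc \<open>a\<close> to its tail moves the head of \<open>a\<close> backwards along \<open>a\<close> and
  pulls along the arcs ending there. Such an arc is first prolonged over parameters from -1 to 2,
  running along \<open>a\<close> in the added pieces, and then reparametrized.
\<close>

definition arc_ext :: "('v, 'a) ugraph \<Rightarrow> 'a \<Rightarrow> 'a \<Rightarrow> real \<Rightarrow> ('v, 'a) gpoint" where
  "arc_ext G a b s =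
     (if s \<le> 0 then if ug_tail G b = ug_head G a then arc_point G a (1 + s) else Vertex (ug_tail G b)
      else if s \<le> 1 then arc_point G b s
      else if ug_head G b = ug_head G a then arc_point G a (2 - s) else Vertex (ug_head G b))"

text \<open>For the other arcs the map \<open>s \<mapsto> (1 + 2 * t) * s - t\<close> sends [0, 1]
  onto [-t, 1 + t], so at time \<open>t\<close> each added piece has length \<open>t\<close>; the
  arc \<open>a\<close> itself is shrunk to its initial part of length \<open>1 - t\<close>.\<close>

definition slide :: "('v, 'a) ugraph \<Rightarrow> 'a \<Rightarrow> real \<Rightarrow> 'a \<Rightarrow> real \<Rightarrow> ('v, 'a) gpoint" where
  "slide G a t b s =
     (if b = a then arc_point G a ((1 - t) * s)
      else if b = ug_rev G a then arc_point G a ((1 - t) * (1 - s))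
      else arc_ext G a b ((1 + 2 * t) * s - t))"

text \<open>An interior point is a set of two coordinate pairs; \<open>slide_rev\<close> shows that
  both give the same image, so \<open>the_elem\<close> is meaningful. Among the vertices only the
  head of \<open>a\<close> moves.\<close>

fun slide_map :: "('v, 'a) ugraph \<Rightarrow> 'a \<Rightarrow> real \<Rightarrow> ('v, 'a) gpoint \<Rightarrow> ('v, 'a) gpoint" where
  "slide_map G a t (Vertex v) = (if v = ug_head G a then arc_point G a (1 - t) else Vertex v)"
| "slide_map G a t (Interior S) = the_elem ((\<lambda>(b, s). slide G a t b s) ` S)"

context bidirected_ugraph
begin

lemma arc_ext_rev:
  assumes "b \<in> ug_arcs G" shows "arc_ext G a (ug_rev G b) (1 - s) = arc_ext G a b s"
  using assms by (auto simp: arc_ext_def arc_point_rev arc_point_def algebra_simps)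

lemma slide_rev:
  assumes "a \<in> ug_arcs G" "b \<in> ug_arcs G"
  shows "slide G a t (ug_rev G b) (1 - s) = slide G a t b s"
proof -
  have "(1 + 2 * t) * (1 - s) - t = 1 - ((1 + 2 * t) * s - t)" by (simp add: algebra_simps)
  then have "arc_ext G a (ug_rev G b) ((1 + 2 * t) * (1 - s) - t) = arc_ext G a b ((1 + 2 * t) * s - t)"
    using arc_ext_rev[OF assms(2)] by metis
  moreover have "ug_rev G b = a \<longleftrightarrow> b = ug_rev G a" "ug_rev G b = ug_rev G a \<longleftrightarrow> b = a"
    using arev_arev by metis+
  ultimately show ?thesis
    using arev_neq[OF assms(1)] by (simp add: slide_def)
qed

lemma slide_map_arc_point:
  assumes a: "a \<in> ug_arcs G" "ug_tail G a \<noteq> ug_head G a" and b: "b \<in> ug_arcs G"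
    and s: "s \<in> {0..1}" and t: "t \<in> {0..1}"
  shows "slide_map G a t (arc_point G b s) = slide G a t b s"
proof -
  \<comment> \<open>At parameter 0, an arc starting at the head of \<open>a\<close> is evaluated by
    \<open>arc_ext\<close> at \<open>-t\<close>, which is the point \<open>1 - t\<close> of
    \<open>a\<close>, in agreement with the moving vertex. Parameter 1 follows by reversal.\<close>
  have 0: "slide_map G a t (arc_point G b 0) = slide G a t b 0" if "b \<in> ug_arcs G" for b
    using a t that arev_neq[OF a(1)] by (auto simp: arc_point_def slide_def arc_ext_def)
  consider "s = 0" | "s = 1" | "0 < s" "s < 1" using s by fastforce
  then show ?thesis
  proof cases
    case 1
    then show ?thesis using 0 b by simp
  next
    case 2
    then show ?thesis
      using 0[of "ug_rev G b"] b arc_point_rev[OF b, of 0] slide_rev[OF a(1) b, of t 1] by simp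
  next
    case 3
    then show ?thesis using slide_rev[OF a(1) b, of t s] by (simp add: arc_point_def)
  qed
qed

lemma continuous_map_arc_ext:
  assumes a: "a \<in> ug_arcs G" and b: "b \<in> ug_arcs G"
  shows "continuous_map (top_of_set {-1..2}) (realization G) (arc_ext G a b)"
proof -
  let ?X = "top_of_set {-1..2::real}"
  let ?Y = "subtopology ?X {x \<in> topspace ?X. 0 \<le> x}"
  have v: "Vertex (ug_tail G b) \<in> gpoints G" "Vertex (ug_head G b) \<in> gpoints G"
    using b by (auto simp: gpoints_def)
  have arc: "continuous_map (top_of_set S) (realization G) (\<lambda>s. arc_point G c (f s))"
    if "c \<in> ug_arcs G" "continuous_on S f" "f ` S \<subseteq> {0..1}" for c and S :: "real set" and f :: "real \<Rightarrow> real"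
    using continuous_map_compose[OF _ continuous_map_arc_point[OF that(1)], of "top_of_set S" f] that(2,3)
    by (simp add: comp_def image_subset_iff_funcset)
  have "continuous_map ?X (realization G)
     (\<lambda>s. if s \<le> 0 then if ug_tail G b = ug_head G a then arc_point G a (1 + s) else Vertex (ug_tail G b)
      else if s \<le> 1 then arc_point G b s
      else if ug_head G b = ug_head G a then arc_point G a (2 - s) else Vertex (ug_head G b))"
  proof (intro continuous_map_cases_le)
    show "continuous_map (subtopology ?X {x \<in> topspace ?X. x \<le> 0}) (realization G)
       (\<lambda>s. if ug_tail G b = ug_head G a then arc_point G a (1 + s) else Vertex (ug_tail G b))"
      unfolding subtopology_subtopology
      by (cases "ug_tail G b = ug_head G a") (auto simp: v intro!: arc a continuous_intros)
    show "continuous_map (subtopology ?Y {x \<in> topspace ?Y. x \<le> 1}) (realization G) (arc_point G b)"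
      unfolding subtopology_subtopology by (rule arc) (auto simp: b intro!: continuous_intros)
    show "continuous_map (subtopology ?Y {x \<in> topspace ?Y. 1 \<le> x}) (realization G) (\<lambda>s. if ug_head G b = ug_head G a then arc_point G a (2 - s) else Vertex (ug_head G b))"
      unfolding subtopology_subtopology
      by (cases "ug_head G b = ug_head G a") (auto simp: v intro!: arc a continuous_intros)
  qed (auto simp: arc_point_def subtopology_subtopology intro!: continuous_intros)
  then show ?thesis by (rule continuous_map_eq) (simp add: arc_ext_def)
qed

lemma continuous_map_slide:
  assumes a: "a \<in> ug_arcs G" and b: "b \<in> ug_arcs G"
  shows "continuous_map (prod_topology (top_of_set {0..1}) (top_of_set {0..1})) (realization G)
    (\<lambda>(t, s). slide G a t b s)"
proof -
  let ?I = "{0..1::real}"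
  have comp: "continuous_map (prod_topology (top_of_set ?I) (top_of_set ?I)) (realization G) (\<lambda>x. f (h x))"
    if "continuous_map (top_of_set S) (realization G) f" "continuous_on (?I \<times> ?I) h" "h ` (?I \<times> ?I) \<subseteq> S"
    for f and h :: "real \<times> real \<Rightarrow> real" and S
    using continuous_map_compose[OF _ that(1), of "prod_topology (top_of_set ?I) (top_of_set ?I)" h] that(2,3)
    by (simp add: comp_def image_subset_iff_funcset)
  have "continuous_map (prod_topology (top_of_set ?I) (top_of_set ?I)) (realization G)
      (\<lambda>x. arc_point G a ((1 - fst x) * snd x))"
    by (rule comp[OF continuous_map_arc_point[OF a]])
       (auto intro!: continuous_intros mult_nonneg_nonneg mult_le_one)
  moreover have "continuous_map (prod_topology (top_of_set ?I) (top_of_set ?I)) (realization G)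
      (\<lambda>x. arc_point G a ((1 - fst x) * (1 - snd x)))"
    by (rule comp[OF continuous_map_arc_point[OF a]])
       (auto intro!: continuous_intros mult_nonneg_nonneg mult_le_one)
  moreover have "continuous_map (prod_topology (top_of_set ?I) (top_of_set ?I)) (realization G)
      (\<lambda>x. arc_ext G a b ((1 + 2 * fst x) * snd x - fst x))"
  proof (rule comp[OF continuous_map_arc_ext[OF a b]])
    have "- 1 \<le> (1 + 2 * t) * s - t \<and> (1 + 2 * t) * s - t \<le> 2" if "t \<in> ?I" "s \<in> ?I" for t s
    proof -
      have "0 \<le> (1 + 2 * t) * s" "(1 + 2 * t) * s \<le> 1 + 2 * t"
        using that by (auto intro: mult_left_le)
      with that show ?thesis by (simp only: atLeastAtMost_iff) linarith
    qed
    then show "(\<lambda>x. (1 + 2 * fst x) * snd x - fst x) ` (?I \<times> ?I) \<subseteq> {- 1..2}" by auto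
  qed (intro continuous_intros)
  ultimately show ?thesis unfolding slide_def case_prod_unfold by simp
qed

end

context ugraph_contraction
begin

lemma arc_F_singleton: "F = {ug_edge G a} \<Longrightarrow> b \<in> \<Union>F \<longleftrightarrow> b = a \<or> b = ug_rev G a"
  by (simp add: ug_edge_def)

text \<open>The only nontrivial fibre is the closed edge of \<open>a\<close>. The points outside it
  are vertices other than its ends and interior points of uncontracted arcs; \<open>\<pi>\<close> is
  injective on these and keeps the two kinds apart.\<close>

lemma collapse_eq_cases:
  assumes F: "F = {ug_edge G a}" and a: "a \<in> ug_arcs G"
    and x: "x \<in> gpoints G" and y: "y \<in> gpoints G" and eq: "\<pi> x = \<pi> y"
  shows "x = y \<or> x \<in> arc_point G a ` {0..1} \<and> y \<in> arc_point G a ` {0..1}"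
proof -
  let ?u = "ug_tail G a" and ?w = "ug_head G a" and ?A = "arc_point G a ` {0..1}"
  let ?V = "\<lambda>z. \<exists>v. v \<in> ug_verts G \<and> v \<notin> {?u, ?w} \<and> z = Vertex v"
  let ?B = "\<lambda>z. \<exists>b s. b \<in> ug_arcs G \<and> b \<notin> \<Union>F \<and> s \<in> {0<..<1} \<and> z = arc_point G b s"
  have er: "edge_rel G F = {(?u, ?w), (?w, ?u)}"
    using a by (auto simp: F edge_rel_def ug_edge_def)
  have fv: "fv p = fv q \<longleftrightarrow> p = q \<or> p \<in> {?u, ?w} \<and> q \<in> {?u, ?w}"
    if "p \<in> ug_verts G" "q \<in> ug_verts G" for p q
    unfolding fv_eq_iff[OF that] er rtrancl_insert by auto
  have "0 \<in> {0..1::real}" "1 \<in> {0..1::real}" by auto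
  then have A: "Vertex ?u \<in> ?A" "Vertex ?w \<in> ?A"
    by (metis (no_types) arc_point_def image_eqI zero_neq_one)+
  have pA: "\<pi> z = Vertex (fv ?u)" if "z \<in> ?A" for z
  proof -
    have "a \<in> \<Union>F" using arc_F_singleton[OF F] by simp
    then show ?thesis using that map_arc_point_contracted[OF a] by (elim imageE) (simp only:)
  qed
  have cases: "z \<in> ?A \<or> ?V z \<or> ?B z" if z: "z \<in> gpoints G" for z
    using z
  proof (cases rule: gpoints_cases)
    case (vertex v)
    then show ?thesis using A by auto
  next
    case (arc b s)
    consider "s = 0 \<or> s = 1" | "s \<in> {0<..<1}" using arc(2) by fastforce
    then show ?thesis
    proof cases
      case 1
      then have "\<exists>v \<in> ug_verts G. z = Vertex v" using arc by (auto simp: arc_point_def)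
      then show ?thesis using A by auto
    next
      case 2
      have "z \<in> ?A" if "b = a \<or> b = ug_rev G a"
      proof (cases "b = a")
        case True
        then show ?thesis using arc(2,3) by simp
      next
        case False
        then show ?thesis
          using that arc(2,3) G.arc_point_rev[OF a, of s] by (intro image_eqI[where x = "1 - s"]) auto
      qed
      then have "z \<in> ?A" if "b \<in> \<Union>F" using that arc_F_singleton[OF F] by (simp only:)
      then show ?thesis using 2 arc(1,3) by (cases "b \<in> \<Union>F") (simp_all only: simp_thms, metis)
    qed
  qed
  have piv: "\<pi> z = Vertex (fv v)" if "z = Vertex v" for z v using that by simp
  have pii: "\<pi> (arc_point G b s) = arc_point G' (fa b) s \<and> (\<forall>v. \<pi> (arc_point G b s) \<noteq> Vertex v)"
    if "b \<in> ug_arcs G" "b \<notin> \<Union>F" "s \<in> {0<..<1}" for b s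
    using map_arc_point[OF that(1,2), of s] that(3) by (simp add: arc_point_def)
  have arcs: "arc_point G b s = arc_point G c t"
    if "b \<in> ug_arcs G" "b \<notin> \<Union>F" "s \<in> {0<..<1}" "c \<in> ug_arcs G" "c \<notin> \<Union>F" "t \<in> {0<..<1}"
      and "arc_point G' (fa b) s = arc_point G' (fa c) t" for b c s t
  proof -
    have "fa c = fa b \<and> t = s \<or> fa c = ug_rev G' (fa b) \<and> t = 1 - s"
      using that G'.arc_point_eq_iff[OF fa_in_arcs[OF that(1,2)] fa_in_arcs[OF that(4,5)], of s t] by simp
    moreover have "ug_rev G b \<in> ug_arcs G" "ug_rev G b \<notin> \<Union>F"
      using that(1,2) G.arev_in_arcs by (simp_all only: rev_mem_Union_F not_False_eq_True)
    ultimately have "c = b \<and> t = s \<or> c = ug_rev G b \<and> t = 1 - s"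
      using that(1,2,4,5) rev_fa fa_eq_iff by metis
    then show ?thesis using G.arc_point_rev[OF that(1)] by auto
  qed
  have uA: "?u \<in> ug_verts G" using a by simp
  from cases[OF x] cases[OF y] show ?thesis
  proof (elim disjE)
    assume "x \<in> ?A" "y \<in> ?A" then show ?thesis by blast
  next
    assume "x \<in> ?A" "?V y"
    then show ?thesis using pA eq fv[OF uA] by fastforce
  next
    assume "?V x" "y \<in> ?A"
    then show ?thesis using pA eq fv[OF _ uA] by fastforce
  next
    assume "?V x" "?V y"
    then show ?thesis using eq fv by auto
  next
    assume "x \<in> ?A" "?B y"
    then show ?thesis using pA pii eq by metis
  next
    assume "y \<in> ?A" "?B x"
    then show ?thesis using pA pii eq by metis
  next
    assume "?V x" "?B y"
    then show ?thesis using piv pii eq by metis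
  next
    assume "?V y" "?B x"
    then show ?thesis using piv pii eq by metis
  next
    assume "?B x" "?B y"
    then show ?thesis using arcs pii eq by metis
  qed
qed

text \<open>At time 1 the slide is constant on the edge of \<open>a\<close>, so it factors through
  \<open>\<pi>\<close>, which gives the inverse \<open>k\<close>; the slide itself joins the
  identity to \<open>k \<circ> \<pi>\<close>. At all times it keeps this edge inside itself, so its
  composite with \<open>\<pi>\<close> descends to a homotopy of \<open>G'\<close> from the identity
  to \<open>\<pi> \<circ> k\<close>.\<close>

lemma single_edge_homotopy_equivalence:
  assumes F: "F = {ug_edge G a}" and a: "a \<in> ug_arcs G"
    and cover: "ug_verts G \<subseteq> ug_tail G ` ug_arcs G"
  shows "homotopy_equivalence_map (realization G) (realization G') \<pi>"
proof -
  let ?X = "realization G" and ?Y = "realization G'" and ?I = "top_of_set {0..1::real}"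
  let ?H = "\<lambda>(t, x). slide_map G a t x"
  \<comment> \<open>A loop is a cycle, so an edge of a forest has distinct ends.\<close>
  have ends: "ug_tail G a \<noteq> ug_head G a"
    using acyclic_F G.acyclic_edges_insert_iff[of "{}" a] a by (auto simp: F edge_rel_def)
  note slide = G.slide_map_arc_point[OF a ends]
  have contH: "continuous_map (prod_topology ?I ?X) ?X ?H"
  proof (rule continuous_map_times_realization[OF cover])
    fix b assume b: "b \<in> ug_arcs G"
    show "continuous_map (prod_topology ?I ?I) ?X (\<lambda>(t, s). ?H (t, arc_point G b s))"
      by (rule continuous_map_eq[OF G.continuous_map_slide[OF a b]]) (auto simp: slide[OF b])
  qed
  have H0: "slide_map G a 0 x = x" if "x \<in> gpoints G" for x
    using that
  proof (cases rule: gpoints_cases)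
    case (arc b s)
    then show ?thesis
      using slide[OF arc(1,2), of 0] G.arc_point_rev[OF a]
      by (auto simp: slide_def arc_ext_def) (auto simp: arc_point_def)
  qed (auto simp: arc_point_def)
  have HA: "slide_map G a t (arc_point G a s) = arc_point G a ((1 - t) * s)" if "t \<in> {0..1}" "s \<in> {0..1}" for t s
    using slide[OF a that(2,1)] by (simp add: slide_def)
  have aF: "a \<in> \<Union>F" using arc_F_singleton[OF F] by blast
  have q: "quotient_map ?X ?Y \<pi>" by (rule quotient_map_realization_map)
  have contf: "continuous_map ?X ?X (slide_map G a 1)"
    using continuous_map_compose[OF _ contH, of ?X "\<lambda>x. (1, x)"]
    by (simp add: comp_def continuous_map_pairedI)
  have respf: "slide_map G a 1 x = slide_map G a 1 y"
    if "x \<in> topspace ?X" "y \<in> topspace ?X" "\<pi> x = \<pi> y" for x y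
  proof -
    have "x = y \<or> x \<in> arc_point G a ` {0..1} \<and> y \<in> arc_point G a ` {0..1}"
      using collapse_eq_cases[OF F a, of x y] that by simp
    then show ?thesis using HA[of 1] by auto
  qed
  obtain k where k: "continuous_map ?Y ?X k" "\<And>x. x \<in> topspace ?X \<Longrightarrow> k (\<pi> x) = slide_map G a 1 x"
    using quotient_map_lift[OF q contf] respf by blast
  have "homotopic_with (\<lambda>_. True) ?X ?X id (k \<circ> \<pi>)"
    by (rule homotopic_with_trueI[OF contH]) (simp_all add: H0 k(2))
  note kp = homotopic_with_symD[OF this]
  \<comment> \<open>The second homotopy lives on the interval times \<open>G'\<close>, so
    \<open>\<pi>\<close> has to stay a quotient map after multiplication with the interval.\<close>
  have "locally_compact_space ?I"
    by (simp add: compact_imp_locally_compact_space compact_space_subtopology)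
  then have Q: "quotient_map (prod_topology ?I ?X) (prod_topology ?I ?Y) (\<lambda>(t, x). (t, \<pi> x))"
    by (intro quotient_map_prod_right q) (simp_all add: Hausdorff_space_subtopology)
  have contpH: "continuous_map (prod_topology ?I ?X) ?Y (\<lambda>(t, x). \<pi> (slide_map G a t x))"
    using continuous_map_compose[OF contH continuous_map_realization_map] by (simp add: comp_def case_prod_unfold)
  have resp: "(\<lambda>(t, x). \<pi> (slide_map G a t x)) p = (\<lambda>(t, x). \<pi> (slide_map G a t x)) p'"
    if pp: "p \<in> topspace (prod_topology ?I ?X)" "p' \<in> topspace (prod_topology ?I ?X)"
      "(\<lambda>(t, x). (t, \<pi> x)) p = (\<lambda>(t, x). (t, \<pi> x)) p'" for p p'
  proof -
    obtain t x y where p: "p = (t, x)" "p' = (t, y)" "t \<in> {0..1}" "x \<in> gpoints G" "y \<in> gpoints G" "\<pi> x = \<pi> y"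
      using pp by (cases p; cases p') auto
    have "x = y \<or> x \<in> arc_point G a ` {0..1} \<and> y \<in> arc_point G a ` {0..1}"
      by (rule collapse_eq_cases[OF F a p(4-6)])
    then show ?thesis
      using HA[OF p(3)] p(1,2) map_arc_point_contracted[OF a aF] by auto
  qed
  obtain K where K: "continuous_map (prod_topology ?I ?Y) ?Y K"
      "\<And>p. p \<in> topspace (prod_topology ?I ?X) \<Longrightarrow>
         K ((\<lambda>(t, x). (t, \<pi> x)) p) = (\<lambda>(t, x). \<pi> (slide_map G a t x)) p"
    using quotient_map_lift[OF Q contpH resp] by blast
  have K': "K (t, \<pi> x) = \<pi> (slide_map G a t x)" if "t \<in> {0..1}" "x \<in> gpoints G" for t x
    using K(2)[of "(t, x)"] that by simp
  have pk': "homotopic_with (\<lambda>_. True) ?Y ?Y id (\<pi> \<circ> k)"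
  proof (rule homotopic_with_trueI[OF K(1)])
    fix y assume "y \<in> topspace ?Y"
    then have "y \<in> \<pi> ` gpoints G" by (simp only: map_image_gpoints topspace_realization)
    then obtain x where x: "y = \<pi> x" "x \<in> gpoints G" by (rule imageE)
    show "K (0, y) = id y"
      using K'[of 0 x] x H0 by simp
  next
    fix y assume "y \<in> topspace ?Y"
    then have "y \<in> \<pi> ` gpoints G" by (simp only: map_image_gpoints topspace_realization)
    then obtain x where x: "y = \<pi> x" "x \<in> gpoints G" by (rule imageE)
    show "K (1, y) = (\<pi> \<circ> k) y" using K'[of 1 x] x k(2) by simp
  qed
  have pk: "homotopic_with (\<lambda>_. True) ?Y ?Y (\<pi> \<circ> k) id"
    by (rule homotopic_with_symD) (rule pk')
  show ?thesis
    unfolding homotopy_equivalence_map_def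
  proof (rule exI[of _ k], intro conjI)
    show "continuous_map ?X ?Y \<pi>" by (rule continuous_map_realization_map)
    show "continuous_map ?Y ?X k" by (rule k(1))
    show "homotopic_with (\<lambda>_. True) ?X ?X (k \<circ> \<pi>) id" by (rule kp)
    show "homotopic_with (\<lambda>_. True) ?Y ?Y (\<pi> \<circ> k) id" by (rule pk)
  qed
qed

end

lemma stable_graph_tail_cover:
  assumes "stable_graph G" shows "ug_verts G \<subseteq> ug_tail G ` ug_arcs G"
proof
  fix v assume "v \<in> ug_verts G"
  then have "0 < card (out_arcs (ug_dig G) v)"
    using assms by (auto simp: stable_graph_def out_degree_def)
  then have "out_arcs (ug_dig G) v \<noteq> {}" by (metis card.empty less_irrefl)
  then show "v \<in> ug_tail G ` ug_arcs G" by auto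
qed

lemma (in bidirected_ugraph) forest_contraction_id: "forest_contraction G G {} (\<lambda>v. v) (\<lambda>a. a)"
  unfolding graph_iso_iff_forest_contraction[OF bidirected_ugraph_axioms, symmetric]
  by (auto simp: graph_iso_def bij_betw_def inj_on_def)

lemma realization_map_id:
  assumes "bidirected_ugraph G" "ugraph_contraction G G {} fv fa" "x \<in> gpoints G"
    and "\<And>v. v \<in> ug_verts G \<Longrightarrow> fv v = v" "\<And>a. a \<in> ug_arcs G \<Longrightarrow> fa a = a"
  shows "realization_map G {} fv fa x = x"
  using assms(3)
proof (cases rule: gpoints_cases)
  case (arc a t)
  then show ?thesis
    using ugraph_contraction.map_arc_point[OF assms(2) arc(1), of t] assms(5) by simp
qed (simp add: assms(4))

text \<open>The inverse is obtained by factoring the identity contraction of \<open>G\<close>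
  through the given isomorphism.\<close>

lemma ugraph_contraction_inverse:
  assumes c: "finite_ugraph_contraction G G' {} fv fa"
  obtains gv ga where "finite_ugraph_contraction G' G {} gv ga"
    "\<And>v. v \<in> ug_verts G \<Longrightarrow> gv (fv v) = v" "\<And>a. a \<in> ug_arcs G \<Longrightarrow> ga (fa a) = a"
    "\<And>x. x \<in> gpoints G \<Longrightarrow> realization_map G' {} gv ga (realization_map G {} fv fa x) = x"
proof -
  interpret A: finite_ugraph_contraction G G' "{}" fv fa by fact
  have inj: "inj_on fv (ug_verts G)" by (rule inj_onI) (simp add: A.fv_eq_iff edge_rel_def)
  let ?gv = "inv_into (ug_verts G) fv" and ?ga = "inv_into (ug_arcs G) fa"
  have gv: "\<And>v. v \<in> ug_verts G \<Longrightarrow> ?gv (fv v) = v" using inj by simp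
  have ga: "\<And>a. a \<in> ug_arcs G \<Longrightarrow> ?ga (fa a) = a"
    using A.bij_betw_fa by (simp add: bij_betw_def)
  have I: "ugraph_contraction G G {} (\<lambda>v. v) (\<lambda>a. a)"
    by (intro ugraph_contractionI A.G.forest_contraction_id A.G.bidirected_ugraph_axioms)
  have B: "ugraph_contraction G' G {} ?gv ?ga"
    by (intro ugraph_contractionI A.G.bidirected_ugraph_axioms A.G'.bidirected_ugraph_axioms)
       (use forest_contraction_factor[OF c I, of ?gv ?ga] gv ga in simp)
  show ?thesis
  proof (rule that[of ?gv ?ga])
    show "finite_ugraph_contraction G' G {} ?gv ?ga"
      using B A.finite_verts' A.finite_arcs'
      by (simp add: finite_ugraph_contraction_def finite_ugraph_contraction_axioms_def)
    fix x assume x: "x \<in> gpoints G"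
    have "realization_map G' {} ?gv ?ga (realization_map G {} fv fa x) = realization_map G {} (\<lambda>v. v) (\<lambda>a. a) x"
      by (rule realization_map_comp[OF A.ugraph_contraction_axioms B I _ _ _ x]) (simp_all add: gv ga)
    also have "\<dots> = x" by (rule realization_map_id[OF A.G.bidirected_ugraph_axioms I x]) simp_all
    finally show "realization_map G' {} ?gv ?ga (realization_map G {} fv fa x) = x" .
  qed (use gv ga in auto)
qed

lemma iso_homotopy_equivalence:
  assumes c: "finite_ugraph_contraction G G' {} fv fa"
  shows "homotopy_equivalence_map (realization G) (realization G') (realization_map G {} fv fa)"
proof -
  interpret A: finite_ugraph_contraction G G' "{}" fv fa by fact
  from c obtain gv ga where g: "finite_ugraph_contraction G' G {} gv ga"
    "\<And>x. x \<in> gpoints G \<Longrightarrow> realization_map G' {} gv ga (A.\<pi> x) = x"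
    by (rule ugraph_contraction_inverse) blast
  interpret B: finite_ugraph_contraction G' G "{}" gv ga by fact
  have gp: "A.\<pi> (B.\<pi> y) = y" if y: "y \<in> gpoints G'" for y
  proof -
    have "y \<in> A.\<pi> ` gpoints G" using y by (simp only: A.map_image_gpoints)
    then obtain x where "y = A.\<pi> x" "x \<in> gpoints G" by (rule imageE)
    then show ?thesis using g(2) by simp
  qed
  show ?thesis
    unfolding homotopy_equivalence_map_def
  proof (rule exI[of _ B.\<pi>], intro conjI)
    show "continuous_map (realization G) (realization G') A.\<pi>" by (rule A.continuous_map_realization_map)
    show "continuous_map (realization G') (realization G) B.\<pi>" by (rule B.continuous_map_realization_map)
    show "homotopic_with (\<lambda>_. True) (realization G) (realization G) (B.\<pi> \<circ> A.\<pi>) id"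
      by (rule homotopic_with_equal)
         (auto intro: continuous_map_compose[OF A.continuous_map_realization_map B.continuous_map_realization_map] simp: g(2))
    show "homotopic_with (\<lambda>_. True) (realization G') (realization G') (A.\<pi> \<circ> B.\<pi>) id"
      by (rule homotopic_with_equal)
         (auto intro: continuous_map_compose[OF B.continuous_map_realization_map A.continuous_map_realization_map] simp: gp)
  qed
qed

section \<open>Stability of contracted graphs\<close>

context finite_ugraph_contraction
begin

lemma out_degree_ge:
  assumes v: "v \<in> ug_verts G" and S: "S \<subseteq> ug_arcs G - \<Union>F" "\<And>b. b \<in> S \<Longrightarrow> fv (ug_tail G b) = fv v"
  shows "card S \<le> out_degree (ug_dig G') (fv v)"
proof -
  have "inj_on fa S" using bij_betw_imp_inj_on[OF bij_betw_fa] S(1) by (rule inj_on_subset)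
  then have "card S = card (fa ` S)" by (simp add: card_image)
  also have "\<dots> \<le> card (out_arcs (ug_dig G') (fv v))"
  proof (rule card_mono)
    show "finite (out_arcs (ug_dig G') (fv v))" using finite_arcs' by (simp add: out_arcs_def)
    show "fa ` S \<subseteq> out_arcs (ug_dig G') (fv v)"
    proof
      fix c assume "c \<in> fa ` S"
      then obtain b where b: "b \<in> S" "c = fa b" by blast
      have b': "b \<in> ug_arcs G" "b \<notin> \<Union>F" using subsetD[OF S(1) b(1)] by (simp_all only: Diff_iff not_False_eq_True)
      show "c \<in> out_arcs (ug_dig G') (fv v)"
        using fa_in_arcs[OF b'] tail_fa[OF b'] S(2)[OF b(1)] b(2) by simp
    qed
  qed
  finally show ?thesis by (simp add: out_degree_def)
qed

lemma stable_graph_iso: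
  assumes "F = {}" "stable_graph G" shows "stable_graph G'"
  unfolding stable_graph_def
proof
  fix v' assume "v' \<in> ug_verts G'"
  then obtain v where v: "v \<in> ug_verts G" "v' = fv v" using fv_image by (metis imageE)
  have "3 \<le> card (out_arcs (ug_dig G) v)" using assms(2) v(1) by (auto simp: stable_graph_def out_degree_def)
  also have "\<dots> \<le> out_degree (ug_dig G') (fv v)"
    by (rule out_degree_ge[OF v(1)]) (auto simp: assms(1))
  finally show "3 \<le> out_degree (ug_dig G') v'" by (simp add: v(2))
qed

text \<open>Ends of valence m and n merge into a vertex of valence m + n - 2, which is at least 4:
  the arcs leaving either end survive, except \<open>a\<close> and its reverse.\<close>

lemma stable_graph_single_edge:
  assumes F: "F = {ug_edge G a}" and a: "a \<in> ug_arcs G" and st: "stable_graph G"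
  shows "stable_graph G'"
  unfolding stable_graph_def
proof
  let ?u = "ug_tail G a" and ?w = "ug_head G a" and ?out = "out_arcs (ug_dig G)"
  have UF: "\<Union>F = {a, ug_rev G a}" by (simp add: F ug_edge_def)
  have ends: "?u \<noteq> ?w"
    using acyclic_F G.acyclic_edges_insert_iff[of "{}" a] a by (auto simp: F edge_rel_def)
  have fin: "finite (?out v)" for v using finite_arcs by (simp add: out_arcs_def)
  have deg: "3 \<le> card (?out v)" if "v \<in> ug_verts G" for v
    using st that by (auto simp: stable_graph_def out_degree_def)
  have uw: "fv ?w = fv ?u" using fv_tail_eq_head[of a] UF by simp
  fix v' assume "v' \<in> ug_verts G'"
  then obtain v where v: "v \<in> ug_verts G" "v' = fv v" using fv_image by (metis imageE)
  show "3 \<le> out_degree (ug_dig G') v'"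
  proof (cases "v \<in> {?u, ?w}")
    case True
    have "card (?out ?u - {a}) \<ge> 2" "card (?out ?w - {ug_rev G a}) \<ge> 2"
      using deg[of ?u] deg[of ?w] a fin by (auto simp: card_Diff_singleton)
    moreover have "card ((?out ?u - {a}) \<union> (?out ?w - {ug_rev G a})) =
        card (?out ?u - {a}) + card (?out ?w - {ug_rev G a})"
      using fin ends by (intro card_Un_disjoint) auto
    moreover have "card ((?out ?u - {a}) \<union> (?out ?w - {ug_rev G a})) \<le> out_degree (ug_dig G') (fv v)"
      using True uw ends a by (intro out_degree_ge[OF v(1)]) (auto simp: UF)
    ultimately show ?thesis using v(2) by simp
  next
    case False
    have "card (?out v) \<le> out_degree (ug_dig G') (fv v)"
      using False a by (intro out_degree_ge[OF v(1)]) (auto simp: UF)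
    with deg[OF v(1)] show ?thesis using v(2) by simp
  qed
qed

end

text \<open>One edge is contracted at a time, because the slide handles a single edge. Stability is
  carried through the induction since at each stage it makes every vertex the tail of an arc, as the
  slide requires.\<close>

theorem contraction_stable_and_homotopy_equivalence:
  fixes G :: "('v, 'a) ugraph" and G' :: "('w, 'b) ugraph"
  assumes "finite_connected_graph G" "stable_graph G" "bidirected_ugraph G'" "forest_contraction G G' F fv fa"
  shows "stable_graph G' \<and>
    homotopy_equivalence_map (realization G) (realization G') (realization_map G F fv fa)"
  using assms
proof (induction "card F" arbitrary: G F fv)
  case 0
  note C = finite_ugraph_contractionI[OF 0(2,4,5)]
  interpret finite_ugraph_contraction G G' F fv fa by (rule C)
  have "F = {}" using 0(1) finite_subset[OF F_subset finite_edges] by simp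
  then show ?case using C 0(3) stable_graph_iso iso_homotopy_equivalence by blast
next
  case (Suc n)
  note C = finite_ugraph_contractionI[OF Suc(3,5,6)]
  interpret C: finite_ugraph_contraction G G' F fv fa by (rule C)
  have finF: "finite F" using finite_subset[OF C.F_subset C.finite_edges] .
  obtain e where e: "e \<in> F" using Suc(2) by (metis card.empty ex_in_conv nat.simps(3))
  then obtain a where a: "a \<in> ug_arcs G" "e = ug_edge G a" using C.F_subset by (auto simp: ug_edges_def)
  have e': "{e} \<subseteq> ug_edges G" "acyclic_edges G {e}" "{e} \<subseteq> F"
    using e C.F_subset C.G.acyclic_edges_mono[OF C.acyclic_F] by auto
  \<comment> \<open>The intermediate graph has the same types as \<open>G\<close> and keeps the
    names of arcs, so the induction hypothesis applies to it with the same
    \<open>fa\<close>.\<close>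
  obtain \<rho> and G1 :: "('v, 'a) ugraph" where G1: "bidirected_ugraph G1" "forest_contraction G G1 {e} \<rho> (\<lambda>a. a)"
    using C.G.contraction_exists[OF e'(1,2)] by metis
  note A = finite_ugraph_contractionI[OF Suc(3) G1]
  interpret A: finite_ugraph_contraction G G1 "{e}" \<rho> "\<lambda>a. a" by (rule A)
  define fv1 where "fv1 x = fv (inv_into (ug_verts G) \<rho> x)" for x
  have fv1: "fv1 (\<rho> v) = fv v" if "v \<in> ug_verts G" for v
    unfolding fv1_def by (rule fv_factor[OF A.ugraph_contraction_axioms C.ugraph_contraction_axioms e'(3) that])
  have B0: "forest_contraction G1 G' (F - {e}) fv1 fa"
    using forest_contraction_factor[OF A C.ugraph_contraction_axioms e'(3), of fv1 fa] fv1 by simp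
  have B: "ugraph_contraction G1 G' (F - {e}) fv1 fa"
    by (rule ugraph_contractionI[OF G1(1) C.G'.bidirected_ugraph_axioms B0])
  have "n = card (F - {e})" using Suc(2) e finF by simp
  moreover have "stable_graph G1" using A.stable_graph_single_edge a Suc(4) by blast
  ultimately have IH: "stable_graph G' \<and>
      homotopy_equivalence_map (realization G1) (realization G') (realization_map G1 (F - {e}) fv1 fa)"
    using Suc(1)[OF _ A.finite_connected_graph_contraction[OF Suc(3)] _ Suc(5) B0] by blast
  have "homotopy_equivalence_map (realization G) (realization G1) A.\<pi>"
    using A.single_edge_homotopy_equivalence[OF _ a(1) stable_graph_tail_cover[OF Suc(4)]] a(2) by simp
  from homotopy_equivalence_map_compose[OF this conjunct2[OF IH]]
  have "homotopy_equivalence_map (realization G) (realization G') (realization_map G F fv fa)"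
  proof (rule homotopy_equivalence_map_eq)
    fix x assume x: "x \<in> topspace (realization G)"
    have mem: "b \<in> \<Union>F \<longleftrightarrow> b \<in> \<Union>{e} \<or> b \<in> \<Union>(F - {e})" for b using e by blast
    show "realization_map G F fv fa x = (realization_map G1 (F - {e}) fv1 fa \<circ> A.\<pi>) x"
      using realization_map_comp[OF A.ugraph_contraction_axioms B C.ugraph_contraction_axioms mem _ _ x[simplified]] fv1
      by (simp del: Union_iff)
  qed
  with IH show ?case by blast
qed

section \<open>Automorphisms homotopic to the identity\<close>

text \<open>A map to the unit circle that wraps the edge of \<open>a\<close> once around it and
  sends everything else to 1. It stands for the 1-cocycle dual to \<open>a\<close>; the parameter
  taken is the one belonging to \<open>a\<close>, not to its reverse.\<close>

fun arc_wrap :: "'a \<Rightarrow> ('v, 'a) gpoint \<Rightarrow> complex" where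
  "arc_wrap a (Vertex v) = 1"
| "arc_wrap a (Interior S) = (if a \<in> fst ` S then cis (2 * pi * (THE t. (a, t) \<in> S)) else 1)"

text \<open>Coefficient of \<open>a\<close> in the 1-chain given by \<open>b\<close>, where reversed
  arcs count negatively; it is also the winding number of \<open>arc_wrap a\<close> along
  \<open>b\<close>.\<close>

definition arc_sign :: "('v, 'a) ugraph \<Rightarrow> 'a \<Rightarrow> 'a \<Rightarrow> int" where
  "arc_sign G a b = of_bool (b = a) - of_bool (b = ug_rev G a)"

context bidirected_ugraph
begin

lemma arc_wrap_arc_point:
  assumes a: "a \<in> ug_arcs G" and b: "b \<in> ug_arcs G"
  shows "arc_wrap a (arc_point G b t) = cis (2 * pi * (of_int (arc_sign G a b) * t))"
proof -
  have ne: "ug_rev G a \<noteq> a" by (rule arev_neq[OF a])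
  have m1: "cis (2 * pi * (- 1)) = 1" using cis_2pi cis_inverse[of "2 * pi"] by simp
  consider "b = a" | "b = ug_rev G a" | "b \<noteq> a" "b \<noteq> ug_rev G a" by blast
  then show ?thesis
  proof cases
    case 1
    have "(THE s. (a, s) \<in> {(a, t), (ug_rev G a, 1 - t)}) = t" using ne by (intro the_equality) auto
    then show ?thesis using 1 ne by (simp add: arc_point_def arc_sign_def)
  next
    case 2
    have "cis (2 * pi * (1 - t)) = cis (2 * pi) * cis (- (2 * pi * t))"
      unfolding cis_mult by (simp add: algebra_simps)
    then have "cis (2 * pi * (1 - t)) = cis (- (2 * pi * t))" by simp
    moreover have "(THE s. (a, s) \<in> {(ug_rev G a, t), (a, 1 - t)}) = 1 - t"
      using ne by (intro the_equality) auto
    ultimately show ?thesis using 2 ne m1 by (simp add: arc_point_def arc_sign_def)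
  next
    case 3
    then have "a \<noteq> ug_rev G b" by auto
    with 3 show ?thesis by (simp add: arc_point_def arc_sign_def)
  qed
qed

lemma continuous_map_arc_wrap:
  assumes a: "a \<in> ug_arcs G"
  shows "continuous_map (realization G) (top_of_set (- {0})) (arc_wrap a)"
proof (rule continuous_map_from_realization)
  have "arc_wrap a x \<noteq> 0" for x :: "('v, 'a) gpoint" by (cases x) simp_all
  then show "arc_wrap a \<in> gpoints G \<rightarrow> topspace (top_of_set (- {0}))" by auto
  show "continuous_map (top_of_set {0..1}) (top_of_set (- {0})) (\<lambda>t. arc_wrap a (arc_point G b t))"
    if b: "b \<in> ug_arcs G" for b
    unfolding arc_wrap_arc_point[OF a b] by (auto intro!: continuous_intros)
qed

text \<open>Up to sign, this is the coefficient of \<open>v\<close> in the boundary of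
  \<open>b\<close>; for a loop the two terms cancel.\<close>

lemma sum_out_arc_sign:
  assumes "finite (ug_arcs G)" "b \<in> ug_arcs G"
  shows "(\<Sum>a \<in> out_arcs (ug_dig G) v. arc_sign G a b) =
    of_bool (v = ug_tail G b) - of_bool (v = ug_head G b)"
proof -
  have fin: "finite (out_arcs (ug_dig G) v)" using assms(1) by (simp add: out_arcs_def)
  have "(\<Sum>a \<in> out_arcs (ug_dig G) v. of_bool (b = a) :: int) = of_bool (v = ug_tail G b)"
    using fin assms(2) by (auto simp: of_bool_def sum.delta)
  moreover have "(\<Sum>a \<in> out_arcs (ug_dig G) v. of_bool (b = ug_rev G a) :: int) =
      (\<Sum>a \<in> out_arcs (ug_dig G) v. of_bool (ug_rev G b = a))"
    by (rule sum.cong) (auto simp: of_bool_def)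
  moreover have "\<dots> = of_bool (v = ug_head G b)"
    using fin assms(2) by (auto simp: of_bool_def sum.delta)
  ultimately show ?thesis by (simp add: arc_sign_def sum_subtractf)
qed

definition walk_sign :: "'a \<Rightarrow> 'a list \<Rightarrow> int" where
  "walk_sign a p = (\<Sum>b\<leftarrow>p. arc_sign G a b)"

text \<open>The boundary telescopes along a walk and leaves its two ends.\<close>

lemma sum_out_walk_sign:
  assumes "finite (ug_arcs G)" "awalk u p w"
  shows "(\<Sum>a \<in> out_arcs (ug_dig G) v. walk_sign a p) = of_bool (v = u) - of_bool (v = w)"
  using assms(2)
proof (induction p arbitrary: u)
  case Nil
  then show ?case by (auto simp: walk_sign_def awalk_Nil_iff)
next
  case (Cons b p)
  then have b: "b \<in> ug_arcs G" "u = ug_tail G b" "awalk (ug_head G b) p w"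
    by (auto simp: awalk_Cons_iff)
  have "(\<Sum>a \<in> out_arcs (ug_dig G) v. walk_sign a (b # p)) =
      (\<Sum>a \<in> out_arcs (ug_dig G) v. arc_sign G a b) + (\<Sum>a \<in> out_arcs (ug_dig G) v. walk_sign a p)"
    by (simp add: walk_sign_def sum.distrib)
  then show ?case using Cons.IH[OF b(3)] sum_out_arc_sign[OF assms(1) b(1)] b(2) by simp
qed

lemma walk_sign_rev:
  "walk_sign (ug_rev G a) p = - walk_sign a p"
  unfolding walk_sign_def arc_sign_def by (induction p) auto

lemma sum_arcs_by_tail:
  assumes "finite (ug_verts G)" "finite (ug_arcs G)"
  shows "(\<Sum>c \<in> ug_arcs G. f c) = (\<Sum>v \<in> ug_verts G. \<Sum>c \<in> out_arcs (ug_dig G) v. f c)"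
proof -
  have "(\<Sum>v \<in> ug_verts G. \<Sum>c \<in> {c \<in> ug_arcs G. ug_tail G c = v}. f c) = (\<Sum>c \<in> ug_arcs G. f c)"
    using assms by (intro sum.group) auto
  then show ?thesis by (simp add: out_arcs_def)
qed

text \<open>
  A Lefschetz count: \<open>D\<close> plays the role of a chain homotopy between \<open>fa\<close> and the identity, and
  comparing traces on edges and vertices bounds the sum of valence minus 2 over all vertices by the
  same sum over the fixed subgraph. Valence at least 3 then forces everything to be fixed.
\<close>

lemma chain_homotopic_automorphism_fixes_arcs:
  fixes D :: "'a \<Rightarrow> 'v \<Rightarrow> 'r::ring_char_0"
  assumes fin: "finite (ug_verts G)" "finite (ug_arcs G)"
    and conn: "Digraph_Component.connected (ug_dig G)" and stable: "stable_graph G"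
    and fv: "fv \<in> ug_verts G \<rightarrow> ug_verts G" and fa: "fa \<in> ug_arcs G \<rightarrow> ug_arcs G"
    and tail_fa: "\<And>c. c \<in> ug_arcs G \<Longrightarrow> ug_tail G (fa c) = fv (ug_tail G c)"
    and head_fa: "\<And>c. c \<in> ug_arcs G \<Longrightarrow> ug_head G (fa c) = fv (ug_head G c)"
    and D: "\<And>a c. a \<in> ug_arcs G \<Longrightarrow> c \<in> ug_arcs G \<Longrightarrow>
      of_int (arc_sign G a (fa c)) - of_int (arc_sign G a c) = D a (ug_head G c) - D a (ug_tail G c)"
    and c: "c \<in> ug_arcs G"
  shows "fa c = c"
proof -
  let ?V = "ug_verts G" and ?A = "ug_arcs G" and ?out = "out_arcs (ug_dig G)"
  \<comment> \<open>The number of moved arcs leaving \<open>v\<close>, minus 2 if \<open>v\<close>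
    itself is moved. All these numbers will turn out to vanish.\<close>
  let ?x = "\<lambda>v. (\<Sum>b \<in> ?out v. 1 - of_bool (fa b = b)) - 2 * (1 - of_bool (fv v = v) :: int)"
  have conn': "?V \<noteq> {}" "\<And>u v. u \<in> ?V \<Longrightarrow> v \<in> ?V \<Longrightarrow> (u, v) \<in> (edge_rel G (ug_edges G))\<^sup>*"
    using conn unfolding connected_iff_edge_rel by simp_all
  obtain r where r: "r \<in> ?V" using conn'(1) by blast
  have "\<exists>p. awalk r p v" if v: "v \<in> ?V" for v
    using edge_rel_apath[OF subset_refl r v conn'(2)[OF r v]] awalkI_apath by metis
  then obtain w where w: "\<And>v. v \<in> ?V \<Longrightarrow> awalk r (w v) v" by metis
  have map_walk: "awalk (fv u) (map fa p) (fv v)" if "awalk u p v" for u p v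
    using that
  proof (induction p arbitrary: u)
    case Nil
    then show ?case using fv by (auto simp: awalk_Nil_iff)
  next
    case (Cons b p)
    then show ?case using fa tail_fa head_fa by (auto simp: awalk_Cons_iff)
  qed
  \<comment> \<open>\<open>E v\<close> is the integral 1-chain "image of the walk \<open>w v\<close>
    minus \<open>w v\<close>". It differs from \<open>D\<close> by the value of \<open>D\<close> at
    the base vertex \<open>r\<close>, but it is an integer and its boundary is known.\<close>
  define E where "E v a = walk_sign a (map fa (w v)) - walk_sign a (w v)" for v a
  have "of_int (walk_sign a (map fa p) - walk_sign a p) = D a v - D a u"
    if "a \<in> ?A" "awalk u p v" for a u p v
    using that(2)
  proof (induction p arbitrary: u)
    case Nil
    then show ?case by (simp add: walk_sign_def awalk_Nil_iff)
  next
    case (Cons b p)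
    then have b: "b \<in> ?A" "u = ug_tail G b" "awalk (ug_head G b) p v"
      by (auto simp: awalk_Cons_iff)
    have "of_int (walk_sign a (map fa (b # p)) - walk_sign a (b # p)) =
        (of_int (arc_sign G a (fa b)) - of_int (arc_sign G a b) :: 'r) +
        of_int (walk_sign a (map fa p) - walk_sign a p)"
      by (simp add: walk_sign_def algebra_simps)
    then show ?case using Cons.IH[OF b(3)] D[OF that(1) b(1)] b(2) by simp
  qed
  then have DE: "of_int (E v a) = D a v - D a r" if "a \<in> ?A" "v \<in> ?V" for a v
    using that w unfolding E_def by blast
  \<comment> \<open>Integers embed into a ring of characteristic 0, so the relation for
    \<open>D\<close> becomes one between integers.\<close>
  have sign_E: "arc_sign G a (fa b) - arc_sign G a b = E (ug_head G b) a - E (ug_tail G b) a"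
    if ab: "a \<in> ?A" "b \<in> ?A" for a b
  proof -
    have "(of_int (arc_sign G a (fa b) - arc_sign G a b) :: 'r) = of_int (E (ug_head G b) a - E (ug_tail G b) a)"
      using D[OF ab] DE[OF ab(1)] ab(2) by simp
    then show ?thesis by (simp only: of_int_eq_iff)
  qed
  have E_rev: "E v (ug_rev G a) = - E v a" for v a by (simp add: E_def walk_sign_rev)
  \<comment> \<open>The image of \<open>w v\<close> runs from \<open>fv r\<close> to
    \<open>fv v\<close>, and \<open>w v\<close> itself from \<open>r\<close> to \<open>v\<close>;
    the final \<open>1\<close> is the end term of \<open>w v\<close>, evaluated at
    \<open>v\<close>.\<close>
  have div_E: "(\<Sum>a \<in> ?out v. E v a) = of_bool (v = fv r) - of_bool (v = fv v) - of_bool (v = r) + 1"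
    if v: "v \<in> ?V" for v
    using sum_out_walk_sign[OF fin(2) map_walk[OF w[OF v]], of v] sum_out_walk_sign[OF fin(2) w[OF v], of v]
    by (simp add: E_def sum_subtractf)
  \<comment> \<open>Reversing arcs swaps heads and tails and changes the sign of \<open>E\<close>,
    so the sum over heads is the negative of the sum over tails. This is the origin of the factor
    -2.\<close>
  have "(\<Sum>b \<in> ?A. E (ug_head G b) b) = (\<Sum>b \<in> ?A. E (ug_head G (ug_rev G b)) (ug_rev G b))"
    by (rule sum.reindex_bij_betw[symmetric]) (simp add: permutes_imp_bij[OF arev_permutes_arcs])
  also have "\<dots> = - (\<Sum>b \<in> ?A. E (ug_tail G b) b)"
    by (simp add: E_rev sum_negf)
  finally have "(\<Sum>b \<in> ?A. arc_sign G b (fa b) - arc_sign G b b) = - 2 * (\<Sum>b \<in> ?A. E (ug_tail G b) b)"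
    by (simp add: sign_E sum_subtractf)
  also have "(\<Sum>b \<in> ?A. E (ug_tail G b) b) = (\<Sum>v \<in> ?V. \<Sum>b \<in> ?out v. E v b)"
    unfolding sum_arcs_by_tail[OF fin] by (intro sum.cong) auto
  \<comment> \<open>Each of the two terms involving the base vertex sums to 1 over all vertices, so
    they cancel; what remains counts the moved vertices.\<close>
  also have "\<dots> = (\<Sum>v \<in> ?V. 1 - of_bool (fv v = v))"
  proof -
    have "fv r \<in> ?V" using fv r by blast
    then have "(\<Sum>v \<in> ?V. of_bool (v = fv r) :: int) = 1" "(\<Sum>v \<in> ?V. of_bool (v = r) :: int) = 1"
      using fin(1) r by (simp_all add: of_bool_def sum.delta)
    then have "(\<Sum>v \<in> ?V. of_bool (v = fv r) - of_bool (v = r) + (1 - of_bool (fv v = v)) :: int) =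
        (\<Sum>v \<in> ?V. 1 - of_bool (fv v = v))"
      unfolding sum.distrib sum_subtractf by simp
    moreover have "(\<Sum>v \<in> ?V. \<Sum>b \<in> ?out v. E v b) =
        (\<Sum>v \<in> ?V. of_bool (v = fv r) - of_bool (v = r) + (1 - of_bool (fv v = v)))"
      by (intro sum.cong) (auto simp: div_E eq_commute[of "fv _"])
    ultimately show ?thesis by simp
  qed
  finally have trace: "(\<Sum>b \<in> ?A. arc_sign G b (fa b) - arc_sign G b b) = - 2 * (\<Sum>v \<in> ?V. 1 - of_bool (fv v = v))" .
  \<comment> \<open>A fixed arc contributes 0, a reversed one -2 and any other moved arc -1, so
    reversed arcs only strengthen the bound.\<close>
  have "arc_sign G b (fa b) - arc_sign G b b \<le> of_bool (fa b = b) - 1" if "b \<in> ?A" for b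
    using arev_neq[OF that] by (simp add: arc_sign_def)
  then have "(\<Sum>b \<in> ?A. arc_sign G b (fa b) - arc_sign G b b) \<le> (\<Sum>b \<in> ?A. of_bool (fa b = b) - 1)"
    by (rule sum_mono)
  \<comment> \<open>The number of moved arcs is at most twice the number of moved vertices.\<close>
  then have "(\<Sum>v \<in> ?V. ?x v) \<le> 0"
    unfolding trace sum_subtractf[of _ _ ?V] sum_distrib_left[symmetric] sum_arcs_by_tail[OF fin, symmetric]
    by (simp add: sum_subtractf)
  \<comment> \<open>All arcs leaving a moved vertex are moved, and there are at least 3 of them, so
    \<open>?x v\<close> is at least 3 - 2 there.\<close>
  moreover have nonneg: "0 \<le> ?x v"
    and pos: "fv v \<noteq> v \<Longrightarrow> 1 \<le> ?x v"
    if v: "v \<in> ?V" for v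
  proof -
    have 3: "3 \<le> int (card (?out v))" using stable v by (auto simp: stable_graph_def out_degree_def)
    have "fa b \<noteq> b" if "b \<in> ?out v" "fv v \<noteq> v" for b using that tail_fa[of b] by auto
    then have "(\<Sum>b \<in> ?out v. 1 - of_bool (fa b = b) :: int) = int (card (?out v))" if "fv v \<noteq> v"
      using that by (simp add: sum_subtractf)
    then show "fv v \<noteq> v \<Longrightarrow> 1 \<le> ?x v"
      using 3 by simp
    then show "0 \<le> ?x v"
      by (cases "fv v = v") (auto intro: sum_nonneg)
  qed
  ultimately have "(\<Sum>v \<in> ?V. ?x v) = 0"
    by (meson antisym sum_nonneg)
  then have zero: "?x v = 0" if "v \<in> ?V" for v
    using that sum_nonneg_eq_0_iff[OF fin(1),
        of ?x] nonneg
    by blast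
  let ?v = "ug_tail G c"
  have v: "?v \<in> ?V" using c by simp
  have "fv ?v = ?v" using pos[OF v] zero[OF v] by fastforce
  then have s0: "(\<Sum>b \<in> ?out ?v. 1 - of_bool (fa b = b) :: int) = 0" using zero[OF v] by simp
  have "finite (?out ?v)" using fin(2) by (simp add: out_arcs_def)
  from sum_nonneg_eq_0_iff[OF this, of "\<lambda>b. 1 - of_bool (fa b = b) :: int"] s0
  have "\<forall>b \<in> ?out ?v. 1 - of_bool (fa b = b) = (0::int)" by simp
  then show ?thesis using c by (simp add: of_bool_def split: if_splits)
qed

end

section \<open>Winding numbers and the chain homotopy\<close>

text \<open>Two logarithms of one path differ by a continuous function whose values are integral
  multiples of \<open>2 * pi * \<i>\<close>; distinct values are at least \<open>2 * pi\<close>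
  apart, so the difference is constant.\<close>

lemma exp_lift_diff_unique:
  fixes g g' :: "real \<Rightarrow> complex"
  assumes "continuous_on {0..1} g" "continuous_on {0..1} g'"
    and eq: "\<And>t. t \<in> {0..1} \<Longrightarrow> exp (g t) = exp (g' t)"
  shows "g 1 - g 0 = g' 1 - g' 0"
proof -
  let ?f = "\<lambda>t. g t - g' t"
  have "?f constant_on {0..1}"
  proof (rule continuous_discrete_range_constant)
    show "continuous_on {0..1} ?f" using assms(1,2) by (intro continuous_intros)
    fix s :: real assume s: "s \<in> {0..1}"
    show "\<exists>e>0. \<forall>t. t \<in> {0..1} \<and> ?f t \<noteq> ?f s \<longrightarrow> e \<le> norm (?f t - ?f s)"
    proof (intro exI[of _ "2 * pi"] conjI allI impI)
      fix t assume t: "t \<in> {0..1} \<and> ?f t \<noteq> ?f s"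
      have "exp (?f t) = exp (?f s)" using eq s t by (simp add: exp_diff)
      then obtain n :: int where n: "?f t = ?f s + (of_int (2 * n) * pi) * \<i>" unfolding exp_eq by blast
      then have "norm (?f t - ?f s) = \<bar>2 * real_of_int n * pi\<bar>"
        by (simp add: norm_mult abs_mult)
      also have "\<dots> = 2 * pi * \<bar>real_of_int n\<bar>" by (simp add: abs_mult)
      moreover have "n \<noteq> 0" using n t by auto
      then have "1 \<le> \<bar>real_of_int n\<bar>" by linarith
      ultimately show "2 * pi \<le> norm (?f t - ?f s)" by simp
    qed simp
  qed simp
  then obtain k where "\<And>t. t \<in> {0..1} \<Longrightarrow> ?f t = k" unfolding constant_on_def by blast
  from this[of 0] this[of 1] show ?thesis by (simp add: algebra_simps)
qed

text \<open>Total change of a logarithm along the path, not divided by \<open>2 * pi * \<i>\<close>.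
  The path need not be closed, so this is a complex number; by \<open>exp_lift_diff_unique\<close>
  it does not depend on the logarithm.\<close>

definition winding :: "(real \<Rightarrow> complex) \<Rightarrow> complex" where
  "winding p = (SOME d. \<exists>g. continuous_on {0..1} g \<and> (\<forall>t \<in> {0..1}. p t = exp (g t)) \<and> d = g 1 - g 0)"

lemma winding_eq:
  assumes "continuous_on {0..1} g" "\<And>t. t \<in> {0..1} \<Longrightarrow> p t = exp (g t)"
  shows "winding p = g 1 - g 0"
proof -
  have "\<exists>d g. continuous_on {0..1} g \<and> (\<forall>t \<in> {0..1}. p t = exp (g t)) \<and> d = g 1 - g 0"
    using assms by blast
  from someI_ex[OF this] obtain g' where g': "continuous_on {0..1} g'"
      "\<And>t. t \<in> {0..1} \<Longrightarrow> p t = exp (g' t)" "winding p = g' 1 - g' 0"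
    unfolding winding_def[symmetric] by blast
  show ?thesis
    unfolding g'(3) by (rule exp_lift_diff_unique[OF g'(1) assms(1)]) (use assms(2) g'(2) in metis)
qed

text \<open>Along the homotopy, \<open>arc_wrap a\<close> becomes a function on the square of time
  and the parameter of \<open>c\<close>. It has a logarithm on the whole square, so the changes
  along the four sides cancel. The sides at times 0 and 1 give the signs of \<open>fa c\<close> and
  \<open>c\<close>; the other two follow the ends of \<open>c\<close> and depend on these vertices
  only, which yields \<open>D\<close>.\<close>

lemma homotopic_id_chain_homotopy:
  fixes G :: "('v, 'a) ugraph"
  assumes "ugraph_contraction G G {} fv fa"
    and hom: "homotopic_with (\<lambda>_. True) (realization G) (realization G) (realization_map G {} fv fa) id"
  obtains D where "\<And>a c. a \<in> ug_arcs G \<Longrightarrow> c \<in> ug_arcs G \<Longrightarrow>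
    of_int (arc_sign G a (fa c)) - of_int (arc_sign G a c) = (D a (ug_head G c) - D a (ug_tail G c) :: complex)"
proof -
  interpret ugraph_contraction G G "{}" fv fa by fact
  let ?I = "{0..1::real}"
  obtain K where K: "continuous_map (prod_topology (top_of_set ?I) (realization G)) (realization G) K"
    and K0: "\<And>x. K (0, x) = realization_map G {} fv fa x" and K1: "\<And>x. K (1, x) = x"
    using hom unfolding homotopic_with_def by auto
  define W where "W a v = winding (\<lambda>t. arc_wrap a (K (t, Vertex v)))" for a v
  have "of_int (arc_sign G a (fa c)) - of_int (arc_sign G a c) =
      - W a (ug_head G c) / (2 * pi * \<i>) - - W a (ug_tail G c) / (2 * pi * \<i>)"
    if a: "a \<in> ug_arcs G" and c: "c \<in> ug_arcs G" for a c
  proof -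
    define Q where "Q p = arc_wrap a (K (fst p, arc_point G c (snd p)))" for p
    have "continuous_map (prod_topology (top_of_set ?I) (top_of_set ?I)) (realization G) (\<lambda>p. arc_point G c (snd p))"
      by (rule continuous_map_compose[OF continuous_map_snd continuous_map_arc_point[OF c], unfolded comp_def])
    then have "continuous_map (prod_topology (top_of_set ?I) (top_of_set ?I))
        (prod_topology (top_of_set ?I) (realization G)) (\<lambda>p. (fst p, arc_point G c (snd p)))"
      by (intro continuous_map_pairedI continuous_map_fst)
    from continuous_map_compose[OF continuous_map_compose[OF this K] G.continuous_map_arc_wrap[OF a]]
    have "continuous_map (top_of_set (?I \<times> ?I)) (top_of_set (- {0})) Q"
      by (simp add: comp_def Q_def[abs_def])
    then have Q: "continuous_on (?I \<times> ?I) Q" "\<And>p. p \<in> ?I \<times> ?I \<Longrightarrow> Q p \<noteq> 0" by auto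
    have "contractible (?I \<times> ?I)" by (intro convex_imp_contractible convex_Times) auto
    then obtain L where L: "continuous_on (?I \<times> ?I) L" "\<And>p. p \<in> ?I \<times> ?I \<Longrightarrow> Q p = exp (L p)"
      using continuous_logarithm_on_contractible[OF Q(1)] Q(2) by metis
    have side: "winding (\<lambda>t. Q (\<gamma> t)) = L (\<gamma> 1) - L (\<gamma> 0)" if "continuous_on ?I \<gamma>" "\<gamma> ` ?I \<subseteq> ?I \<times> ?I" for \<gamma>
    proof (rule winding_eq)
      show "continuous_on ?I (\<lambda>t. L (\<gamma> t))" by (rule continuous_on_compose2[OF L(1) that])
      show "Q (\<gamma> t) = exp (L (\<gamma> t))" if "t \<in> ?I" for t
        using that \<open>\<gamma> ` ?I \<subseteq> ?I \<times> ?I\<close> by (intro L(2)) blast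
    qed
    have sides: "winding (\<lambda>s. Q (x, s)) = L (x, 1) - L (x, 0)" "winding (\<lambda>t. Q (t, x)) = L (1, x) - L (0, x)"
      if "x \<in> ?I" for x
      by (rule side; use that in \<open>force intro!: continuous_intros\<close>)+
    have arc: "winding (\<lambda>s. arc_wrap a (arc_point G b s)) = 2 * pi * \<i> * of_int (arc_sign G a b)"
      if b: "b \<in> ug_arcs G" for b
    proof -
      have "winding (\<lambda>s. arc_wrap a (arc_point G b s)) =
          \<i> * of_real (2 * pi * (of_int (arc_sign G a b) * 1)) - \<i> * of_real (2 * pi * (of_int (arc_sign G a b) * 0))"
        by (rule winding_eq) (auto simp: G.arc_wrap_arc_point[OF a b] cis_conv_exp intro!: continuous_intros)
      then show ?thesis by simp
    qed
    have W: "W a (ug_tail G c) = winding (\<lambda>t. Q (t, 0))" "W a (ug_head G c) = winding (\<lambda>t. Q (t, 1))"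
      by (simp_all add: W_def Q_def arc_point_def)
    have Q0: "(\<lambda>s. Q (0, s)) = (\<lambda>s. arc_wrap a (arc_point G (fa c) s))"
      using map_arc_point[OF c] by (simp add: Q_def K0 fun_eq_iff)
    have Q1: "(\<lambda>s. Q (1, s)) = (\<lambda>s. arc_wrap a (arc_point G c s))"
      by (simp add: Q_def K1)
    have fac: "fa c \<in> ug_arcs G" using fa_in_arcs[OF c] by simp
    have "2 * pi * \<i> * of_int (arc_sign G a (fa c)) = L (0, 1) - L (0, 0)"
      using sides(1)[of 0] Q0 arc[OF fac] by simp
    moreover have "2 * pi * \<i> * of_int (arc_sign G a c) = L (1, 1) - L (1, 0)"
      using sides(1)[of 1] Q1 arc[OF c] by simp
    moreover have "W a (ug_tail G c) = L (1, 0) - L (0, 0)" "W a (ug_head G c) = L (1, 1) - L (0, 1)"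
      using sides(2)[of 0] sides(2)[of 1] W by simp_all
    ultimately have "2 * pi * \<i> * of_int (arc_sign G a (fa c)) - 2 * pi * \<i> * of_int (arc_sign G a c) =
        W a (ug_tail G c) - W a (ug_head G c)" by simp
    then show ?thesis by (simp add: field_simps)
  qed
  then show ?thesis by (rule that[of "\<lambda>a v. - W a v / (2 * pi * \<i>)"])
qed

section \<open>Coordinate cones\<close>

abbreviation coord :: "('e \<Rightarrow>\<^sub>0 real) \<Rightarrow> 'e \<Rightarrow> real" where
  "coord \<equiv> Poly_Mapping.lookup"

abbreviation supp :: "('e \<Rightarrow>\<^sub>0 real) \<Rightarrow> 'e set" where
  "supp \<equiv> Poly_Mapping.keys"

lemma lookup_scaleR [simp]: "coord (r *\<^sub>R l) e = r *\<^sub>R coord l e"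
proof -
  have "finite {e. r *\<^sub>R coord l e \<noteq> 0}"
    by (rule finite_subset[OF _ finite_keys[of l]]) (auto simp: in_keys_iff)
  then show ?thesis by (simp add: scaleR_poly_mapping_def)
qed

lemma abs_lookup_le_norm: "\<bar>coord l e\<bar> \<le> norm (l :: 'e \<Rightarrow>\<^sub>0 real)"
proof (cases "e \<in> supp l")
  case True
  then have "\<bar>coord l e\<bar> \<le> (\<Sum>n \<in> supp l. \<bar>coord l n\<bar>)"
    by (intro member_le_sum) auto
  then show ?thesis by (simp add: norm_poly_mapping_def dist_poly_mapping_def)
qed (simp add: in_keys_iff)

lemma continuous_on_lookup: "continuous_on A (\<lambda>l :: 'e \<Rightarrow>\<^sub>0 real. coord l e)"
proof -
  have "bounded_linear (\<lambda>l :: 'e \<Rightarrow>\<^sub>0 real. coord l e)"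
    by (rule bounded_linear_intro[where K = 1]) (auto simp: lookup_add abs_lookup_le_norm)
  then show ?thesis by (rule linear_continuous_on)
qed

text \<open>An orthant with some boundary faces removed: \<open>P\<close> says which sets of
  coordinates may vanish together. For length cones \<open>P\<close> is acyclicity.\<close>

locale coordinate_cone =
  fixes E :: "'e set" and P :: "'e set \<Rightarrow> bool"
  assumes finite_E: "finite E" and P_empty: "P {}"
    and P_mono: "\<And>Z Z'. P Z \<Longrightarrow> Z' \<subseteq> Z \<Longrightarrow> P Z'"
begin

definition subspace_E :: "('e \<Rightarrow>\<^sub>0 real) set" where
  "subspace_E = {l. supp l \<subseteq> E}"

definition orthant :: "('e \<Rightarrow>\<^sub>0 real) set" where
  "orthant = {l. supp l \<subseteq> E \<and> (\<forall>e \<in> E. 0 \<le> coord l e)}"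

definition lattice_E :: "('e \<Rightarrow>\<^sub>0 real) set" where
  "lattice_E = {l. supp l \<subseteq> E \<and> (\<forall>e \<in> E. coord l e \<in> \<int>)}"

definition open_orthant :: "('e \<Rightarrow>\<^sub>0 real) set" where
  "open_orthant = {l. supp l \<subseteq> E \<and> (\<forall>e \<in> E. 0 < coord l e)}"

definition cone_E :: "('e \<Rightarrow>\<^sub>0 real) set" where
  "cone_E = {l. supp l \<subseteq> E \<and> (\<forall>e \<in> E. 0 \<le> coord l e) \<and>
     P {e \<in> E. coord l e = 0}}"

abbreviation unit_at :: "'e \<Rightarrow> 'e \<Rightarrow>\<^sub>0 real" where
  "unit_at e \<equiv> Poly_Mapping.single e 1"

lemma keys_subset_iff: "supp l \<subseteq> E \<longleftrightarrow> (\<forall>e. e \<notin> E \<longrightarrow> coord l e = 0)"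
  by (auto simp: in_keys_iff)

lemma subspace_subspace_E: "subspace subspace_E"
  by (auto simp: subspace_def subspace_E_def keys_subset_iff lookup_add)

lemma lookup_sum_units:
  assumes "A \<subseteq> E"
  shows "coord (\<Sum>e \<in> A. c e *\<^sub>R unit_at e) e' = (if e' \<in> A then c e' else 0)"
proof -
  have "finite A" using assms finite_E finite_subset by blast
  then show ?thesis
    by (auto simp: lookup_sum lookup_single when_def if_distrib[of "(*) _"] sum.delta cong: if_cong)
qed

lemma sum_units: "l \<in> subspace_E \<Longrightarrow> (\<Sum>e \<in> E. coord l e *\<^sub>R unit_at e) = l"
  by (rule poly_mapping_eqI) (auto simp: lookup_sum_units subspace_E_def keys_subset_iff)

lemma unit_in_lattice: "e \<in> E \<Longrightarrow> unit_at e \<in> lattice_E"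
  by (auto simp: lattice_E_def lookup_single when_def)

lemma inj_unit: "inj_on unit_at E"
  by (rule inj_onI) (metis lookup_single_eq lookup_single_not_eq zero_neq_one)

lemma sum_units_image: "(\<Sum>b \<in> unit_at ` E. c b *\<^sub>R b) = (\<Sum>e \<in> E. c (unit_at e) *\<^sub>R unit_at e)"
  by (simp add: sum.reindex[OF inj_unit])

lemma is_lattice_E: "is_lattice lattice_E"
  unfolding is_lattice_def
proof (intro exI[of _ "unit_at ` E"] conjI)
  show "finite (unit_at ` E)" using finite_E by simp
  show "independent (unit_at ` E)"
  proof (rule independent_if_scalars_zero)
    fix f x assume s: "(\<Sum>x \<in> unit_at ` E. f x *\<^sub>R x) = 0" and "x \<in> unit_at ` E"
    then obtain e where e: "e \<in> E" "x = unit_at e" by blast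
    have "coord (\<Sum>x \<in> unit_at ` E. f x *\<^sub>R x) e = f x"
      using e by (simp add: sum_units_image lookup_sum_units)
    then show "f x = 0" using s by simp
  qed (use finite_E in simp)
  show "lattice_E = {\<Sum>b \<in> unit_at ` E. of_int (k b) *\<^sub>R b |k. True}"
  proof (intro equalityI subsetI)
    fix l assume l: "l \<in> lattice_E"
    define k where "k b = \<lfloor>\<Sum>e \<in> E. if b = unit_at e then coord l e else 0\<rfloor>" for b
    have k: "of_int (k (unit_at e)) = coord l e" if e: "e \<in> E" for e
    proof -
      have "(\<Sum>e' \<in> E. if unit_at e = unit_at e' then coord l e' else 0) =
          (\<Sum>e' \<in> E. if e' = e then coord l e' else 0)"
        using inj_unit e by (intro sum.cong) (auto dest: inj_onD)
      then show ?thesis using e finite_E l by (simp add: k_def lattice_E_def of_int_floor)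
    qed
    have "l = (\<Sum>b \<in> unit_at ` E. of_int (k b) *\<^sub>R b)"
      using l unfolding sum_units_image
      by (subst sum_units[symmetric]) (auto simp: k subspace_E_def lattice_E_def)
    then show "l \<in> {\<Sum>b \<in> unit_at ` E. of_int (k b) *\<^sub>R b |k. True}" by blast
  next
    fix l assume "l \<in> {\<Sum>b \<in> unit_at ` E. of_int (k b) *\<^sub>R b |k. True}"
    then show "l \<in> lattice_E"
      by (auto simp: sum_units_image lattice_E_def keys_subset_iff lookup_sum_units)
  qed
qed

lemma convex_cone_orthant: "convex_cone orthant"
  unfolding convex_cone_iff by (auto simp: orthant_def keys_subset_iff lookup_add intro!: exI[of _ 0])

lemma unit_in_orthant: "e \<in> E \<Longrightarrow> unit_at e \<in> orthant"
  by (auto simp: orthant_def lookup_single when_def)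

lemma orthant_eq_hull: "orthant = convex_cone hull (unit_at ` E)"
proof
  show "convex_cone hull (unit_at ` E) \<subseteq> orthant"
    using unit_in_orthant convex_cone_orthant by (intro hull_minimal) auto
  show "orthant \<subseteq> convex_cone hull (unit_at ` E)"
  proof
    fix l assume l: "l \<in> orthant"
    have "(\<Sum>e \<in> A. coord l e *\<^sub>R unit_at e) \<in> convex_cone hull (unit_at ` E)" if "A \<subseteq> E" for A
      using finite_subset[OF that finite_E] that
    proof (induction A)
      case empty
      then show ?case by (simp add: convex_cone_hull_contains_0)
    next
      case (insert e A)
      then have "coord l e *\<^sub>R unit_at e \<in> convex_cone hull (unit_at ` E)"
        using l by (intro convex_cone_hull_mul hull_inc) (auto simp: orthant_def)
      with insert show ?case by (simp add: convex_cone_hull_add)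
    qed
    note this[OF subset_refl]
    also have "(\<Sum>e \<in> E. coord l e *\<^sub>R unit_at e) = l"
      using l by (intro sum_units) (simp add: subspace_E_def orthant_def)
    finally show "l \<in> convex_cone hull (unit_at ` E)" .
  qed
qed

definition orthant_face :: "'e set \<Rightarrow> ('e \<Rightarrow>\<^sub>0 real) set" where
  "orthant_face S = {l \<in> orthant. \<forall>e \<in> S. coord l e = 0}"

text \<open>A convex combination of nonnegative numbers with positive weights vanishes only if both
  numbers vanish.\<close>

lemma orthant_face_face_of: "S \<subseteq> E \<Longrightarrow> orthant_face S face_of orthant"
  unfolding face_of_def
proof (intro conjI ballI impI)
  assume S: "S \<subseteq> E"
  show "orthant_face S \<subseteq> orthant" by (auto simp: orthant_face_def)
  have "convex_cone (orthant_face S)"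
    using S unfolding convex_cone_iff
    by (auto simp: orthant_face_def orthant_def keys_subset_iff lookup_add intro!: exI[of _ 0])
  then show "convex (orthant_face S)" by (simp add: convex_cone_def)
  fix a b x assume ab: "a \<in> orthant" "b \<in> orthant" "x \<in> orthant_face S" "x \<in> open_segment a b"
  then obtain u where u: "0 < u" "u < 1" "x = (1 - u) *\<^sub>R a + u *\<^sub>R b" by (auto simp: in_segment)
  have "coord a e = 0 \<and> coord b e = 0" if e: "e \<in> S" for e
  proof -
    have "(1 - u) * coord a e + u * coord b e = 0"
      using ab(3) e u(3) by (auto simp: orthant_face_def lookup_add)
    moreover have "0 \<le> (1 - u) * coord a e" "0 \<le> u * coord b e"
      using ab(1,2) e S u(1,2) by (auto simp: orthant_def)
    ultimately have "(1 - u) * coord a e = 0" "u * coord b e = 0" by linarith+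
    then show ?thesis using u(1,2) by simp
  qed
  then show "a \<in> orthant_face S" "b \<in> orthant_face S" using ab(1,2) by (auto simp: orthant_face_def)
qed

text \<open>The removed faces are those on which a forbidden set of coordinates vanishes. As
  \<open>P\<close> passes to subsets, a point lies on one of them iff its full zero set is
  forbidden; they are proper because the empty set is allowed.\<close>

lemma ideal_cone_cone_E: "ideal_cone lattice_E cone_E"
  unfolding ideal_cone_def
proof (intro exI[of _ orthant] exI[of _ "orthant_face ` {S. S \<subseteq> E \<and> \<not> P S}"] conjI ballI)
  show "rational_polyhedral_cone lattice_E orthant"
    unfolding rational_polyhedral_cone_def
    by (intro exI[of _ "unit_at ` E"] conjI orthant_eq_hull finite_imageI finite_E)
       (use unit_in_lattice in blast)
  let ?N = "orthant_face ` {S. S \<subseteq> E \<and> \<not> P S}"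
  show "cone_E = orthant - \<Union>?N"
  proof (intro equalityI subsetI)
    fix l assume l: "l \<in> cone_E"
    have "l \<notin> orthant_face S" if "S \<subseteq> E" "\<not> P S" for S
    proof
      assume "l \<in> orthant_face S"
      then have "S \<subseteq> {e \<in> E. coord l e = 0}" using that by (auto simp: orthant_face_def)
      moreover have "P {e \<in> E. coord l e = 0}" using l by (simp add: cone_E_def)
      ultimately show False using that(2) P_mono by metis
    qed
    then have "l \<notin> \<Union>?N" by blast
    moreover have "l \<in> orthant" using l by (simp add: cone_E_def orthant_def)
    ultimately show "l \<in> orthant - \<Union>?N" by (rule DiffI[rotated])
  next
    fix l assume l: "l \<in> orthant - \<Union>?N"
    let ?Z = "{e \<in> E. coord l e = 0}"
    have lo: "l \<in> orthant" using l by (rule DiffD1)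
    then have "l \<in> orthant_face ?Z" by (simp add: orthant_face_def)
    moreover have "orthant_face ?Z \<in> ?N" if "\<not> P ?Z"
      using that by (intro imageI) simp
    ultimately have "P ?Z" using DiffD2[OF l] by (meson UnionI)
    then show "l \<in> cone_E" using lo by (simp add: cone_E_def orthant_def)
  qed
  fix H assume "H \<in> ?N"
  then obtain S where S: "S \<subseteq> E" "\<not> P S" "H = orthant_face S" by blast
  then show "H face_of orthant" using orthant_face_face_of by simp
  have "S \<noteq> {}" using S(2) P_empty by blast
  then obtain e where e: "e \<in> S" by blast
  then have "unit_at e \<in> orthant" "unit_at e \<notin> orthant_face S"
    using S(1) unit_in_orthant by (auto simp: orthant_face_def lookup_single when_def)
  then show "H \<noteq> orthant" using S(3) by blast
qed

lemma cone_E_subset: "cone_E \<subseteq> orthant" "orthant \<subseteq> subspace_E" "open_orthant \<subseteq> cone_E"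
proof -
  show "open_orthant \<subseteq> cone_E"
  proof
    fix l assume l: "l \<in> open_orthant"
    then have "{e \<in> E. coord l e = 0} = {}" by (auto simp: open_orthant_def)
    then have "P {e \<in> E. coord l e = 0}" using P_empty by (simp only:)
    with l show "l \<in> cone_E" by (auto simp: open_orthant_def cone_E_def less_imp_le)
  qed
qed (auto simp: cone_E_def orthant_def subspace_E_def)

definition all_ones :: "'e \<Rightarrow>\<^sub>0 real" where
  "all_ones = (\<Sum>e \<in> E. 1 *\<^sub>R unit_at e)"

lemma lookup_all_ones: "coord all_ones e = (if e \<in> E then 1 else 0)"
  unfolding all_ones_def by (rule lookup_sum_units[OF subset_refl])

lemma orthant_add_open: "l \<in> orthant \<Longrightarrow> 0 < d \<Longrightarrow> l + d *\<^sub>R all_ones \<in> open_orthant"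
  by (auto simp: orthant_def open_orthant_def keys_subset_iff lookup_add lookup_all_ones intro: add_nonneg_pos)

lemma span_lattice_E: "span lattice_E = subspace_E"
proof
  show "span lattice_E \<subseteq> subspace_E"
    by (rule span_minimal[OF _ subspace_subspace_E]) (auto simp: lattice_E_def subspace_E_def)
  show "subspace_E \<subseteq> span lattice_E"
  proof
    fix l assume l: "l \<in> subspace_E"
    have "(\<Sum>e \<in> E. coord l e *\<^sub>R unit_at e) \<in> span lattice_E"
      by (intro span_sum span_scale span_base unit_in_lattice)
    then show "l \<in> span lattice_E" using sum_units[OF l] by simp
  qed
qed

text \<open>The origin and the unit vectors may be missing from \<open>cone_E\<close>, so the unit
  vector is written as the difference of \<open>unit_at e + all_ones\<close> and
  \<open>all_ones\<close>, which both belong to it. The coefficients 1, -d and d sum to 1.\<close>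

lemma unit_in_affine_hull_cone_E:
  assumes "e \<in> E" "d \<in> {0..1}" "x \<in> cone_E"
  shows "x - d *\<^sub>R unit_at e \<in> affine hull cone_E"
proof -
  have "all_ones \<in> cone_E" "unit_at e + all_ones \<in> cone_E"
    using orthant_add_open[of 0 1] orthant_add_open[OF unit_in_orthant[OF assms(1)], of 1] cone_E_subset(3)
      convex_cone_contains_0[OF convex_cone_orthant] by auto
  then have "1 *\<^sub>R x + (- d) *\<^sub>R (unit_at e + all_ones) + d *\<^sub>R all_ones \<in> affine hull cone_E"
    using assms(3) by (intro mem_affine_3 affine_affine_hull hull_inc) auto
  then show ?thesis by (simp add: algebra_simps)
qed

lemma span_cone_E: "span cone_E = subspace_E"
proof
  show "span cone_E \<subseteq> subspace_E"
    by (rule span_minimal[OF _ subspace_subspace_E]) (use cone_E_subset in blast)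
  have "unit_at e \<in> span cone_E" if e: "e \<in> E" for e
  proof -
    have "all_ones \<in> cone_E" "unit_at e + all_ones \<in> cone_E"
      using orthant_add_open[of 0 1] orthant_add_open[OF unit_in_orthant[OF e], of 1] cone_E_subset(3)
        convex_cone_contains_0[OF convex_cone_orthant] by auto
    then have "(unit_at e + all_ones) - all_ones \<in> span cone_E" by (intro span_diff span_base)
    then show ?thesis by simp
  qed
  then have *: "(\<Sum>e \<in> E. coord l e *\<^sub>R unit_at e) \<in> span cone_E" for l :: "'e \<Rightarrow>\<^sub>0 real"
    by (intro span_sum span_scale) auto
  show "subspace_E \<subseteq> span cone_E"
  proof
    fix l assume "l \<in> subspace_E"
    then show "l \<in> span cone_E" using *[of l] by (simp only: sum_units)
  qed
qed

lemma closed_orthant: "closed orthant"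
proof -
  have "orthant = (\<Inter>e \<in> - E. {l. coord l e = 0}) \<inter> (\<Inter>e \<in> E. {l. 0 \<le> coord l e})"
    by (auto simp: orthant_def keys_subset_iff)
  moreover have "closed {l :: 'e \<Rightarrow>\<^sub>0 real. coord l e = 0}" "closed {l :: 'e \<Rightarrow>\<^sub>0 real. 0 \<le> coord l e}" for e
    by (intro closed_Collect_eq closed_Collect_le continuous_on_lookup continuous_on_const)+
  ultimately show ?thesis by (auto intro!: closed_Int closed_INT)
qed

lemma closure_cone_E: "closure cone_E = orthant"
proof
  show "closure cone_E \<subseteq> orthant" by (rule closure_minimal[OF cone_E_subset(1) closed_orthant])
  show "orthant \<subseteq> closure cone_E"
  proof
    fix l assume l: "l \<in> orthant"
    show "l \<in> closure cone_E" unfolding closure_approachable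
    proof (intro allI impI)
      fix d :: real assume d: "0 < d"
      \<comment> \<open>The 1 in the denominator covers \<open>E = {}\<close>, where
        \<open>all_ones\<close> is 0.\<close>
      let ?c = "d / (2 * (1 + norm all_ones))"
      have pos: "0 < 1 + norm all_ones" by (simp add: add_pos_nonneg)
      have "l + ?c *\<^sub>R all_ones \<in> cone_E"
        using orthant_add_open[OF l, of ?c] d pos cone_E_subset(3) by auto
      moreover have "dist (l + ?c *\<^sub>R all_ones) l < d"
      proof -
        have "dist (l + ?c *\<^sub>R all_ones) l = ?c * norm all_ones" using d pos by (simp add: dist_norm)
        also have "\<dots> \<le> ?c * (1 + norm all_ones)" using d pos by (intro mult_left_mono) auto
        also have "\<dots> = d / 2" using pos by (simp add: field_simps)
        finally show ?thesis using d by simp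
      qed
      ultimately show "\<exists>y \<in> cone_E. dist y l < d" by blast
    qed
  qed
qed

text \<open>Finitely many strict inequalities cut out an open part of the affine hull that lies in
  the cone. Conversely, where a coordinate vanishes, a small step against its unit vector stays in
  the affine hull but leaves the cone.\<close>

lemma rel_interior_cone_E: "rel_interior cone_E = open_orthant"
proof (intro equalityI subsetI)
  have aff: "affine hull cone_E \<subseteq> subspace_E"
    by (rule hull_minimal) (use cone_E_subset subspace_subspace_E subspace_imp_affine in auto)
  fix l assume l: "l \<in> open_orthant"
  let ?U = "\<Inter>e \<in> E. {l :: 'e \<Rightarrow>\<^sub>0 real. 0 < coord l e}"
  have "open {l :: 'e \<Rightarrow>\<^sub>0 real. 0 < coord l e}" for e
    by (intro open_Collect_less continuous_on_lookup continuous_on_const)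
  then have "open ?U" using finite_E by (intro open_INT) auto
  moreover have "?U \<inter> affine hull cone_E \<subseteq> cone_E"
  proof
    fix x assume "x \<in> ?U \<inter> affine hull cone_E"
    then have "x \<in> open_orthant" using aff by (auto simp: open_orthant_def subspace_E_def)
    then show "x \<in> cone_E" using cone_E_subset(3) by blast
  qed
  moreover have "l \<in> affine hull cone_E" using l cone_E_subset(3) by (blast intro: hull_inc)
  ultimately show "l \<in> rel_interior cone_E"
    unfolding rel_interior_def using l
    by (intro CollectI exI[of _ "?U \<inter> affine hull cone_E"]) (auto simp: open_orthant_def openin_open)
next
  fix l assume "l \<in> rel_interior cone_E"
  then obtain T where T: "openin (top_of_set (affine hull cone_E)) T" "l \<in> T" "T \<subseteq> cone_E"
    unfolding rel_interior_def by blast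
  have lc: "l \<in> cone_E" using T by blast
  have "0 < coord l e" if e: "e \<in> E" for e
  proof (rule ccontr)
    assume "\<not> 0 < coord l e"
    then have l0: "coord l e = 0" using lc e by (force simp: cone_E_def)
    obtain d where d: "0 < d" "\<And>y. y \<in> affine hull cone_E \<Longrightarrow> dist y l < d \<Longrightarrow> y \<in> T"
      using T(1,2) unfolding openin_euclidean_subtopology_iff by blast
    \<comment> \<open>The bound 1 keeps the step within the range of
      \<open>unit_in_affine_hull_cone_E\<close>.\<close>
    let ?c = "min 1 (d / (2 * (1 + norm (unit_at e))))" and ?n = "norm (unit_at e)"
    have n: "0 < 1 + ?n" by (simp add: add_pos_nonneg)
    have c: "0 < ?c" "?c \<le> 1" using d(1) n by simp_all
    have "?c * ?n < d"
    proof -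
      have "?c * ?n \<le> (d / (2 * (1 + ?n))) * (1 + ?n)" using d(1) n by (intro mult_mono) auto
      also have "\<dots> = d / 2" using n by (simp add: field_simps)
      finally show ?thesis using d(1) by simp
    qed
    then have "dist (l - ?c *\<^sub>R unit_at e) l < d" using c(1) by (simp add: dist_norm)
    moreover have "l - ?c *\<^sub>R unit_at e \<in> affine hull cone_E"
      using unit_in_affine_hull_cone_E[OF e _ lc] c by simp
    ultimately have "l - ?c *\<^sub>R unit_at e \<in> cone_E" using d(2) T(3) by blast
    then have "0 \<le> coord (l - ?c *\<^sub>R unit_at e) e" using e by (auto simp: cone_E_def)
    then show False using l0 c(1) by (simp add: lookup_minus)
  qed
  then show "l \<in> open_orthant" using lc by (auto simp: open_orthant_def cone_E_def)
qed

lemma ideal_face_cone_E: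
  assumes "S \<subseteq> E" shows "ideal_face {l \<in> cone_E. \<forall>e \<in> S. coord l e = 0} cone_E"
  unfolding ideal_face_def closure_cone_E
  using orthant_face_face_of[OF assms] cone_E_subset(1)
  by (intro exI[of _ "orthant_face S"]) (auto simp: orthant_face_def)

end

section \<open>Specializations of marked graphs\<close>

lemma stable_marked_graphsD:
  assumes "(G, h) \<in> stable_marked_graphs g"
  shows "finite_connected_graph G" "genus G = int g" "stable_graph G" "bidirected_ugraph G"
    "homotopy_equivalence_map (realization (rose g)) (realization G) h"
    "continuous_map (realization (rose g)) (realization G) h"
  using assms fcg_bidirected_ugraph
  by (auto simp: stable_marked_graphs_def homotopy_equivalence_map_def)

lemma marking_in_gpoints:
  "(G, h) \<in> stable_marked_graphs g \<Longrightarrow> x \<in> topspace (realization (rose g)) \<Longrightarrow> h x \<in> gpoints G"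
  using continuous_map_image_subset_topspace[OF stable_marked_graphsD(6)] by fastforce

lemma specialization_iff:
  "specialization g (G, h) (G', h') F fv fa \<longleftrightarrow> forest_contraction G G' F fv fa \<and>
     homotopic_markings g G' (realization_map G F fv fa \<circ> h) h'"
  by (simp add: specialization_def)

lemma specialization_contraction:
  assumes "specialization g (G, h) (G', h') F fv fa"
    "(G, h) \<in> stable_marked_graphs g" "(G', h') \<in> stable_marked_graphs g"
  shows "finite_ugraph_contraction G G' F fv fa" "ugraph_contraction G G' F fv fa"
proof -
  show "finite_ugraph_contraction G G' F fv fa"
    using finite_ugraph_contractionI[OF stable_marked_graphsD(1)[OF assms(2)] stable_marked_graphsD(4)[OF assms(3)]]
      assms(1) by (simp add: specialization_iff)
  then show "ugraph_contraction G G' F fv fa" by (simp add: finite_ugraph_contraction_def)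
qed

lemma contracted_marking:
  assumes m: "(G, h) \<in> stable_marked_graphs g" and "bidirected_ugraph G'" "forest_contraction G G' F fv fa"
  shows "(G', realization_map G F fv fa \<circ> h) \<in> stable_marked_graphs g"
    "specialization g (G, h) (G', realization_map G F fv fa \<circ> h) F fv fa"
proof -
  note D = stable_marked_graphsD[OF m]
  interpret finite_ugraph_contraction G G' F fv fa
    using finite_ugraph_contractionI[OF D(1) assms(2,3)] .
  have "stable_graph G'" "homotopy_equivalence_map (realization G) (realization G') \<pi>"
    using contraction_stable_and_homotopy_equivalence[OF D(1,3) assms(2,3)] by auto
  then show "(G', \<pi> \<circ> h) \<in> stable_marked_graphs g"
    using finite_connected_graph_contraction[OF D(1)] genus_contraction D(2)
      homotopy_equivalence_map_compose[OF D(5)]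
    by (simp add: stable_marked_graphs_def)
  show "specialization g (G, h) (G', \<pi> \<circ> h) F fv fa"
    using assms(3) continuous_map_compose[OF D(6) continuous_map_realization_map]
    by (simp add: specialization_iff)
qed

lemma specialization_refl:
  assumes "(G, h) \<in> stable_marked_graphs g"
  shows "specialization g (G, h) (G, h) {} (\<lambda>v. v) (\<lambda>a. a)"
proof -
  note D = stable_marked_graphsD[OF assms]
  interpret bidirected_ugraph G by (rule D(4))
  have I: "ugraph_contraction G G {} (\<lambda>v. v) (\<lambda>a. a)"
    by (rule ugraph_contractionI[OF bidirected_ugraph_axioms bidirected_ugraph_axioms forest_contraction_id])
  have "realization_map G {} (\<lambda>v. v) (\<lambda>a. a) (h x) = h x" if "x \<in> topspace (realization (rose g))" for x
    using marking_in_gpoints[OF assms that] by (rule realization_map_id[OF D(4) I]) simp_all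
  then have "homotopic_markings g G (realization_map G {} (\<lambda>v. v) (\<lambda>a. a) \<circ> h) h"
    by (intro homotopic_with_symD[OF homotopic_with_equal]) (use D(6) in auto)
  then show ?thesis using forest_contraction_id by (simp add: specialization_iff)
qed

lemma homotopic_markings_compose:
  assumes "homotopic_markings g G h h'" "continuous_map (realization G) (realization G') f"
  shows "homotopic_markings g G' (f \<circ> h) (f \<circ> h')"
  by (rule homotopic_with_compose_continuous_map_left[OF assms]) simp

lemma specialization_comp:
  assumes s: "specialization g (G, h) (G1, h1) F p q" "specialization g (G1, h1) (G2, h2) F1 p1 q1"
    and m: "(G, h) \<in> stable_marked_graphs g" "(G1, h1) \<in> stable_marked_graphs g" "(G2, h2) \<in> stable_marked_graphs g"
  shows "specialization g (G, h) (G2, h2) (F \<union> {e \<in> ug_edges G - F. q ` e \<in> F1}) (\<lambda>v. p1 (p v)) (\<lambda>a. q1 (q a))"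
proof -
  let ?F = "F \<union> {e \<in> ug_edges G - F. q ` e \<in> F1}"
  note A = specialization_contraction[OF s(1) m(1,2)] and B = specialization_contraction[OF s(2) m(2,3)]
  have fc: "forest_contraction G G2 ?F (\<lambda>v. p1 (p v)) (\<lambda>a. q1 (q a))"
    by (rule forest_contraction_comp[OF A(1) B(2)])
  have C: "ugraph_contraction G G2 ?F (\<lambda>v. p1 (p v)) (\<lambda>a. q1 (q a))"
    by (rule ugraph_contractionI[OF stable_marked_graphsD(4)[OF m(1)] stable_marked_graphsD(4)[OF m(3)] fc])
  let ?r = "realization_map G F p q" and ?r1 = "realization_map G1 F1 p1 q1"
  have "homotopic_markings g G2 (?r1 \<circ> (?r \<circ> h)) (?r1 \<circ> h1)"
    by (rule homotopic_markings_compose[OF _ ugraph_contraction.continuous_map_realization_map[OF B(2)]])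
      (use s(1) in \<open>simp add: specialization_iff\<close>)
  moreover have "homotopic_markings g G2 (?r1 \<circ> h1) h2" using s(2) by (simp add: specialization_iff)
  ultimately have "homotopic_markings g G2 (?r1 \<circ> (?r \<circ> h)) h2" by (rule homotopic_with_trans)
  then have "homotopic_markings g G2 (realization_map G ?F (\<lambda>v. p1 (p v)) (\<lambda>a. q1 (q a)) \<circ> h) h2"
  proof (rule homotopic_with_pointwise)
    fix x assume "x \<in> topspace (realization (rose g))"
    then have "h x \<in> gpoints G" by (rule marking_in_gpoints[OF m(1)])
    then show "(realization_map G ?F (\<lambda>v. p1 (p v)) (\<lambda>a. q1 (q a)) \<circ> h) x = (?r1 \<circ> (?r \<circ> h)) x"
      using realization_map_comp[OF A(2) B(2) C mem_Union_comp[OF A(2) B(2)]] by simp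
  qed simp
  with fc show ?thesis by (simp add: specialization_iff)
qed

text \<open>For the markings: \<open>h1\<close> is homotopic to the image of \<open>h\<close> in
  \<open>G1\<close>, so its image in \<open>G2\<close> is homotopic to the image of \<open>h\<close>
  there, which is homotopic to \<open>h2\<close>.\<close>

lemma specialization_factor:
  assumes s: "specialization g (G, h) (G1, h1) F0 p q" "specialization g (G, h) (G2, h2) F fv fa" "F0 \<subseteq> F"
    and m: "(G, h) \<in> stable_marked_graphs g" "(G1, h1) \<in> stable_marked_graphs g" "(G2, h2) \<in> stable_marked_graphs g"
  obtains fv1 fa1 where "specialization g (G1, h1) (G2, h2) ((\<lambda>e. q ` e) ` (F - F0)) fv1 fa1"
    "\<And>a. a \<in> ug_arcs G \<Longrightarrow> a \<notin> \<Union>F \<Longrightarrow> fa1 (q a) = fa a"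
proof -
  let ?F1 = "(\<lambda>e. q ` e) ` (F - F0)"
  note A = specialization_contraction[OF s(1) m(1,2)] and C = specialization_contraction[OF s(2) m(1,3)]
  interpret A: finite_ugraph_contraction G G1 F0 p q by (rule A(1))
  interpret C: finite_ugraph_contraction G G2 F fv fa by (rule C(1))
  define fv1 where "fv1 x = fv (inv_into (ug_verts G) p x)" for x
  \<comment> \<open>\<open>q\<close> is a bijection from the arcs outside \<open>F0\<close> to the
    arcs of \<open>G1\<close>, so this determines \<open>fa1\<close> on all arcs of
    \<open>G1\<close>.\<close>
  define fa1 where "fa1 b = fa (inv_into (ug_arcs G - \<Union>F0) q b)" for b
  have fv1: "fv1 (p v) = fv v" if "v \<in> ug_verts G" for v
    unfolding fv1_def by (rule fv_factor[OF A(2) C(2) s(3) that])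
  have fa1: "fa1 (q a) = fa a" if a: "a \<in> ug_arcs G" "a \<notin> \<Union>F" for a
  proof -
    have "a \<notin> \<Union>F0" using a(2) s(3) by blast
    then have "inv_into (ug_arcs G - \<Union>F0) q (q a) = a"
      using a(1) bij_betw_imp_inj_on[OF A.bij_betw_fa] by (intro inv_into_f_f) (simp_all only: Diff_iff simp_thms)
    then show ?thesis by (simp add: fa1_def)
  qed
  have fc: "forest_contraction G1 G2 ?F1 fv1 fa1"
    by (rule forest_contraction_factor[OF A(1) C(2) s(3) fv1 fa1])
  have B: "ugraph_contraction G1 G2 ?F1 fv1 fa1"
    by (rule ugraph_contractionI[OF stable_marked_graphsD(4)[OF m(2)] stable_marked_graphsD(4)[OF m(3)] fc])
  let ?r = "realization_map G F0 p q" and ?r1 = "realization_map G1 ?F1 fv1 fa1"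
  have "homotopic_markings g G2 (?r1 \<circ> h1) (?r1 \<circ> (?r \<circ> h))"
    by (rule homotopic_markings_compose[OF homotopic_with_symD
          ugraph_contraction.continuous_map_realization_map[OF B]])
      (use s(1) in \<open>simp add: specialization_iff\<close>)
  moreover have "homotopic_markings g G2 (?r1 \<circ> (?r \<circ> h)) h2"
  proof (rule homotopic_with_pointwise)
    show "homotopic_markings g G2 (realization_map G F fv fa \<circ> h) h2" using s(2) by (simp add: specialization_iff)
    fix x assume "x \<in> topspace (realization (rose g))"
    then have x: "h x \<in> gpoints G" by (rule marking_in_gpoints[OF m(1)])
    have mem: "a \<in> \<Union>F \<longleftrightarrow> a \<in> \<Union>F0 \<or> q a \<in> \<Union>?F1" if a: "a \<in> ug_arcs G" for a
      using mem_Union_factor[OF A(2) C.F_subset s(3) a] s(3) by (cases "a \<in> \<Union>F0") (simp_all only: simp_thms, blast)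
    show "(?r1 \<circ> (?r \<circ> h)) x = (realization_map G F fv fa \<circ> h) x"
      unfolding comp_apply by (rule realization_map_comp[OF A(2) B C(2) mem _ _ x]) (simp_all only: fv1 fa1 not_False_eq_True)
  qed simp
  ultimately have "homotopic_markings g G2 (?r1 \<circ> h1) h2" by (rule homotopic_with_trans)
  with fc fa1 show ?thesis by (intro that[of fv1 fa1]) (simp_all add: specialization_iff del: Union_iff)
qed

lemma marked_equiv_iff:
  "((G, h), (G', h')) \<in> marked_equiv g \<longleftrightarrow> (G, h) \<in> stable_marked_graphs g \<and>
     (G', h') \<in> stable_marked_graphs g \<and> (\<exists>fv fa. specialization g (G, h) (G', h') {} fv fa)"
proof (cases "(G, h) \<in> stable_marked_graphs g")
  case True
  show ?thesis
    unfolding marked_equiv_def specialization_iff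
    by (simp add: graph_iso_iff_forest_contraction[OF stable_marked_graphsD(4)[OF True]])
qed (simp add: marked_equiv_def)

lemma specialization_inverse:
  assumes s: "specialization g (G, h) (G', h') {} fv fa"
    and m: "(G, h) \<in> stable_marked_graphs g" "(G', h') \<in> stable_marked_graphs g"
  obtains gv ga where "specialization g (G', h') (G, h) {} gv ga" "\<And>a. a \<in> ug_arcs G \<Longrightarrow> ga (fa a) = a"
proof -
  show ?thesis
  proof (rule specialization_factor[OF s specialization_refl[OF m(1)] subset_refl m m(1)])
    fix gv ga
    assume "specialization g (G', h') (G, h) ((\<lambda>e. fa ` e) ` ({} - {})) gv ga"
      "\<And>a. a \<in> ug_arcs G \<Longrightarrow> a \<notin> \<Union>{} \<Longrightarrow> ga (fa a) = a"
    then show ?thesis by (intro that[of gv ga]) simp_all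
  qed
qed

lemma equiv_marked_equiv:
  "equiv (stable_marked_graphs g :: ('v, 'a) marked_graph set) (marked_equiv g)"
  (is "equiv ?M ?R")
proof (rule equivI)
  show "?R \<subseteq> ?M \<times> ?M"
    by (auto simp: marked_equiv_iff)
  show "refl_on ?M ?R"
  proof (rule refl_onI, clarify)
    show "((G, h), (G, h)) \<in> marked_equiv g" if "(G, h) \<in> stable_marked_graphs g" for G :: "('v, 'a) ugraph" and h
      unfolding marked_equiv_iff using that specialization_refl by blast
  qed
  show "sym ?R"
  proof (rule symI, clarify)
    fix G h G' h' assume "((G :: ('v, 'a) ugraph, h), (G', h')) \<in> marked_equiv g"
    then show "((G', h'), (G, h)) \<in> marked_equiv g"
      unfolding marked_equiv_iff by (blast elim: specialization_inverse)
  qed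
  show "trans ?R"
  proof (rule transI, clarify)
    fix G h G1 h1 G2 h2
    assume "((G :: ('v, 'a) ugraph, h), (G1, h1)) \<in> marked_equiv g" "((G1, h1), (G2, h2)) \<in> marked_equiv g"
    then obtain p q p1 q1 where m: "(G, h) \<in> stable_marked_graphs g" "(G1, h1) \<in> stable_marked_graphs g"
        "(G2, h2) \<in> stable_marked_graphs g"
      and s: "specialization g (G, h) (G1, h1) {} p q" "specialization g (G1, h1) (G2, h2) {} p1 q1"
      unfolding marked_equiv_iff by blast
    show "((G, h), (G2, h2)) \<in> marked_equiv g"
      using specialization_comp[OF s m] m unfolding marked_equiv_iff by auto
  qed
qed

text \<open>Let \<open>k\<close> be a homotopy inverse of the marking \<open>h\<close>. Then
  \<open>\<pi>\<close> is homotopic to \<open>\<pi> \<circ> h \<circ> k\<close>, by compatibility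
  with the marking to \<open>h \<circ> k\<close>, and hence to the identity, so the Lefschetz count
  applies.\<close>

lemma specialization_self_fixes_arcs:
  assumes m: "(G, h) \<in> stable_marked_graphs g" and s: "specialization g (G, h) (G, h) {} fv fa"
    and a: "a \<in> ug_arcs G"
  shows "fa a = a"
proof -
  note D = stable_marked_graphsD[OF m] and C = specialization_contraction[OF s m m]
  interpret finite_ugraph_contraction G G "{}" fv fa by (rule C(1))
  let ?X = "realization G" and ?R = "realization (rose g)"
  obtain k where k: "continuous_map ?X ?R k" "homotopic_with (\<lambda>_. True) ?X ?X (h \<circ> k) id"
    using D(5) by (auto simp: homotopy_equivalence_map_def)
  have "homotopic_with (\<lambda>_. True) ?X ?X (\<pi> \<circ> (h \<circ> k)) (\<pi> \<circ> id)"
    by (rule homotopic_with_compose_continuous_map_left[OF k(2) continuous_map_realization_map]) simp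
  from homotopic_with_symD[OF this]
  have "homotopic_with (\<lambda>_. True) ?X ?X \<pi> (\<pi> \<circ> h \<circ> k)" by (simp add: comp_assoc)
  moreover have "homotopic_with (\<lambda>_. True) ?X ?X (\<pi> \<circ> h \<circ> k) (h \<circ> k)"
    by (rule homotopic_with_compose_continuous_map_right[OF _ k(1)]) (use s in \<open>auto simp: specialization_iff\<close>)
  ultimately have "homotopic_with (\<lambda>_. True) ?X ?X \<pi> id"
    using k(2) homotopic_with_trans by metis
  from homotopic_id_chain_homotopy[OF C(2) this]
  obtain D where chain: "\<And>a c. a \<in> ug_arcs G \<Longrightarrow> c \<in> ug_arcs G \<Longrightarrow>
    of_int (arc_sign G a (fa c)) - of_int (arc_sign G a c) = (D a (ug_head G c) - D a (ug_tail G c) :: complex)"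
    by metis
  show ?thesis
  proof (rule G.chain_homotopic_automorphism_fixes_arcs[OF finite_verts finite_arcs _ D(3) _ _ _ _ chain a])
    show "Digraph_Component.connected (ug_dig G)" using D(1) by (simp add: finite_connected_graph_def)
    show "fv \<in> ug_verts G \<rightarrow> ug_verts G" "fa \<in> ug_arcs G \<rightarrow> ug_arcs G"
      using fv_in_verts fa_in_arcs by auto
    show "ug_tail G (fa c) = fv (ug_tail G c)" "ug_head G (fa c) = fv (ug_head G c)" if "c \<in> ug_arcs G" for c
      using tail_fa[OF that] head_fa[OF that] by simp_all
  qed
qed

section \<open>Length cones\<close>

lemma coordinate_cone_edges:
  assumes "finite_connected_graph G" shows "coordinate_cone (ug_edges G) (acyclic_edges G)"
proof -
  interpret bidirected_ugraph G by (rule fcg_bidirected_ugraph[OF assms])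
  show ?thesis
    by unfold_locales
      (use fcg_finite[OF assms] acyclic_edges_empty acyclic_edges_mono in \<open>auto simp: ug_edges_def\<close>)
qed

lemma
  assumes "finite_connected_graph G"
  shows is_lattice_length_lattice: "is_lattice (length_lattice G)"
    and ideal_cone_length_cone: "ideal_cone (length_lattice G) (length_cone G)"
    and rel_interior_length_cone: "rel_interior (length_cone G) = open_length_cone G"
    and span_length_lattice: "span (length_lattice G) = {l. supp l \<subseteq> ug_edges G}"
    and span_length_cone: "span (length_cone G) = {l. supp l \<subseteq> ug_edges G}"
    and open_length_cone_subset: "open_length_cone G \<subseteq> length_cone G"
    and ideal_face_length_cone: "S \<subseteq> ug_edges G \<Longrightarrow>
      ideal_face {l \<in> length_cone G. \<forall>e \<in> S. coord l e = 0} (length_cone G)"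
proof -
  interpret coordinate_cone "ug_edges G" "acyclic_edges G" by (rule coordinate_cone_edges[OF assms])
  have e: "length_lattice G = lattice_E" "length_cone G = cone_E" "open_length_cone G = open_orthant"
    "{l. supp l \<subseteq> ug_edges G} = subspace_E"
    by (simp_all only: length_lattice_def lattice_E_def length_cone_def cone_E_def open_length_cone_def
        open_orthant_def subspace_E_def)
  show "is_lattice (length_lattice G)" unfolding e by (rule is_lattice_E)
  show "ideal_cone (length_lattice G) (length_cone G)" unfolding e by (rule ideal_cone_cone_E)
  show "rel_interior (length_cone G) = open_length_cone G" unfolding e by (rule rel_interior_cone_E)
  show "span (length_lattice G) = {l. supp l \<subseteq> ug_edges G}" unfolding e by (rule span_lattice_E)
  show "span (length_cone G) = {l. supp l \<subseteq> ug_edges G}" unfolding e by (rule span_cone_E)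
  show "open_length_cone G \<subseteq> length_cone G" unfolding e by (rule cone_E_subset(3))
  show "ideal_face {l \<in> length_cone G. \<forall>e \<in> S. coord l e = 0} (length_cone G)"
    if "S \<subseteq> ug_edges G" unfolding e by (rule ideal_face_cone_E[OF that])
qed

lemma keys_subset_iff_lookup:
  "supp l \<subseteq> E \<longleftrightarrow> (\<forall>e. e \<notin> E \<longrightarrow> coord l e = 0)"
  by (auto simp: in_keys_iff)

context finite_ugraph_contraction
begin

abbreviation L :: "('b set \<Rightarrow>\<^sub>0 real) \<Rightarrow> ('a set \<Rightarrow>\<^sub>0 real)" where
  "L \<equiv> length_map G F fa"

lemma lookup_length_map:
  "coord (L l) e = (if e \<in> ug_edges G - F then coord l (fa ` e) else 0)"
proof -
  have "coord (L l) e =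
      (\<Sum>e' \<in> ug_edges G - F. if e' = e then coord l (fa ` e') else 0)"
    unfolding length_map_def lookup_sum by (rule sum.cong) (auto simp: lookup_single when_def)
  then show ?thesis using finite_edges by simp
qed

lemma keys_length_map: "supp (L l) \<subseteq> ug_edges G"
  by (simp add: keys_subset_iff_lookup lookup_length_map)

lemma linear_length_map: "linear L"
  by (rule linearI) (auto intro!: poly_mapping_eqI simp: lookup_length_map lookup_add)

lemma edge'_cases:
  assumes "e' \<in> ug_edges G'"
  obtains e where "e \<in> ug_edges G - F" "e' = fa ` e"
  using assms bij_betw_edges unfolding bij_betw_def by blast

lemma fa_image_in_edges: "e \<in> ug_edges G - F \<Longrightarrow> fa ` e \<in> ug_edges G'"
  using bij_betw_edges unfolding bij_betw_def by blast

lemma length_map_inject: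
  assumes "supp l \<subseteq> ug_edges G'" "supp l' \<subseteq> ug_edges G'" "L l = L l'"
  shows "l = l'"
proof (rule poly_mapping_eqI)
  fix e'
  show "coord l e' = coord l' e'"
  proof (cases "e' \<in> ug_edges G'")
    case True
    then obtain e where "e \<in> ug_edges G - F" "e' = fa ` e" by (rule edge'_cases)
    then show ?thesis using arg_cong[OF assms(3), of "\<lambda>l. coord l e"] by (simp add: lookup_length_map)
  next
    case False
    then show ?thesis using assms(1,2) by (simp add: keys_subset_iff_lookup)
  qed
qed

lemma length_map_surj:
  assumes "supp l \<subseteq> ug_edges G" "\<And>e. e \<in> F \<Longrightarrow> coord l e = 0"
  obtains l' where "supp l' \<subseteq> ug_edges G'" "l = L l'"
proof -
  let ?inv = "inv_into (ug_edges G - F) (\<lambda>e. fa ` e)"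
  define l' where "l' = (\<Sum>e' \<in> ug_edges G'. Poly_Mapping.single e' (coord l (?inv e')))"
  have fin: "finite (ug_edges G')" using finite_arcs' by (simp add: ug_edges_def)
  have l': "coord l' e' = (if e' \<in> ug_edges G' then coord l (?inv e') else 0)" for e'
  proof -
    have "coord l' e' = (\<Sum>e \<in> ug_edges G'. if e = e' then coord l (?inv e) else 0)"
      unfolding l'_def lookup_sum by (rule sum.cong) (auto simp: lookup_single when_def)
    then show ?thesis using fin by simp
  qed
  have inv: "?inv (fa ` e) = e" if "e \<in> ug_edges G - F" for e
    using bij_betw_imp_inj_on[OF bij_betw_edges] that by simp
  have "coord l e = coord (L l') e" for e
    using assms inv[of e] fa_image_in_edges[of e]
    by (cases "e \<in> F") (auto simp: lookup_length_map l' keys_subset_iff_lookup)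
  then have "l = L l'" by (rule poly_mapping_eqI)
  then show ?thesis by (intro that[of l']) (auto simp: keys_subset_iff_lookup l')
qed

text \<open>The zero set of \<open>L l\<close> consists of \<open>F\<close> and the edges
  corresponding to the zero set of \<open>l\<close>; contracting \<open>F\<close> neither creates
  nor destroys acyclicity of such a set.\<close>

lemma length_map_in_length_cone_iff:
  assumes l: "supp l \<subseteq> ug_edges G'"
  shows "L l \<in> length_cone G \<longleftrightarrow> l \<in> length_cone G'"
proof -
  let ?Z = "{e \<in> ug_edges G. coord (L l) e = 0}"
  let ?Z' = "{e \<in> ug_edges G'. coord l e = 0}"
  have Z: "F \<subseteq> ?Z" "?Z \<subseteq> ug_edges G" using F_subset by (auto simp: lookup_length_map)
  have "(\<lambda>e. fa ` e) ` (?Z - F) = ?Z'"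
  proof (intro equalityI subsetI)
    fix e' assume "e' \<in> ?Z'"
    then have e': "e' \<in> ug_edges G'" "coord l e' = 0" by auto
    from e'(1) obtain e where "e \<in> ug_edges G - F" "e' = fa ` e" by (rule edge'_cases)
    then show "e' \<in> (\<lambda>e. fa ` e) ` (?Z - F)"
      using e'(2) by (intro image_eqI[of _ _ e]) (auto simp: lookup_length_map)
  next
    fix e' assume "e' \<in> (\<lambda>e. fa ` e) ` (?Z - F)"
    then obtain e where e: "e \<in> ?Z - F" "e' = fa ` e" by blast
    then show "e' \<in> ?Z'" using fa_image_in_edges[of e] by (auto simp: lookup_length_map)
  qed
  then have "acyclic_edges G ?Z \<longleftrightarrow> acyclic_edges G' ?Z'"
    using acyclic_edges_contraction_iff[OF Z] by simp
  moreover have "(\<forall>e \<in> ug_edges G. 0 \<le> coord (L l) e) \<longleftrightarrow>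
      (\<forall>e' \<in> ug_edges G'. 0 \<le> coord l e')"
  proof
    assume n: "\<forall>e \<in> ug_edges G. 0 \<le> coord (L l) e"
    show "\<forall>e' \<in> ug_edges G'. 0 \<le> coord l e'"
    proof
      fix e' assume "e' \<in> ug_edges G'"
      then obtain e where "e \<in> ug_edges G - F" "e' = fa ` e" by (rule edge'_cases)
      then show "0 \<le> coord l e'" using n[rule_format, of e] by (simp add: lookup_length_map)
    qed
  qed (use fa_image_in_edges in \<open>simp add: lookup_length_map\<close>)
  ultimately show ?thesis using l keys_length_map by (simp add: length_cone_def)
qed

end

text \<open>The image is the face on which the coordinates in \<open>F\<close> vanish. Integrality
  is visible in each coordinate, since the map only relabels coordinates and inserts zeros.\<close>

lemma length_map_lattice_preserving:
  fixes G G' :: "('v, 'a) ugraph"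
  assumes "finite_ugraph_contraction G G' F fv fa" and G: "finite_connected_graph G"
  shows "lattice_preserving_inclusion (length_lattice G') (length_cone G') (length_lattice G) (length_cone G) (length_map G F fa)"
proof -
  interpret finite_ugraph_contraction G G' F fv fa by fact
  note G' = finite_connected_graph_contraction[OF G]
  have keys: "supp l \<subseteq> ug_edges G'" if "l \<in> length_cone G'" for l
    using that by (simp add: length_cone_def)
  have "L ` length_cone G' = {l \<in> length_cone G. \<forall>e \<in> F. coord l e = 0}"
  proof (intro equalityI subsetI)
    fix l assume "l \<in> L ` length_cone G'"
    then show "l \<in> {l \<in> length_cone G. \<forall>e \<in> F. coord l e = 0}"
      using length_map_in_length_cone_iff keys by (auto simp: lookup_length_map)
  next
    fix l assume l: "l \<in> {l \<in> length_cone G. \<forall>e \<in> F. coord l e = 0}"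
    then have "supp l \<subseteq> ug_edges G" "\<And>e. e \<in> F \<Longrightarrow> coord l e = 0"
      by (auto simp: length_cone_def)
    then obtain l' where "supp l' \<subseteq> ug_edges G'" "l = L l'" by (rule length_map_surj)
    then show "l \<in> L ` length_cone G'" using l length_map_in_length_cone_iff by auto
  qed
  moreover have "L ` length_lattice G' = length_lattice G \<inter> L ` {l. supp l \<subseteq> ug_edges G'}"
  proof (intro equalityI subsetI)
    fix l assume "l \<in> L ` length_lattice G'"
    then show "l \<in> length_lattice G \<inter> L ` {l. supp l \<subseteq> ug_edges G'}"
      using keys_length_map fa_image_in_edges by (auto simp: length_lattice_def lookup_length_map)
  next
    fix l assume "l \<in> length_lattice G \<inter> L ` {l. supp l \<subseteq> ug_edges G'}"
    then obtain l' where l': "l = L l'" "supp l' \<subseteq> ug_edges G'" "L l' \<in> length_lattice G" by blast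
    have "coord l' e' \<in> \<int>" if e': "e' \<in> ug_edges G'" for e'
    proof -
      from e' obtain e where "e \<in> ug_edges G - F" "e' = fa ` e" by (rule edge'_cases)
      then have "coord l' e' = coord (L l') e" "e \<in> ug_edges G"
        by (simp_all add: lookup_length_map)
      then show ?thesis using l'(3) by (simp add: length_lattice_def)
    qed
    then show "l \<in> L ` length_lattice G'" using l' by (auto simp: length_lattice_def)
  qed
  moreover have "length_lattice G' \<inter> {l. supp l \<subseteq> ug_edges G'} = length_lattice G'"
    by (auto simp: length_lattice_def)
  moreover have "L ` {l. supp l \<subseteq> ug_edges G'} \<subseteq> {l. supp l \<subseteq> ug_edges G}"
    using keys_length_map by blast
  moreover have "inj_on L (length_cone G')" by (rule inj_onI) (use keys length_map_inject in blast)
  ultimately show ?thesis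
    unfolding lattice_preserving_inclusion_def span_length_lattice[OF G] span_length_lattice[OF G'] span_length_cone[OF G']
    using linear_length_map ideal_face_length_cone[OF G F_subset] by simp
qed

section \<open>Specializations of marked metric graphs\<close>

definition cone_curves :: "nat \<Rightarrow> ('v, 'a) marked_curve set" where
  "cone_curves g = {(G, l, h). (G, h) \<in> stable_marked_graphs g \<and> l \<in> length_cone G}"

text \<open>The lengths upstairs are determined by those downstairs, so the corresponding gluing map
  goes from the second curve to the first.\<close>

definition metric_specialization ::
  "nat \<Rightarrow> ('v, 'a) marked_curve \<Rightarrow> ('v, 'a) marked_curve \<Rightarrow> 'a set set \<Rightarrow> ('v \<Rightarrow> 'v) \<Rightarrow> ('a \<Rightarrow> 'a) \<Rightarrow> bool"
where
  "metric_specialization g = (\<lambda>(G, l, h) (G', l', h') F fv fa.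
     specialization g (G, h) (G', h') F fv fa \<and> l = length_map G F fa l')"

lemma metric_specialization_iff:
  "metric_specialization g (G, l, h) (G', l', h') F fv fa \<longleftrightarrow>
     specialization g (G, h) (G', h') F fv fa \<and> l = length_map G F fa l'"
  by (simp add: metric_specialization_def)

lemma cone_curvesD:
  assumes "(G, l, h) \<in> cone_curves g"
  shows "(G, h) \<in> stable_marked_graphs g" "l \<in> length_cone G" "supp l \<subseteq> ug_edges G"
  using assms by (auto simp: cone_curves_def length_cone_def)

lemma marked_curves_subset: "marked_curves g \<subseteq> cone_curves g"
  using open_length_cone_subset stable_marked_graphsD(1)
  by (fastforce simp: marked_curves_def cone_curves_def)

lemma metric_specialization_refl:
  assumes "x \<in> cone_curves g" shows "metric_specialization g x x {} (\<lambda>v. v) (\<lambda>a. a)"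
proof -
  obtain G l h where x: "x = (G, l, h)" by (rule prod_cases3)
  note m = cone_curvesD[OF assms[unfolded x]]
  note s = specialization_refl[OF m(1)]
  interpret finite_ugraph_contraction G G "{}" "\<lambda>v. v" "\<lambda>a. a"
    by (rule specialization_contraction[OF s m(1,1)])
  have "coord l e = coord (length_map G {} (\<lambda>a. a) l) e" for e
    using m(3) by (auto simp: lookup_length_map keys_subset_iff_lookup)
  then have "l = length_map G {} (\<lambda>a. a) l" by (rule poly_mapping_eqI)
  with s show ?thesis unfolding x metric_specialization_iff by (rule conjI)
qed

lemma metric_specialization_comp:
  assumes s: "metric_specialization g x y F p q" "metric_specialization g y z F1 p1 q1"
    and m: "x \<in> cone_curves g" "y \<in> cone_curves g" "z \<in> cone_curves g"
  obtains F2 p2 q2 where "metric_specialization g x z F2 p2 q2" "F = {} \<Longrightarrow> F1 = {} \<Longrightarrow> F2 = {}"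
proof -
  obtain G l h where ex: "x = (G, l, h)" by (rule prod_cases3)
  obtain G1 l1 h1 where ey: "y = (G1, l1, h1)" by (rule prod_cases3)
  obtain G2 l2 h2 where ez: "z = (G2, l2, h2)" by (rule prod_cases3)
  note e = ex ey ez
  note mx = cone_curvesD[OF m(1)[unfolded e]] and my = cone_curvesD[OF m(2)[unfolded e]]
    and mz = cone_curvesD[OF m(3)[unfolded e]]
  have sx: "specialization g (G, h) (G1, h1) F p q" "l = length_map G F q l1"
    and sy: "specialization g (G1, h1) (G2, h2) F1 p1 q1" "l1 = length_map G1 F1 q1 l2"
    using s by (simp_all add: e metric_specialization_iff)
  define Z where "Z = F \<union> {e \<in> ug_edges G - F. q ` e \<in> F1}"
  have sz: "specialization g (G, h) (G2, h2) Z (\<lambda>v. p1 (p v)) (\<lambda>a. q1 (q a))"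
    unfolding Z_def by (rule specialization_comp[OF sx(1) sy(1) mx(1) my(1) mz(1)])
  interpret A: finite_ugraph_contraction G G1 F p q by (rule specialization_contraction[OF sx(1) mx(1) my(1)])
  interpret B: finite_ugraph_contraction G1 G2 F1 p1 q1 by (rule specialization_contraction[OF sy(1) my(1) mz(1)])
  interpret C: finite_ugraph_contraction G G2 Z "\<lambda>v. p1 (p v)" "\<lambda>a. q1 (q a)"
    by (rule specialization_contraction[OF sz mx(1) mz(1)])
  have "coord l e = coord (length_map G Z (\<lambda>a. q1 (q a)) l2) e" for e
    unfolding sx(2) sy(2) A.lookup_length_map B.lookup_length_map C.lookup_length_map
    using A.fa_image_in_edges[of e] by (auto simp: image_image Z_def)
  then have "l = length_map G Z (\<lambda>a. q1 (q a)) l2" by (rule poly_mapping_eqI)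
  with sz have "metric_specialization g x z Z (\<lambda>v. p1 (p v)) (\<lambda>a. q1 (q a))"
    unfolding e metric_specialization_iff by (rule conjI)
  then show ?thesis by (rule that) (simp add: Z_def)
qed

text \<open>The case \<open>F0 = F\<close> is the source of uniqueness: two contractions of the same
  forest differ by an isomorphism respecting lengths and markings.\<close>

lemma metric_specialization_factor:
  assumes s: "metric_specialization g x y F0 p q" "metric_specialization g x z F fv fa" "F0 \<subseteq> F"
    and m: "x \<in> cone_curves g" "y \<in> cone_curves g" "z \<in> cone_curves g"
  obtains F1 p1 q1 where "metric_specialization g y z F1 p1 q1" "F0 = F \<Longrightarrow> F1 = {}"
proof -
  obtain G l h where ex: "x = (G, l, h)" by (rule prod_cases3)
  obtain G1 l1 h1 where ey: "y = (G1, l1, h1)" by (rule prod_cases3)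
  obtain G2 l2 h2 where ez: "z = (G2, l2, h2)" by (rule prod_cases3)
  note e = ex ey ez
  note mx = cone_curvesD[OF m(1)[unfolded e]] and my = cone_curvesD[OF m(2)[unfolded e]]
    and mz = cone_curvesD[OF m(3)[unfolded e]]
  have sy: "specialization g (G, h) (G1, h1) F0 p q" "l = length_map G F0 q l1"
    and sz: "specialization g (G, h) (G2, h2) F fv fa" "l = length_map G F fa l2"
    using s by (simp_all add: e metric_specialization_iff)
  let ?F1 = "(\<lambda>e. q ` e) ` (F - F0)"
  interpret A: finite_ugraph_contraction G G1 F0 p q by (rule specialization_contraction[OF sy(1) mx(1) my(1)])
  interpret C: finite_ugraph_contraction G G2 F fv fa by (rule specialization_contraction[OF sz(1) mx(1) mz(1)])
  show ?thesis
  proof (rule specialization_factor[OF sy(1) sz(1) s(3) mx(1) my(1) mz(1)])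
    fix fv1 fa1
    assume s1: "specialization g (G1, h1) (G2, h2) ?F1 fv1 fa1"
      and fa1: "\<And>a. a \<in> ug_arcs G \<Longrightarrow> a \<notin> \<Union>F \<Longrightarrow> fa1 (q a) = fa a"
    interpret B: finite_ugraph_contraction G1 G2 ?F1 fv1 fa1
      by (rule specialization_contraction[OF s1 my(1) mz(1)])
    have im: "fa1 ` q ` e = fa ` e" if e: "e \<in> ug_edges G - F" for e
    proof -
      have "fa1 (q a) = fa a" if a: "a \<in> e" for a
      proof -
        have "a \<in> \<Union>(ug_edges G - F)" using a e by blast
        then have "ug_edge G a \<in> ug_edges G - F" by (simp only: A.G.mem_Union_edges[OF Diff_subset])
        then show ?thesis
          using fa1[of a] by (simp only: A.G.ug_edge_in_ug_edges C.mem_Union_F Diff_iff simp_thms)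
      qed
      then show ?thesis by (auto simp: image_image)
    qed
    have "coord l1 e1 = coord (length_map G1 ?F1 fa1 l2) e1" for e1
    proof (cases "e1 \<in> ug_edges G1")
      case True
      then obtain e where e: "e \<in> ug_edges G - F0" "e1 = q ` e" by (rule A.edge'_cases)
      have "e1 \<in> ?F1 \<longleftrightarrow> e \<in> F - F0"
        unfolding e(2) using A.F_subset C.F_subset e(1)
        by (intro inj_on_image_mem_iff[OF bij_betw_imp_inj_on[OF A.bij_betw_edges]]) auto
      moreover have "coord l1 e1 = coord l e"
        using e by (simp add: sy(2) A.lookup_length_map)
      ultimately show ?thesis
        using e True im[of e] by (simp add: sz(2) B.lookup_length_map C.lookup_length_map)
    next
      case False
      then show ?thesis using my(3) by (simp add: keys_subset_iff_lookup B.lookup_length_map)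
    qed
    then have "l1 = length_map G1 ?F1 fa1 l2" by (rule poly_mapping_eqI)
    with s1 have "metric_specialization g y z ?F1 fv1 fa1"
      unfolding e metric_specialization_iff by (rule conjI)
    then show ?thesis by (rule that) simp
  qed
qed

text \<open>Positive lengths in the target leave no choice: an uncontracted edge has the length of
  its image, a contracted one has length 0.\<close>

lemma metric_specialization_contracted_edges:
  assumes s: "metric_specialization g (G, l, h) (G', l', h') F fv fa"
    and m: "(G, l, h) \<in> cone_curves g" "(G', l', h') \<in> marked_curves g"
  shows "F = {e \<in> ug_edges G. coord l e = 0}"
proof -
  have s': "specialization g (G, h) (G', h') F fv fa" "l = length_map G F fa l'"
    using s by (simp_all add: metric_specialization_iff)
  have m': "(G', h') \<in> stable_marked_graphs g" "l' \<in> open_length_cone G'"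
    using m(2) by (auto simp: marked_curves_def)
  interpret finite_ugraph_contraction G G' F fv fa
    by (rule specialization_contraction[OF s'(1) cone_curvesD(1)[OF m(1)] m'(1)])
  have "coord l' (fa ` e) \<noteq> 0" if "e \<in> ug_edges G - F" for e
    using fa_image_in_edges[OF that] m'(2) by (force simp: open_length_cone_def)
  then show ?thesis using F_subset by (auto simp: s'(2) lookup_length_map)
qed

lemma curve_equiv_iff:
  "(x, y) \<in> curve_equiv g \<longleftrightarrow> x \<in> marked_curves g \<and> y \<in> marked_curves g \<and>
     (\<exists>fv fa. metric_specialization g x y {} fv fa)"
proof -
  obtain G l h where ex: "x = (G, l, h)" by (rule prod_cases3)
  obtain G' l' h' where ey: "y = (G', l', h')" by (rule prod_cases3)
  note e = ex ey
  show ?thesis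
  proof (cases "x \<in> marked_curves g \<and> y \<in> marked_curves g")
    case True
    then have m: "(G, h) \<in> stable_marked_graphs g" "(G', h') \<in> stable_marked_graphs g"
      and keys: "supp l \<subseteq> ug_edges G"
      by (auto simp: e marked_curves_def open_length_cone_def)
    note fc = graph_iso_iff_forest_contraction[OF stable_marked_graphsD(4)[OF m(1)], of G']
    have "(\<forall>e \<in> ug_edges G. coord l' (fa ` e) = coord l e) \<longleftrightarrow> l = length_map G {} fa l'"
      if "graph_iso G G' fv fa" for fv fa
    proof -
      interpret finite_ugraph_contraction G G' "{}" fv fa
        by (rule finite_ugraph_contractionI) (use stable_marked_graphsD[OF m(1)] stable_marked_graphsD[OF m(2)] that fc in auto)
      show ?thesis
        unfolding poly_mapping_eq_iff fun_eq_iff lookup_length_map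
        using keys by (auto simp: keys_subset_iff_lookup)
    qed
    then have "(\<exists>fv fa. graph_iso G G' fv fa \<and>
        (\<forall>e \<in> ug_edges G. coord l' (fa ` e) = coord l e) \<and>
        homotopic_markings g G' (realization_map G {} fv fa \<circ> h) h') \<longleftrightarrow>
        (\<exists>fv fa. metric_specialization g x y {} fv fa)"
      unfolding e metric_specialization_iff specialization_iff fc[symmetric] by blast
    with True show ?thesis by (simp add: curve_equiv_def e)
  next
    case False
    then show ?thesis by (auto simp: curve_equiv_def e)
  qed
qed

text \<open>All positive-length curves obtained from \<open>x\<close> are collected instead of
  choosing one; the set turns out to be a class of \<open>curve_equiv\<close>.\<close>

definition contracts_to :: "nat \<Rightarrow> ('v, 'a) marked_curve \<Rightarrow> ('v, 'a) marked_curve set" where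
  "contracts_to g x = {y \<in> marked_curves g. \<exists>F fv fa. metric_specialization g x y F fv fa}"

text \<open>The zero set is a forest by definition of the cone and can be contracted. Arcs keep
  their names, so the new edges are the edges of positive length, and \<open>l\<close> itself is the
  length function of the contracted graph.\<close>

lemma contracts_to_nonempty:
  assumes "x \<in> cone_curves g" shows "contracts_to g x \<noteq> {}"
proof -
  obtain G l h where x: "x = (G, l, h)" by (rule prod_cases3)
  note m = cone_curvesD[OF assms[unfolded x]]
  interpret bidirected_ugraph G by (rule stable_marked_graphsD(4)[OF m(1)])
  let ?F = "{e \<in> ug_edges G. coord l e = 0}"
  have "?F \<subseteq> ug_edges G" "acyclic_edges G ?F" using m(2) by (auto simp: length_cone_def)
  then obtain \<rho> and G' :: "('a, 'b) ugraph" where G': "bidirected_ugraph G'" "forest_contraction G G' ?F \<rho> (\<lambda>a. a)"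
    using contraction_exists by metis
  note cm = contracted_marking[OF m(1) G']
  interpret C: finite_ugraph_contraction G G' ?F \<rho> "\<lambda>a. a"
    by (rule specialization_contraction[OF cm(2) m(1) cm(1)])
  have E': "ug_edges G' = ug_edges G - ?F" using C.bij_betw_edges by (simp add: bij_betw_def)
  have "coord l e = coord (length_map G ?F (\<lambda>a. a) l) e" for e
    using m(3) by (auto simp: C.lookup_length_map keys_subset_iff_lookup)
  then have "l = length_map G ?F (\<lambda>a. a) l" by (rule poly_mapping_eqI)
  with cm(2) have "metric_specialization g x (G', l, C.\<pi> \<circ> h) ?F \<rho> (\<lambda>a. a)"
    unfolding x metric_specialization_iff by (rule conjI)
  moreover have "l \<in> open_length_cone G'"
    using m(2,3) by (fastforce simp: open_length_cone_def E' length_cone_def keys_subset_iff_lookup)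
  then have "(G', l, C.\<pi> \<circ> h) \<in> marked_curves g" using cm(1) by (simp add: marked_curves_def)
  ultimately have "(G', l, C.\<pi> \<circ> h) \<in> contracts_to g x" unfolding contracts_to_def by blast
  then show ?thesis by blast
qed

text \<open>Both contractions collapse exactly the zero set of \<open>x\<close>, so factoring one
  through the other leaves an isomorphism.\<close>

lemma contracts_to_unique:
  assumes x: "x \<in> cone_curves g" and y: "y \<in> contracts_to g x" "y' \<in> contracts_to g x"
  shows "(y, y') \<in> curve_equiv g"
proof -
  obtain G l h where e: "x = (G, l, h)" by (rule prod_cases3)
  obtain F fv fa F' fv' fa' where s: "metric_specialization g x y F fv fa" "metric_specialization g x y' F' fv' fa'"
    and m: "y \<in> marked_curves g" "y' \<in> marked_curves g"
    using y by (auto simp: contracts_to_def)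
  have "F = F'"
  proof (cases y, cases y')
    fix G1 l1 h1 G2 l2 h2 assume y: "y = (G1, l1, h1)" "y' = (G2, l2, h2)"
    show ?thesis
      using metric_specialization_contracted_edges[OF s(1)[unfolded e y] x[unfolded e] m(1)[unfolded y]]
        metric_specialization_contracted_edges[OF s(2)[unfolded e y] x[unfolded e] m(2)[unfolded y]] by (rule trans[OF _ sym])
  qed
  note sub = subsetD[OF marked_curves_subset]
  obtain F1 p1 q1 where "metric_specialization g y y' F1 p1 q1" "F = F' \<Longrightarrow> F1 = {}"
    by (rule metric_specialization_factor[OF s _ x sub[OF m(1)] sub[OF m(2)]]) (use \<open>F = F'\<close> in blast)+
  then show ?thesis using m \<open>F = F'\<close> by (auto simp: curve_equiv_iff)
qed

lemma contracts_to_trans: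
  assumes "metric_specialization g x x1 F fv fa" "x \<in> cone_curves g" "x1 \<in> cone_curves g"
  shows "contracts_to g x1 \<subseteq> contracts_to g x"
proof
  fix y assume "y \<in> contracts_to g x1"
  then obtain F1 p1 q1 where y: "y \<in> marked_curves g" "metric_specialization g x1 y F1 p1 q1"
    by (auto simp: contracts_to_def)
  then have "y \<in> cone_curves g" using marked_curves_subset by blast
  from metric_specialization_comp[OF assms(1) y(2) assms(2,3) this]
  obtain F2 p2 q2 where "metric_specialization g x y F2 p2 q2" by metis
  with y(1) show "y \<in> contracts_to g x" by (auto simp: contracts_to_def)
qed

lemma contracts_to_eq_class:
  assumes x: "x \<in> cone_curves g" and y: "y \<in> contracts_to g x"
  shows "contracts_to g x = curve_equiv g `` {y}"
proof (intro equalityI subsetI)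
  fix z assume "z \<in> contracts_to g x"
  then show "z \<in> curve_equiv g `` {y}" using contracts_to_unique[OF x y] by blast
next
  fix z assume "z \<in> curve_equiv g `` {y}"
  then obtain fv fa where z: "y \<in> marked_curves g" "z \<in> marked_curves g" "metric_specialization g y z {} fv fa"
    by (auto simp: curve_equiv_iff)
  from y obtain F p q where s: "metric_specialization g x y F p q" by (auto simp: contracts_to_def)
  from metric_specialization_comp[OF s z(3) x] z marked_curves_subset
  obtain F2 p2 q2 where "metric_specialization g x z F2 p2 q2" by (metis subsetD)
  then show "z \<in> contracts_to g x" using z(2) by (auto simp: contracts_to_def)
qed

lemma contracts_to_self: "x \<in> marked_curves g \<Longrightarrow> x \<in> contracts_to g x"
  using metric_specialization_refl marked_curves_subset by (fastforce simp: contracts_to_def)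

text \<open>Composition gives one inclusion and hence a common element; both sets are equivalence
  classes, so they coincide.\<close>

lemma contracts_to_invariant:
  assumes s: "metric_specialization g x x1 F fv fa" and m: "x \<in> cone_curves g" "x1 \<in> cone_curves g"
  shows "contracts_to g x = contracts_to g x1"
proof -
  obtain y where y: "y \<in> contracts_to g x1" using contracts_to_nonempty[OF m(2)] by blast
  then have "y \<in> contracts_to g x" using contracts_to_trans[OF s m] by blast
  then show ?thesis using contracts_to_eq_class m y by metis
qed

section \<open>The glued space\<close>

locale teichmueller =
  fixes g :: nat and rep :: "('v, 'a) marked_graph set \<Rightarrow> ('v, 'a) marked_graph"
  assumes rep: "\<And>c. c \<in> marked_classes g \<Longrightarrow> rep c \<in> c"
begin

abbreviation I :: "('v, 'a) marked_graph set set" where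
  "I \<equiv> marked_classes g"

abbreviation \<sigma> :: "('v, 'a) marked_graph set \<Rightarrow> ('a set \<Rightarrow>\<^sub>0 real) set" where
  "\<sigma> \<equiv> teich_cone rep"

abbreviation \<sigma>0 :: "('v, 'a) marked_graph set \<Rightarrow> ('a set \<Rightarrow>\<^sub>0 real) set" where
  "\<sigma>0 \<equiv> teich_open_cone rep"

abbreviation A where "A \<equiv> teich_maps g rep"

abbreviation glue where "glue \<equiv> gluing_equiv I \<sigma> A"

definition curve :: "('v, 'a) marked_graph set \<times> ('a set \<Rightarrow>\<^sub>0 real) \<Rightarrow> ('v, 'a) marked_curve" where
  "curve = (\<lambda>(c, l). (fst (rep c), l, snd (rep c)))"

abbreviation K :: "('v, 'a) marked_graph set \<times> ('a set \<Rightarrow>\<^sub>0 real) \<Rightarrow> ('v, 'a) marked_curve set" where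
  "K p \<equiv> contracts_to g (curve p)"

lemma rep_stable:
  assumes "c \<in> I" shows "rep c \<in> stable_marked_graphs g" "c = marked_equiv g `` {rep c}"
proof -
  obtain m where m: "m \<in> stable_marked_graphs g" "c = marked_equiv g `` {m}"
    using assms unfolding marked_classes_def by (rule quotientE)
  have "(m, rep c) \<in> marked_equiv g" using rep[OF assms] m(2) by blast
  then show "rep c \<in> stable_marked_graphs g" "c = marked_equiv g `` {rep c}"
    using equiv_class_eq[OF equiv_marked_equiv] equivE[OF equiv_marked_equiv] m(2) by blast+
qed

lemma rep_fcg: "c \<in> I \<Longrightarrow> finite_connected_graph (fst (rep c))"
  using rep_stable(1)[of c] stable_marked_graphsD(1)[of "fst (rep c)" "snd (rep c)"] by simp

lemma open_cone_subset: "c \<in> I \<Longrightarrow> \<sigma>0 c \<subseteq> \<sigma> c"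
  unfolding teich_open_cone_def teich_cone_def by (rule open_length_cone_subset[OF rep_fcg])

lemma curve_in_cone_curves: "p \<in> Sigma I \<sigma> \<Longrightarrow> curve p \<in> cone_curves g"
  using rep_stable(1) by (auto simp: curve_def cone_curves_def teich_cone_def)

lemma curve_in_marked_curves: "p \<in> Sigma I \<sigma>0 \<Longrightarrow> curve p \<in> marked_curves g"
  using rep_stable(1) by (auto simp: curve_def marked_curves_def teich_open_cone_def)

lemma metric_specialization_curve:
  "metric_specialization g (curve (c, l)) (curve (c', l')) F fv fa \<longleftrightarrow>
     specialization g (rep c) (rep c') F fv fa \<and> l = length_map (fst (rep c)) F fa l'"
  by (simp add: curve_def metric_specialization_iff)

lemma specialization_rep_contraction:
  assumes "c \<in> I" "c' \<in> I" "specialization g (rep c) (rep c') F fv fa"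
  shows "finite_ugraph_contraction (fst (rep c)) (fst (rep c')) F fv fa"
  using specialization_contraction(1)[of g "fst (rep c)" "snd (rep c)" "fst (rep c')" "snd (rep c')"]
    assms rep_stable(1) by simp

lemma glue_step:
  assumes "(c', c, L) \<in> A" "l' \<in> \<sigma> c'"
  shows "(c', l') \<in> Sigma I \<sigma>" "(c, L l') \<in> Sigma I \<sigma>" "K (c, L l') = K (c', l')"
proof -
  from assms(1) obtain F fv fa where c: "c \<in> I" "c' \<in> I" "specialization g (rep c) (rep c') F fv fa"
    "L = length_map (fst (rep c)) F fa"
    unfolding teich_maps_def by blast
  interpret finite_ugraph_contraction "fst (rep c)" "fst (rep c')" F fv fa
    by (rule specialization_rep_contraction[OF c(1-3)])
  show 1: "(c', l') \<in> Sigma I \<sigma>" using c(2) assms(2) by simp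
  show 2: "(c, L l') \<in> Sigma I \<sigma>"
    using c assms(2) length_map_in_length_cone_iff[of l'] by (simp add: teich_cone_def length_cone_def)
  have "metric_specialization g (curve (c, L l')) (curve (c', l')) F fv fa"
    using c(3,4) by (simp add: metric_specialization_curve)
  then show "K (c, L l') = K (c', l')"
    by (rule contracts_to_invariant[OF _ curve_in_cone_curves[OF 2] curve_in_cone_curves[OF 1]])
qed

text \<open>The generating relation inside \<open>gluing_equiv\<close>, named so that invariance can
  be shown by induction along zigzags.\<close>

definition step :: "((('v, 'a) marked_graph set \<times> ('a set \<Rightarrow>\<^sub>0 real)) \<times> (('v, 'a) marked_graph set \<times> ('a set \<Rightarrow>\<^sub>0 real))) set"
  where "step = {((i, x), (j, L x)) | i j L x. (i, j, L) \<in> A \<and> x \<in> \<sigma> i}"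

lemma glue_eq: "glue = (step \<union> step\<inverse>)\<^sup>* \<inter> (Sigma I \<sigma> \<times> Sigma I \<sigma>)"
  by (simp add: gluing_equiv_def step_def Let_def)

lemma step_invariant: "(p, q) \<in> step \<Longrightarrow> p \<in> Sigma I \<sigma> \<and> q \<in> Sigma I \<sigma> \<and> K p = K q"
  using glue_step by (auto simp: step_def)

lemma glue_invariant:
  assumes "(p, q) \<in> glue" shows "p \<in> Sigma I \<sigma>" "q \<in> Sigma I \<sigma>" "K p = K q"
proof -
  show "p \<in> Sigma I \<sigma>" "q \<in> Sigma I \<sigma>" using assms by (simp_all only: glue_eq Int_iff mem_Sigma_iff)
  have "(p, q) \<in> (step \<union> step\<inverse>)\<^sup>*" using assms by (simp only: glue_eq Int_iff)
  then show "K p = K q"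
  proof (induction rule: rtrancl_induct)
    case (step y z)
    then show ?case using step_invariant[of y z] step_invariant[of z y] by auto
  qed simp
qed

lemma glue_sym: assumes "(p, q) \<in> glue" shows "(q, p) \<in> glue"
proof -
  have "sym ((step \<union> step\<inverse>)\<^sup>*)" by (intro sym_rtrancl sym_Un_converse)
  then show ?thesis using assms unfolding glue_eq by (auto dest: symD)
qed

lemma glue_trans: "(p, q) \<in> glue \<Longrightarrow> (q, s) \<in> glue \<Longrightarrow> (p, s) \<in> glue"
  unfolding glue_eq by (auto intro: rtrancl_trans)

text \<open>The pair is reversed because the gluing map embeds the cone of the contracted graph into
  the cone of the original one.\<close>

lemma glue_metric_specialization:
  assumes p: "(c, l) \<in> Sigma I \<sigma>" "(c', l') \<in> Sigma I \<sigma>"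
    and s: "metric_specialization g (curve (c, l)) (curve (c', l')) F fv fa"
  shows "((c', l'), (c, l)) \<in> glue"
proof -
  have s': "specialization g (rep c) (rep c') F fv fa" "l = length_map (fst (rep c)) F fa l'"
    using s by (simp_all only: metric_specialization_curve)
  have c: "c \<in> I" "c' \<in> I" "l' \<in> \<sigma> c'" using p by (simp_all only: mem_Sigma_iff)
  have "(c', c, length_map (fst (rep c)) F fa) \<in> A"
    using c s'(1) unfolding teich_maps_def by blast
  then have "((c', l'), (c, length_map (fst (rep c)) F fa l')) \<in> step"
    using c(3) unfolding step_def by blast
  then have "((c', l'), (c, l)) \<in> step" by (simp only: s'(2)[symmetric])
  then show ?thesis unfolding glue_eq using p by blast
qed

text \<open>The marked graph of \<open>y\<close> is isomorphic to the chosen representative of its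
  class, and the lengths are carried along the isomorphism.\<close>

lemma curve_transport:
  assumes y: "y \<in> marked_curves g"
  obtains p fv fa where "p \<in> Sigma I \<sigma>0" "metric_specialization g y (curve p) {} fv fa"
proof -
  obtain G l h where e: "y = (G, l, h)" by (rule prod_cases3)
  have m: "(G, h) \<in> stable_marked_graphs g" "l \<in> open_length_cone G"
    using y by (auto simp: e marked_curves_def)
  define c where "c = marked_equiv g `` {(G, h)}"
  have c: "c \<in> I" unfolding c_def marked_classes_def by (rule quotientI[OF m(1)])
  obtain G0 h0 where r: "rep c = (G0, h0)" by (rule prod.exhaust)
  have "((G, h), (G0, h0)) \<in> marked_equiv g" using rep[OF c] by (simp add: r) (simp add: c_def)
  then obtain fv fa where s: "specialization g (G, h) (G0, h0) {} fv fa" and m0: "(G0, h0) \<in> stable_marked_graphs g"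
    unfolding marked_equiv_iff by blast
  interpret finite_ugraph_contraction G G0 "{}" fv fa by (rule specialization_contraction[OF s m(1) m0])
  have keys: "supp l \<subseteq> ug_edges G" using m(2) by (simp add: open_length_cone_def)
  obtain l0 where l0: "supp l0 \<subseteq> ug_edges G0" "l = length_map G {} fa l0"
    using length_map_surj[OF keys] by auto
  have "0 < coord l0 e0" if "e0 \<in> ug_edges G0" for e0
  proof -
    from that obtain e where e: "e \<in> ug_edges G - {}" "e0 = fa ` e" by (rule edge'_cases)
    then have "0 < coord l e" using m(2) by (simp add: open_length_cone_def)
    then show ?thesis using e by (simp add: l0(2) lookup_length_map)
  qed
  then have "l0 \<in> open_length_cone G0" using l0(1) by (simp add: open_length_cone_def)
  then have p: "(c, l0) \<in> Sigma I \<sigma>0" using c r by (simp add: teich_open_cone_def)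
  have "metric_specialization g y (curve (c, l0)) {} fv fa"
    by (simp add: e curve_def r metric_specialization_iff s l0(2)[symmetric])
  with p show ?thesis by (rule that)
qed

text \<open>The zero-length edges of \<open>p\<close> are contracted and the result is moved to its
  representative; the composite is a single specialization, hence one gluing map.\<close>

lemma glue_open_point:
  assumes p: "p \<in> Sigma I \<sigma>" obtains p0 where "p0 \<in> Sigma I \<sigma>0" "(p0, p) \<in> glue"
proof -
  note x = curve_in_cone_curves[OF p] and sub = subsetD[OF marked_curves_subset]
  obtain y where y: "y \<in> contracts_to g (curve p)" using contracts_to_nonempty[OF x] by blast
  then obtain F fv fa where m: "y \<in> marked_curves g" and s: "metric_specialization g (curve p) y F fv fa"
    by (auto simp: contracts_to_def)
  obtain p0 fv0 fa0 where p0: "p0 \<in> Sigma I \<sigma>0" "metric_specialization g y (curve p0) {} fv0 fa0"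
    using curve_transport[OF m] by metis
  have p0': "p0 \<in> Sigma I \<sigma>" using p0(1) open_cone_subset by auto
  obtain F2 p2 q2 where "metric_specialization g (curve p) (curve p0) F2 p2 q2"
    using metric_specialization_comp[OF s p0(2) x sub[OF m] curve_in_cone_curves[OF p0']] by metis
  then have "(p0, p) \<in> glue"
    using glue_metric_specialization[of "fst p" "snd p" "fst p0" "snd p0"] p p0' by simp
  with p0(1) show ?thesis by (rule that)
qed

text \<open>A curve of positive length belongs to its own \<open>K\<close>-set, so equal sets give
  an isomorphism. It makes the two representatives equivalent, and classes with equivalent
  representatives coincide.\<close>

lemma open_points_same_class:
  assumes p: "p \<in> Sigma I \<sigma>0" and q: "q \<in> Sigma I \<sigma>0" and eq: "K p = K q"
  obtains fv fa where "fst p = fst q" "metric_specialization g (curve p) (curve q) {} fv fa"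
proof -
  note mp = curve_in_marked_curves[OF p] and mq = curve_in_marked_curves[OF q]
  have x: "curve p \<in> cone_curves g" using mp marked_curves_subset by blast
  have "(curve p, curve q) \<in> curve_equiv g"
    using contracts_to_unique[OF x contracts_to_self[OF mp]] contracts_to_self[OF mq] eq by simp
  then obtain fv fa where s: "metric_specialization g (curve p) (curve q) {} fv fa"
    unfolding curve_equiv_iff by blast
  obtain c l c' l' where e: "p = (c, l)" "q = (c', l')" by (cases p, cases q) auto
  have c: "c \<in> I" "c' \<in> I" using p q by (auto simp: e)
  have "specialization g (rep c) (rep c') {} fv fa" using s by (simp add: e metric_specialization_curve)
  then have "(rep c, rep c') \<in> marked_equiv g"
    using marked_equiv_iff[of "fst (rep c)" "snd (rep c)" "fst (rep c')" "snd (rep c')" g] rep_stable(1) c by auto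
  then have "c = c'"
    using rep_stable(2)[OF c(1)] rep_stable(2)[OF c(2)] equiv_class_eq[OF equiv_marked_equiv] by metis
  then show ?thesis using s by (intro that) (simp_all add: e)
qed

text \<open>Any zigzag can be replaced by a short one: \<open>p\<close> and \<open>q\<close> are
  each glued to an open point, and two open points with the same \<open>K\<close>-set are related by
  one isomorphism.\<close>

lemma glue_iff:
  assumes p: "p \<in> Sigma I \<sigma>" and q: "q \<in> Sigma I \<sigma>"
  shows "(p, q) \<in> glue \<longleftrightarrow> K p = K q"
proof
  assume eq: "K p = K q"
  obtain p0 where p0: "p0 \<in> Sigma I \<sigma>0" "(p0, p) \<in> glue" using glue_open_point[OF p] by metis
  obtain q0 where q0: "q0 \<in> Sigma I \<sigma>0" "(q0, q) \<in> glue" using glue_open_point[OF q] by metis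
  have "K p0 = K q0" using glue_invariant(3)[OF p0(2)] glue_invariant(3)[OF q0(2)] eq by simp
  then obtain fv fa where "metric_specialization g (curve p0) (curve q0) {} fv fa"
    using open_points_same_class[OF p0(1) q0(1)] by metis
  then have "(q0, p0) \<in> glue"
    using glue_metric_specialization[of "fst p0" "snd p0" "fst q0" "snd q0"]
      glue_invariant(1)[OF p0(2)] glue_invariant(1)[OF q0(2)] by simp
  then show "(p, q) \<in> glue" using p0(2) q0(2) glue_sym glue_trans by metis
qed (rule glue_invariant(3))

text \<open>The two points differ by an automorphism of the representative that respects the marking
  up to homotopy. It fixes all arcs, so the lengths agree.\<close>

lemma open_points_rigid:
  assumes c: "c \<in> I" and l: "l \<in> \<sigma>0 c" "l' \<in> \<sigma>0 c" and eq: "K (c, l) = K (c, l')"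
  shows "l = l'"
proof -
  obtain fv fa where "metric_specialization g (curve (c, l)) (curve (c, l')) {} fv fa"
    using open_points_same_class[of "(c, l)" "(c, l')"] c l eq by auto
  then have s: "specialization g (rep c) (rep c) {} fv fa" "l = length_map (fst (rep c)) {} fa l'"
    by (simp_all only: metric_specialization_curve)
  interpret finite_ugraph_contraction "fst (rep c)" "fst (rep c)" "{}" fv fa
    by (rule specialization_rep_contraction[OF c c s(1)])
  have fix_arc: "fa a = a" if "a \<in> ug_arcs (fst (rep c))" for a
    using specialization_self_fixes_arcs[of "fst (rep c)" "snd (rep c)" g] rep_stable(1)[OF c] s(1) that by simp
  have "fa ` e = e" if e: "e \<in> ug_edges (fst (rep c))" for e
  proof -
    have "e \<subseteq> ug_arcs (fst (rep c))" using G.Union_edges_subset[OF subset_refl] e by blast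
    then show ?thesis using fix_arc by force
  qed
  moreover have "supp l' \<subseteq> ug_edges (fst (rep c))"
    using l(2) by (simp add: teich_open_cone_def open_length_cone_def)
  ultimately have "coord l e = coord l' e" for e
    unfolding s(2) lookup_length_map by (auto simp: keys_subset_iff_lookup)
  then show ?thesis by (rule poly_mapping_eqI)
qed

section \<open>Points and cells of the glued space\<close>

lemma topspace_teichmueller: "topspace (pure_tropical_teichmueller g rep) = Sigma I \<sigma> // glue"
  by (simp add: pure_tropical_teichmueller_def glued_space_def comp_def)

text \<open>Inverse of the map that \<open>K\<close> induces on the glued space, hence the bijection
  from curve classes to points.\<close>

definition fibre :: "('v, 'a) marked_curve set \<Rightarrow> (('v, 'a) marked_graph set \<times> ('a set \<Rightarrow>\<^sub>0 real)) set" where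
  "fibre S = {p \<in> Sigma I \<sigma>. K p = S}"

lemma glue_class_eq_fibre:
  assumes "p \<in> Sigma I \<sigma>" shows "glue `` {p} = fibre (K p)"
proof (intro equalityI subsetI)
  fix q assume "q \<in> glue `` {p}"
  then have "(p, q) \<in> glue" by simp
  then show "q \<in> fibre (K p)" using glue_invariant by (simp add: fibre_def)
next
  fix q assume "q \<in> fibre (K p)"
  then show "q \<in> glue `` {p}" using glue_iff[OF assms] by (simp add: fibre_def)
qed

lemma K_in_quotient:
  assumes "p \<in> Sigma I \<sigma>" shows "K p \<in> marked_curves g // curve_equiv g"
proof -
  note x = curve_in_cone_curves[OF assms]
  obtain y where y: "y \<in> K p" using contracts_to_nonempty[OF x] by blast
  then have "y \<in> marked_curves g" by (simp add: contracts_to_def)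
  then show ?thesis unfolding contracts_to_eq_class[OF x y] by (rule quotientI)
qed

lemma K_surj:
  assumes "S \<in> marked_curves g // curve_equiv g"
  obtains p where "p \<in> Sigma I \<sigma>0" "p \<in> Sigma I \<sigma>" "K p = S"
proof -
  obtain y where y: "y \<in> marked_curves g" "S = curve_equiv g `` {y}" using assms by (rule quotientE)
  have yc: "y \<in> cone_curves g" using y(1) marked_curves_subset by blast
  obtain p fv fa where p: "p \<in> Sigma I \<sigma>0" "metric_specialization g y (curve p) {} fv fa"
    using curve_transport[OF y(1)] by metis
  have p': "p \<in> Sigma I \<sigma>" using p(1) open_cone_subset by auto
  have "K p = contracts_to g y"
    using contracts_to_invariant[OF p(2) yc curve_in_cone_curves[OF p']] by simp
  also have "\<dots> = S" unfolding y(2) by (rule contracts_to_eq_class[OF yc contracts_to_self[OF y(1)]])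
  finally show ?thesis using p(1) p' by (intro that)
qed

lemma bij_betw_fibre:
  "bij_betw fibre (marked_curves g // curve_equiv g) (topspace (pure_tropical_teichmueller g rep))"
  unfolding topspace_teichmueller
proof (rule bij_betw_imageI)
  show "inj_on fibre (marked_curves g // curve_equiv g)"
  proof (rule inj_onI)
    fix S S' assume S: "S \<in> marked_curves g // curve_equiv g" and eq: "fibre S = fibre S'"
    obtain p where "p \<in> Sigma I \<sigma>" "K p = S" using K_surj[OF S] by metis
    then have "p \<in> fibre S'" using eq by (auto simp: fibre_def)
    then show "S = S'" using \<open>K p = S\<close> by (simp add: fibre_def)
  qed
  show "fibre ` (marked_curves g // curve_equiv g) = Sigma I \<sigma> // glue"
  proof (intro equalityI subsetI)
    fix X assume "X \<in> fibre ` (marked_curves g // curve_equiv g)"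
    then obtain S where S: "S \<in> marked_curves g // curve_equiv g" "X = fibre S" by blast
    obtain p where p: "p \<in> Sigma I \<sigma>" "K p = S" using K_surj[OF S(1)] by metis
    then have "X = glue `` {p}" using glue_class_eq_fibre S(2) by simp
    then show "X \<in> Sigma I \<sigma> // glue" using p(1) by (simp only: quotientI)
  next
    fix X assume "X \<in> Sigma I \<sigma> // glue"
    then obtain p where p: "p \<in> Sigma I \<sigma>" "X = glue `` {p}" by (rule quotientE)
    then have "X = fibre (K p)" using glue_class_eq_fibre by simp
    then show "X \<in> fibre ` (marked_curves g // curve_equiv g)" using K_in_quotient[OF p(1)] by blast
  qed
qed

lemma glued_point_eq_fibre:
  "c \<in> I \<Longrightarrow> l \<in> \<sigma>0 c \<Longrightarrow> glued_point I \<sigma> A c l = fibre (K (c, l))"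
  unfolding glued_point_def using open_cone_subset by (intro glue_class_eq_fibre) auto

text \<open>The first conclusion makes the cells of distinct classes disjoint, the second makes each
  open cone inject into the glued space.\<close>

lemma glued_point_eqD:
  assumes "c \<in> I" "l \<in> \<sigma>0 c" "c' \<in> I" "l' \<in> \<sigma>0 c'" "glued_point I \<sigma> A c l = glued_point I \<sigma> A c' l'"
  shows "c = c'" "l = l'"
proof -
  have in\<sigma>: "(c, l) \<in> Sigma I \<sigma>" using assms(1,2) open_cone_subset by auto
  then have "(c, l) \<in> fibre (K (c, l))" by (simp add: fibre_def)
  then have "(c, l) \<in> fibre (K (c', l'))" using assms by (simp add: glued_point_eq_fibre)
  then have K: "K (c, l) = K (c', l')" by (simp add: fibre_def)
  show "c = c'" using open_points_same_class[of "(c, l)" "(c', l')"] assms(1-4) K by auto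
  then show "l = l'" using open_points_rigid assms(1,2,4) K by simp
qed

lemma rel_interior_teich_cone: "c \<in> I \<Longrightarrow> rel_interior (\<sigma> c) = \<sigma>0 c"
  unfolding teich_cone_def teich_open_cone_def by (rule rel_interior_length_cone[OF rep_fcg])

lemma ideal_stacky_fan_teichmueller:
  "ideal_stacky_fan (pure_tropical_teichmueller g rep) I (teich_lattice rep) \<sigma> A"
  unfolding ideal_stacky_fan_def
proof (intro conjI ballI)
  show "is_lattice (teich_lattice rep c)" "ideal_cone (teich_lattice rep c) (\<sigma> c)" if "c \<in> I" for c
    unfolding teich_lattice_def teich_cone_def
    using is_lattice_length_lattice[OF rep_fcg[OF that]] ideal_cone_length_cone[OF rep_fcg[OF that]] by simp_all
  show "case t of (i, j, L) \<Rightarrow> i \<in> I \<and> j \<in> I \<and>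
      lattice_preserving_inclusion (teich_lattice rep i) (\<sigma> i) (teich_lattice rep j) (\<sigma> j) L" if "t \<in> A" for t
  proof -
    from that obtain c c' F fv fa where c: "c \<in> I" "c' \<in> I" "specialization g (rep c) (rep c') F fv fa"
      "t = (c', c, length_map (fst (rep c)) F fa)"
      unfolding teich_maps_def by blast
    show ?thesis
      using length_map_lattice_preserving[OF specialization_rep_contraction[OF c(1-3)] rep_fcg[OF c(1)]] c(1,2,4)
      by (simp add: teich_lattice_def teich_cone_def)
  qed
  show "pure_tropical_teichmueller g rep = glued_space I \<sigma> A"
    by (rule pure_tropical_teichmueller_def)
  show "topspace (pure_tropical_teichmueller g rep) = (\<Union>i \<in> I. glued_point I \<sigma> A i ` rel_interior (\<sigma> i))"
  proof (intro equalityI subsetI)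
    fix X assume "X \<in> topspace (pure_tropical_teichmueller g rep)"
    then obtain S where S: "S \<in> marked_curves g // curve_equiv g" "X = fibre S"
      using bij_betw_imp_surj_on[OF bij_betw_fibre] by blast
    obtain p where p: "p \<in> Sigma I \<sigma>0" "K p = S" using K_surj[OF S(1)] by metis
    obtain c l where cl: "p = (c, l)" by (rule prod.exhaust)
    have "X = glued_point I \<sigma> A c l" using S(2) p cl glued_point_eq_fibre by auto
    then show "X \<in> (\<Union>i \<in> I. glued_point I \<sigma> A i ` rel_interior (\<sigma> i))"
      using p(1) cl rel_interior_teich_cone by auto
  next
    fix X assume "X \<in> (\<Union>i \<in> I. glued_point I \<sigma> A i ` rel_interior (\<sigma> i))"
    then obtain c l where cl: "c \<in> I" "l \<in> \<sigma>0 c" "X = glued_point I \<sigma> A c l"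
      using rel_interior_teich_cone by auto
    then have "(c, l) \<in> Sigma I \<sigma>" using open_cone_subset by auto
    then show "X \<in> topspace (pure_tropical_teichmueller g rep)"
      unfolding topspace_teichmueller cl(3) glued_point_def by (rule quotientI)
  qed
  show "disjoint_family_on (\<lambda>i. glued_point I \<sigma> A i ` rel_interior (\<sigma> i)) I"
    unfolding disjoint_family_on_def using glued_point_eqD(1) rel_interior_teich_cone by auto
qed

end

theorem proposition3p1p9:
  fixes g :: nat
    and rep :: "(nat, nat) marked_graph set \<Rightarrow> (nat, nat) marked_graph"
  assumes "1 \<le> g"
    and "\<And>c. c \<in> marked_classes g \<Longrightarrow> rep c \<in> c"
  shows
    "ideal_stacky_fan (pure_tropical_teichmueller g rep)
        (marked_classes g) (teich_lattice rep) (teich_cone rep) (teich_maps g rep) \<and>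
     (\<forall>c \<in> marked_classes g.
        rel_interior (teich_cone rep c) = teich_open_cone rep c \<and>
        inj_on (teich_point g rep c) (teich_open_cone rep c)) \<and>
     (\<exists>\<Phi>. bij_betw \<Phi> (marked_curves g // curve_equiv g)
              (topspace (pure_tropical_teichmueller g rep)) \<and>
        (\<forall>c \<in> marked_classes g. \<forall>G h l. rep c = (G, h) \<and> l \<in> teich_open_cone rep c \<longrightarrow>
           \<Phi> (curve_equiv g `` {(G, l, h)}) = teich_point g rep c l))"
proof -
  interpret teichmueller g rep by unfold_locales (rule assms(2))
  have inj: "inj_on (teich_point g rep c) (teich_open_cone rep c)" if "c \<in> marked_classes g" for c
    using glued_point_eqD(2)[OF that _ that] by (auto simp: inj_on_def teich_point_def)
  \<comment> \<open>The curve of an open point already has positive lengths, so it lies in its own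
    \<open>K\<close>-set, which is therefore the class of \<open>(G, l, h)\<close>.\<close>
  have "fibre (curve_equiv g `` {(G, l, h)}) = teich_point g rep c l"
    if c: "c \<in> marked_classes g" and r: "rep c = (G, h)" and l: "l \<in> teich_open_cone rep c" for c G h l
  proof -
    have m: "curve (c, l) \<in> marked_curves g" using c l by (intro curve_in_marked_curves) simp
    then have "curve (c, l) \<in> cone_curves g" using marked_curves_subset by blast
    from contracts_to_eq_class[OF this contracts_to_self[OF m]]
    have "K (c, l) = curve_equiv g `` {(G, l, h)}" by (simp add: curve_def r)
    then show ?thesis using glued_point_eq_fibre[OF c l] by (simp add: teich_point_def)
  qed
  then show ?thesis
    using ideal_stacky_fan_teichmueller rel_interior_teich_cone inj bij_betw_fibre by blast
qed

end
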